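(* Let $\nu$ be a lattice path from $(0,0)$ to $(a,b)$ and let $w$ be the number of valleys of $\overline{\nu}=E\nu N$. The simplex-subdivision $\mathcal{F}_{\widetilde{G}_B(\nu)}=\bigcup_{i=1}^w\mathcal{Q}_i$ is encoded in the polynomial $$P_\nu=\sum_{\substack{S\subseteq[w]\\ S\neq\emptyset}}\beta^{|S|-1}\,M\Big(\bigcap_{i\in S}G(\nu,i)\Big)$$ of the subdivision algebra $\mathcal{S}(\beta)$. Furthermore, reducing $P_\nu$ in the subdivision algebra encodes subdivisions of $\mathcal{F}_{\widetilde{G}_B(\nu)}$.
   Context: Generalized flow polytopes: for a finite graph on a totally ordered vertex set with forward edges $(i,j,+)$ (flow $\ge 0$, traversed $i\to j$), backward edges $(i,j,-)$ (flow $\le 0$, traversed $j\to i$) and bidirectional edges $(i,j,\pm)$ (flow in $\mathbb{R}$), where $i<j$, $\mathcal{F}_G\subseteq\mathbb{R}^{E(G)}$ is the set of flows with netflow $\sum_{e=\{j,k\},k>j}x_e-\sum_{e=\{i,j\},i<j}x_e$ equal to $1$ at the smallest vertex (source), $-1$ at the largest (sink), $0$ elsewhere. A route is a directed source-to-sink path using edges in allowed directions; its signed characteristic vector has entry $1$ on edges traversed from smaller to larger endpoint, $-1$ on edges traversed the other way, $0$ elsewhere. Two lattice polytopes are integrally equivalent if an affine map restricts to a bijection between them and between the lattice points of their affine spans. Path data: $\nu$ uses steps $E=(1,0)$, $N=(0,1)$. Canonical indexing of $\overline{\nu}$: reading left to right each letter gets the next positive integer, except an $N$ immediately preceded by $E$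 gets that $E$'s index. $n$ = largest index, $I$ = indices of $E$ steps, $J$ = indices of $N$ steps, $I\cap J=\{v_1<\dots<v_w\}$. $G(\nu)$: vertex set $[n]$, forward edge $(i,j,+)$ for $i\in I$, $j\in J$, $i<j$, iff every consecutive $EN$ pair in the factor $E_i\cdots N_j$ of $\overline{\nu}$ is $E_kN_k$ with $k\in\{i,j\}$. $G_B(\nu)$: same, with the edges $(v_k,v_{k+1})$ bidirectional. For $1\le i<w$, $G(\nu,i)$ is $G(\nu)$ with edge $(v_i,v_{i+1},+)$ deleted and backward edge $(v_1,v_w,-)$ (from $v_w$ to $v_1$) added; $G(\nu,w)=G(\nu)$. $\bigcap_{i\in S}G(\nu,i)$ is the graph of edges common to all $G(\nu,i)$, $i\in S$. Partial augmentation $\widetilde{H}$ of a graph $H$ on $[n]$: add source $s$, sink $t$ and forward edges $(s,i)$, $i\in I$, and $(j,t)$, $j\in J$. Simplex-subdivision: in $\mathbb{R}^{E(\widetilde{G}_B(\nu))}$, for $1\le i<w$, $\mathcal{Q}_i$ is the convex hull of signed characteristic vectors of routes of $\widetilde{G}_B(\nu)$ which do not traverse $\{v_i,v_{i+1}\}$ from $v_i$ to $v_{i+1}$ and which, if they traverse any edge from larger to smaller endpoint, traverse $\{v_i,v_{i+1}\}$ from $v_{i+1}$ to $v_i$; $\mathcal{Q}_w=\mathcal{F}_{\widetilde{G}(\nu)}$ (routes traversing all edges from smaller to larger endpoint). These have pairwise disjoint interiors and union $\mathcal{F}_{\widetilde{G}_B(\nu)}$. Subdivision algebra $\mathcal{S}(\beta)$: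 the commutative associative algebra over $\mathbb{Z}[\beta]$ generated by $\{x_{ij}: i\neq j\}$ subject to $x_{ij}x_{jk}=x_{ik}x_{ij}+x_{jk}x_{ik}+\beta x_{ik}$ for $i\neq k$. For fixed $i,j,k$, replacing every occurrence of $x_{ij}x_{jk}$ in a polynomial by $x_{ik}x_{ij}+x_{jk}x_{ik}+\beta x_{ik}$ is a reduction. For a graph $H$ with forward and backward edges, $M(H)=\prod_{(i,j,+)\in E(H)}x_{ij}\prod_{(i,j,-)\in E(H)}x_{ji}$ (so a generator $x_{pq}$ is an edge traversed from $p$ to $q$). Encoding convention: a polynomial in $\mathcal{S}(\beta)$ whose terms are of the form $\beta^kM(H)$ encodes a polyhedral subdivision of $\mathcal{F}_{\widetilde{G}_B(\nu)}$ when the interior faces of the subdivision correspond to its terms, a term $\beta^kM(H)$ corresponding to an interior face of codimension $k$ that is integrally equivalent to $\mathcal{F}_{\widetilde{H}}$; a reduction at $x_{ij}x_{jk}$ corresponds to cutting by the hyperplane $x_{\{i,j\}}=x_{\{j,k\}}$. *)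

theory Defs
  imports
    "HOL-Analysis.Analysis"
    "HOL-Analysis.Finite_Function_Topology"
    "HOL-Library.Poly_Mapping"
    "HOL-Computational_Algebra.Polynomial"
begin

section \<open>Graphs, flows and routes\<close>

datatype esign = Fwd | Bwd | Bidir

text \<open>
  Vertices are natural numbers with their usual order, and an edge is stored with its smaller
  endpoint first: \<open>(i, j, Fwd)\<close>, \<open>(i, j, Bwd)\<close> and \<open>(i, j, Bidir)\<close> are the edges
  \<open>(i,j,+)\<close>, \<open>(i,j,-)\<close> and \<open>(i,j,\<plusminus>)\<close>.
\<close>

record graph =
  verts :: "nat set"
  edges :: "(nat \<times> nat \<times> esign) set"

definition edge_pairs :: "graph \<Rightarrow> (nat \<times> nat) set" where
  "edge_pairs G = (\<lambda>(i, j, \<sigma>). (i, j)) ` edges G"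

definition wf_graph :: "graph \<Rightarrow> bool" where
  "wf_graph G \<longleftrightarrow> finite (verts G) \<and>
     (\<forall>(i, j, \<sigma>) \<in> edges G. i \<in> verts G \<and> j \<in> verts G \<and> i < j) \<and>
     (\<forall>i j \<sigma> \<tau>. (i, j, \<sigma>) \<in> edges G \<and> (i, j, \<tau>) \<in> edges G \<longrightarrow> \<sigma> = \<tau>)"

text \<open>
  The graphs are simple, so an edge is determined by its pair of endpoints. The space
  \<open>\<real>\<close> to the power \<open>E(G)\<close> is the set of finitely supported functions on pairs that vanish
  off \<open>edge_pairs G\<close>. Thus graphs with the same underlying pairs, such as
  \<open>G(\<nu>)\<close> and \<open>G\<^sub>B(\<nu>)\<close>, have their flows in the same space.
\<close>

type_synonym flow = "(nat \<times> nat) \<Rightarrow>\<^sub>0 real"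

definition netflow :: "graph \<Rightarrow> flow \<Rightarrow> nat \<Rightarrow> real" where
  "netflow G x v =
     (\<Sum>e \<in> {e \<in> edge_pairs G. fst e = v}. Poly_Mapping.lookup x e) -
     (\<Sum>e \<in> {e \<in> edge_pairs G. snd e = v}. Poly_Mapping.lookup x e)"

definition flow_polytope :: "graph \<Rightarrow> flow set" where
  "flow_polytope G = {x.
     Poly_Mapping.keys x \<subseteq> edge_pairs G \<and>
     (\<forall>i j. (i, j, Fwd) \<in> edges G \<longrightarrow> Poly_Mapping.lookup x (i, j) \<ge> 0) \<and>
     (\<forall>i j. (i, j, Bwd) \<in> edges G \<longrightarrow> Poly_Mapping.lookup x (i, j) \<le> 0) \<and>
     (\<forall>v \<in> verts G. netflow G x v =
        (if v = Min (verts G) then 1 else if v = Max (verts G) then -1 else 0))}"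

definition traversable :: "graph \<Rightarrow> nat \<Rightarrow> nat \<Rightarrow> bool" where
  "traversable G p q \<longleftrightarrow>
     (p < q \<and> ((p, q, Fwd) \<in> edges G \<or> (p, q, Bidir) \<in> edges G)) \<or>
     (q < p \<and> ((q, p, Bwd) \<in> edges G \<or> (q, p, Bidir) \<in> edges G))"

definition path_steps :: "nat list \<Rightarrow> (nat \<times> nat) set" where
  "path_steps r = set (zip r (tl r))"

definition is_route :: "graph \<Rightarrow> nat list \<Rightarrow> bool" where
  "is_route G r \<longleftrightarrow> r \<noteq> [] \<and> distinct r \<and> hd r = Min (verts G) \<and> last r = Max (verts G) \<and>
     (\<forall>(p, q) \<in> path_steps r. traversable G p q)"

definition signed_char_vec :: "nat list \<Rightarrow> flow" where
  "signed_char_vec r = (\<Sum>(p, q) \<in> path_steps r.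
     if p < q then Poly_Mapping.single (p, q) 1 else Poly_Mapping.single (q, p) (-1))"


section \<open>Polytopes\<close>

text \<open>
  The library's \<open>aff_dim\<close> is restricted to Euclidean-space types. The dimension of a nonempty
  polytope is the dimension of the direction space of its affine hull.
\<close>

definition pdim :: "'a::real_vector set \<Rightarrow> nat" where
  "pdim P = dim {x - y | x y. x \<in> P \<and> y \<in> P}"

definition polytope_boundary :: "'a::real_vector set \<Rightarrow> 'a set" where
  "polytope_boundary P = \<Union>{F. F face_of P \<and> F \<noteq> P}"

text \<open>A subdivision is given by its set of maximal cells.\<close>

definition polyhedral_subdivision :: "'a::real_vector set \<Rightarrow> 'a set set \<Rightarrow> bool" where
  "polyhedral_subdivision P \<C> \<longleftrightarrow> finite \<C> \<and> \<Union>\<C> = P \<and>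
     (\<forall>C \<in> \<C>. polytope C \<and> C \<noteq> {} \<and> pdim C = pdim P) \<and>
     (\<forall>C \<in> \<C>. \<forall>D \<in> \<C>. (C \<inter> D) face_of C \<and> (C \<inter> D) face_of D)"

definition interior_faces :: "'a::real_vector set \<Rightarrow> 'a set set \<Rightarrow> 'a set set" where
  "interior_faces P \<C> = {F. (\<exists>C \<in> \<C>. F face_of C) \<and> \<not> F \<subseteq> polytope_boundary P}"

definition lattice_points :: "flow set" where
  "lattice_points = {x. \<forall>e. Poly_Mapping.lookup x e \<in> \<int>}"

definition lattice_polytope :: "flow set \<Rightarrow> bool" where
  "lattice_polytope P \<longleftrightarrow> (\<exists>V. finite V \<and> V \<subseteq> lattice_points \<and> P = convex hull V)"

definition affine_map :: "(flow \<Rightarrow> flow) \<Rightarrow> bool" where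
  "affine_map f \<longleftrightarrow> (\<exists>L c. linear L \<and> f = (\<lambda>x. L x + c))"

definition integral_equivalence :: "(flow \<Rightarrow> flow) \<Rightarrow> flow set \<Rightarrow> flow set \<Rightarrow> bool" where
  "integral_equivalence f P Q \<longleftrightarrow> lattice_polytope P \<and> lattice_polytope Q \<and> affine_map f \<and>
     bij_betw f P Q \<and>
     bij_betw f (affine hull P \<inter> lattice_points) (affine hull Q \<inter> lattice_points)"


section \<open>Lattice paths and their graphs\<close>

datatype step = East | North

definition lattice_path :: "step list \<Rightarrow> nat \<Rightarrow> nat \<Rightarrow> bool" where
  "lattice_path \<nu> a b \<longleftrightarrow> count_list \<nu> East = a \<and> count_list \<nu> North = b"

definition ext_path :: "step list \<Rightarrow> step list" where
  "ext_path \<nu> = East # \<nu> @ [North]"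

text \<open>\<open>canon_index \<mu> p\<close> is the canonical index of the letter at (0-based) position \<open>p\<close>.\<close>

primrec canon_index :: "step list \<Rightarrow> nat \<Rightarrow> nat" where
  "canon_index \<mu> 0 = 1"
| "canon_index \<mu> (Suc p) =
     (if \<mu> ! p = East \<and> \<mu> ! Suc p = North then canon_index \<mu> p else canon_index \<mu> p + 1)"

definition path_n :: "step list \<Rightarrow> nat" where
  "path_n \<nu> = Max (canon_index (ext_path \<nu>) ` {..<length (ext_path \<nu>)})"

definition E_indices :: "step list \<Rightarrow> nat set" where
  "E_indices \<nu> = {canon_index (ext_path \<nu>) p | p. p < length (ext_path \<nu>) \<and> ext_path \<nu> ! p = East}"

definition N_indices :: "step list \<Rightarrow> nat set" where
  "N_indices \<nu> = {canon_index (ext_path \<nu>) p | p. p < length (ext_path \<nu>) \<and> ext_path \<nu> ! p = North}"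

definition num_valleys :: "step list \<Rightarrow> nat" where
  "num_valleys \<nu> = card (E_indices \<nu> \<inter> N_indices \<nu>)"

text \<open>The valley indices, numbered from 1 in increasing order.\<close>

definition valley :: "step list \<Rightarrow> nat \<Rightarrow> nat" where
  "valley \<nu> k = sorted_list_of_set (E_indices \<nu> \<inter> N_indices \<nu>) ! (k - 1)"

text \<open>Below, \<open>p\<close> and \<open>q\<close> are the positions of \<open>E\<^sub>i\<close> and \<open>N\<^sub>j\<close>.\<close>

definition G_path :: "step list \<Rightarrow> graph" where
  "G_path \<nu> = (let \<mu> = ext_path \<nu> in
     \<lparr>verts = {1..path_n \<nu>},
      edges = {(i, j, Fwd) | i j. i < j \<and>
        (\<exists>p q. p < q \<and> q < length \<mu> \<and>
           \<mu> ! p = East \<and> canon_index \<mu> p = i \<and> \<mu> ! q = North \<and> canon_index \<mu> q = j \<and>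
           (\<forall>r. p \<le> r \<and> Suc r \<le> q \<and> \<mu> ! r = East \<and> \<mu> ! Suc r = North
              \<longrightarrow> canon_index \<mu> r \<in> {i, j}))}\<rparr>)"

definition valley_pairs :: "step list \<Rightarrow> (nat \<times> nat) set" where
  "valley_pairs \<nu> = {(valley \<nu> k, valley \<nu> (k + 1)) | k. 1 \<le> k \<and> k < num_valleys \<nu>}"

definition GB_path :: "step list \<Rightarrow> graph" where
  "GB_path \<nu> = \<lparr>verts = {1..path_n \<nu>},
     edges = {(i, j, Fwd) | i j. (i, j, Fwd) \<in> edges (G_path \<nu>) \<and> (i, j) \<notin> valley_pairs \<nu>} \<union>
             {(i, j, Bidir) | i j. (i, j) \<in> valley_pairs \<nu>}\<rparr>"

definition Gi_path :: "step list \<Rightarrow> nat \<Rightarrow> graph" where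
  "Gi_path \<nu> i = (if i = num_valleys \<nu> then G_path \<nu> else
     \<lparr>verts = {1..path_n \<nu>},
      edges = (edges (G_path \<nu>) - {(valley \<nu> i, valley \<nu> (i + 1), Fwd)}) \<union>
              {(valley \<nu> 1, valley \<nu> (num_valleys \<nu>), Bwd)}\<rparr>)"

definition Gi_inter :: "step list \<Rightarrow> nat set \<Rightarrow> graph" where
  "Gi_inter \<nu> S = \<lparr>verts = {1..path_n \<nu>}, edges = (\<Inter>i \<in> S. edges (Gi_path \<nu> i))\<rparr>"

text \<open>The source is \<open>0\<close> and the sink is \<open>n + 1\<close>.\<close>

definition partial_aug :: "step list \<Rightarrow> graph \<Rightarrow> graph" where
  "partial_aug \<nu> H = \<lparr>verts = {0..path_n \<nu> + 1},
     edges = edges H \<union> {(0, i, Fwd) | i. i \<in> E_indices \<nu>} \<union>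
             {(j, path_n \<nu> + 1, Fwd) | j. j \<in> N_indices \<nu>}\<rparr>"

definition cyclic_flow_polytope :: "step list \<Rightarrow> flow set" where
  "cyclic_flow_polytope \<nu> = flow_polytope (partial_aug \<nu> (GB_path \<nu>))"

definition Q_cell :: "step list \<Rightarrow> nat \<Rightarrow> flow set" where
  "Q_cell \<nu> i = (if i = num_valleys \<nu> then flow_polytope (partial_aug \<nu> (G_path \<nu>)) else
     convex hull (signed_char_vec ` {r. is_route (partial_aug \<nu> (GB_path \<nu>)) r \<and>
       (valley \<nu> i, valley \<nu> (i + 1)) \<notin> path_steps r \<and>
       ((\<exists>(p, q) \<in> path_steps r. q < p) \<longrightarrow> (valley \<nu> (i + 1), valley \<nu> i) \<in> path_steps r)}))"

definition simplex_subdivision :: "step list \<Rightarrow> flow set set" where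
  "simplex_subdivision \<nu> = Q_cell \<nu> ` {1..num_valleys \<nu>}"


section \<open>The subdivision algebra\<close>

text \<open>
  Polynomials in commuting variables \<open>x\<^sub>p\<^sub>q\<close> over \<open>\<int>[\<beta>]\<close>: a monomial is its exponent function
  and \<open>\<int>[\<beta>]\<close> is \<^typ>\<open>int poly\<close>. Only the variables with \<open>p \<noteq> q\<close> are generators of
  \<open>\<S>(\<beta>)\<close>; the variables with \<open>p = q\<close> occur in no relation and in no polynomial considered below.
\<close>

type_synonym monomial = "(nat \<times> nat) \<Rightarrow>\<^sub>0 nat"
type_synonym spoly = "monomial \<Rightarrow>\<^sub>0 int poly"

definition beta :: spoly where
  "beta = Poly_Mapping.single 0 (monom 1 1)"

definition xvar :: "nat \<Rightarrow> nat \<Rightarrow> spoly" where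
  "xvar p q = Poly_Mapping.single (Poly_Mapping.single (p, q) 1) 1"

definition replacement :: "nat \<Rightarrow> nat \<Rightarrow> nat \<Rightarrow> spoly" where
  "replacement i j k = xvar i k * xvar i j + xvar j k * xvar i k + beta * xvar i k"

definition valid_triple :: "nat \<times> nat \<times> nat \<Rightarrow> bool" where
  "valid_triple t \<longleftrightarrow> (case t of (i, j, k) \<Rightarrow> i \<noteq> j \<and> j \<noteq> k \<and> i \<noteq> k)"

text \<open>
  The ideal of relations; \<open>\<S>(\<beta>)\<close> is the quotient by it, and two polynomials are the same element
  of \<open>\<S>(\<beta>)\<close> iff their difference lies in the ideal.
\<close>

inductive_set subdivision_ideal :: "spoly set" where
  zero: "0 \<in> subdivision_ideal"
| add: "p \<in> subdivision_ideal \<Longrightarrow> valid_triple (i, j, k) \<Longrightarrow>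
        p + q * (xvar i j * xvar j k - replacement i j k) \<in> subdivision_ideal"

definition eq_in_subdivision_algebra :: "spoly \<Rightarrow> spoly \<Rightarrow> bool" where
  "eq_in_subdivision_algebra p q \<longleftrightarrow> p - q \<in> subdivision_ideal"

text \<open>
  In a monomial \<open>m\<close> the product \<open>x\<^sub>i\<^sub>j x\<^sub>j\<^sub>k\<close> occurs \<open>c\<close> times, where \<open>c\<close> is the smaller of the two
  exponents. All of these occurrences, in all monomials, are replaced at once.
\<close>

definition reduce :: "nat \<times> nat \<times> nat \<Rightarrow> spoly \<Rightarrow> spoly" where
  "reduce t p = (case t of (i, j, k) \<Rightarrow>
     (\<Sum>m \<in> Poly_Mapping.keys p.
        let c = min (Poly_Mapping.lookup m (i, j)) (Poly_Mapping.lookup m (j, k)) in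
        Poly_Mapping.single
          (m - Poly_Mapping.single (i, j) c - Poly_Mapping.single (j, k) c) (Poly_Mapping.lookup p m)
        * replacement i j k ^ c))"

text \<open>Powers of \<open>\<beta>\<close> are part of a term: \<open>\<beta> m\<close> and \<open>m\<close> are different terms.\<close>

definition terms :: "spoly \<Rightarrow> spoly set" where
  "terms p = {Poly_Mapping.single m (monom (coeff (Poly_Mapping.lookup p m) k) k) | m k.
                coeff (Poly_Mapping.lookup p m) k \<noteq> 0}"

definition M_graph :: "graph \<Rightarrow> spoly" where
  "M_graph H = (\<Prod>(i, j) \<in> {(i, j). (i, j, Fwd) \<in> edges H}. xvar i j) *
               (\<Prod>(i, j) \<in> {(i, j). (i, j, Bwd) \<in> edges H}. xvar j i)"

definition P_poly :: "step list \<Rightarrow> spoly" where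
  "P_poly \<nu> = (\<Sum>S \<in> {S. S \<subseteq> {1..num_valleys \<nu>} \<and> S \<noteq> {}}.
     beta ^ (card S - 1) * M_graph (Gi_inter \<nu> S))"


section \<open>Encoding of subdivisions\<close>

definition fwd_bwd_graph_on :: "nat \<Rightarrow> graph \<Rightarrow> bool" where
  "fwd_bwd_graph_on n H \<longleftrightarrow> wf_graph H \<and> verts H = {1..n} \<and>
     (\<forall>(i, j, \<sigma>) \<in> edges H. \<sigma> = Fwd \<or> \<sigma> = Bwd)"

text \<open>
  \<open>h\<close> and \<open>T\<close> record the encoding: the term of an interior face \<open>F\<close> is \<open>\<beta>\<close> to the codimension
  times \<open>M (h F)\<close>, and \<open>T F\<close> is an integral equivalence from the flow polytope of the partial
  augmentation of \<open>h F\<close> onto \<open>F\<close>. Since \<open>F\<close> ranges bijectively over \<open>terms p\<close>, every coefficient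
  of \<open>p\<close> is \<open>1\<close>.
\<close>

definition encodes_via ::
  "step list \<Rightarrow> spoly \<Rightarrow> flow set set \<Rightarrow> (flow set \<Rightarrow> graph) \<Rightarrow> (flow set \<Rightarrow> flow \<Rightarrow> flow) \<Rightarrow> bool"
where
  "encodes_via \<nu> p \<C> h T \<longleftrightarrow> (let P = cyclic_flow_polytope \<nu> in
     polyhedral_subdivision P \<C> \<and>
     bij_betw (\<lambda>F. beta ^ (pdim P - pdim F) * M_graph (h F)) (interior_faces P \<C>) (terms p) \<and>
     (\<forall>F \<in> interior_faces P \<C>. fwd_bwd_graph_on (path_n \<nu>) (h F) \<and>
        integral_equivalence (T F) (flow_polytope (partial_aug \<nu> (h F))) F))"

definition encodes :: "step list \<Rightarrow> spoly \<Rightarrow> flow set set \<Rightarrow> bool" where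
  "encodes \<nu> p \<C> \<longleftrightarrow> (\<exists>h T. encodes_via \<nu> p \<C> h T)"

text \<open>
  The amount of flow along an edge in its direction of traversal from \<open>p\<close> to \<open>q\<close>. The coordinate of
  a backward edge is nonpositive, so the cutting hyperplane \<open>x\<^sub>i\<^sub>j = x\<^sub>j\<^sub>k\<close> compares these amounts.
\<close>

definition flow_along :: "nat \<Rightarrow> nat \<Rightarrow> flow \<Rightarrow> real" where
  "flow_along p q y = (if p < q then Poly_Mapping.lookup y (p, q) else - Poly_Mapping.lookup y (q, p))"

text \<open>
  Cutting a subdivision along the reduction at \<open>x\<^sub>i\<^sub>j x\<^sub>j\<^sub>k\<close>: a cell whose graph has both edges is cut,
  in the coordinates of its flow polytope, into two halves; the other cells are kept.
\<close>

definition cut_cell ::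
  "step list \<Rightarrow> nat \<times> nat \<times> nat \<Rightarrow> graph \<Rightarrow> (flow \<Rightarrow> flow) \<Rightarrow> flow set \<Rightarrow> flow set set" where
  "cut_cell \<nu> t H f C = (case t of (i, j, k) \<Rightarrow>
     if traversable H i j \<and> traversable H j k then
       {f ` {y \<in> flow_polytope (partial_aug \<nu> H). flow_along i j y \<ge> flow_along j k y},
        f ` {y \<in> flow_polytope (partial_aug \<nu> H). flow_along i j y \<le> flow_along j k y}}
     else {C})"

definition cut_subdivision ::
  "step list \<Rightarrow> nat \<times> nat \<times> nat \<Rightarrow> (flow set \<Rightarrow> graph) \<Rightarrow> (flow set \<Rightarrow> flow \<Rightarrow> flow)
     \<Rightarrow> flow set set \<Rightarrow> flow set set" where
  "cut_subdivision \<nu> t h T \<C> = (\<Union>C \<in> \<C>. cut_cell \<nu> t (h C) (T C) C)"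

end

theory Submission
  imports Defs
begin

text \<open>
  The graph underlying \<open>G(\<nu>)\<close> is a caterpillar: a path through the valleys with pendant leaves. In a
  tree a flow is determined by its net supplies, so a point of the polytope amounts to a pair of
  distributions \<open>p\<close> on \<open>I\<close> (at the source) and \<open>q\<close> on \<open>J\<close> (at the sink), and for a forest \<open>S\<close> of edges
  from \<open>I\<close> to \<open>J\<close> the flow polytope of its partial augmentation is integrally equivalent to the cell of
  all points for which \<open>p - q\<close> lies in the cone spanned by the vectors \<open>e\<^sub>a - e\<^sub>b\<close>, \<open>(a, b) \<in> S\<close>; this
  equivalence is the restriction of one linear map that does not depend on \<open>S\<close>. Subdivisions thus come
  from families of spanning trees whose cones form a complete unimodular fan. The interior faces are the
  cells of the subforests that cover all vertices other than valleys, and distinct subforests have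
  distinct cells, hence distinct monomials. The cell \<open>Q\<^sub>i\<close> consists of the points for which the \<open>i\<close>-th
  path edge carries the least flow (an edge closing the cycle carries \<open>0\<close>). A reduction at
  \<open>x\<^sub>i\<^sub>j x\<^sub>j\<^sub>k\<close> replaces the trees containing both edges by the two trees obtained by rerouting along
  \<open>i \<rightarrow> k\<close>; this again gives such a fan, and it has the right effect on the covering subforests because
  \<open>j\<close>, having edges in both directions, is a valley.
\<close>


section \<open>The indices of a lattice path\<close>

text \<open>Every reduction acts on all interior faces at once, so the invariant has to survive an
  arbitrary sequence of cuts. \<open>tree_fan\<close> manages this by speaking only of nonnegative
  coefficients on arcs with a given boundary. Uniqueness across any two trees of the family yields
  three facts together: the vectors of one tree are independent, two cells meet in the cell of their
  common arcs, and different covering subforests have different cells. A cut merely moves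
  coefficients along the relation (e_i - e_j) + (e_j - e_k) = e_i - e_k; which of the two arcs
  becomes empty is decided by comparing their coefficients. Valleys are exempt from the covering
  condition because a point is off the boundary exactly when all its source and sink flows are
  positive. At a vertex only in I or only in J such a flow must use an arc of the forest, whereas at
  a valley it can pass from the source straight to the sink. The exponent of \<beta> counts missing
  arcs: every tree has n - 1 arcs, and each arc dropped lowers the dimension of the cell by
  one.\<close>

lemma canon_index_mono: "p \<le> q \<Longrightarrow> canon_index \<mu> p \<le> canon_index \<mu> q"
  by (rule lift_Suc_mono_le[of "canon_index \<mu>"]) auto

text \<open>Every step other than an \<open>EN\<close> pair raises the index, and two successive
  steps cannot both be \<open>EN\<close> pairs, since the middle letter would have to be
  both.\<close>

lemma canon_index_eqD:
  assumes "canon_index \<mu> p = canon_index \<mu> q" "p < q"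
  shows "q = Suc p \<and> \<mu> ! p = East \<and> \<mu> ! q = North"
proof -
  have step: "\<mu> ! r = East \<and> \<mu> ! Suc r = North" if "p \<le> r" "Suc r \<le> q" for r
  proof (rule ccontr)
    assume "\<not> ?thesis"
    then have "canon_index \<mu> (Suc r) = canon_index \<mu> r + 1"
      by auto
    moreover have "canon_index \<mu> p \<le> canon_index \<mu> r" "canon_index \<mu> (Suc r) \<le> canon_index \<mu> q"
      using that canon_index_mono[of p r \<mu>] canon_index_mono[of "Suc r" q \<mu>] by blast+
    ultimately show False using assms by simp
  qed
  have "q = Suc p"
  proof (rule ccontr)
    assume "q \<noteq> Suc p"
    with assms have "Suc (Suc p) \<le> q" by simp
    with step[of p] step[of "Suc p"] show False by simp
  qed
  with step[of p] show ?thesis by auto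
qed

lemma canon_index_image:
  "canon_index \<mu> ` {..m} = {1..canon_index \<mu> m}"
proof (induction m)
  case (Suc m)
  have "canon_index \<mu> ` {..Suc m} = insert (canon_index \<mu> (Suc m)) {1..canon_index \<mu> m}"
    using Suc by (simp add: atMost_Suc)
  moreover have "1 \<le> canon_index \<mu> m" using canon_index_mono[of 0 m \<mu>] by simp
  ultimately show ?case by auto
qed auto

lemma ex_East_North:
  assumes "\<mu> ! p = East" "\<mu> ! q = North" "p < q"
  shows "\<exists>r. p \<le> r \<and> Suc r \<le> q \<and> \<mu> ! r = East \<and> \<mu> ! Suc r = North"
  using assms
proof (induction "q - p" arbitrary: p)
  case (Suc d)
  show ?case
  proof (cases "\<mu> ! Suc p")
    case East
    with Suc.prems have "Suc p < q" by (metis Suc_lessI step.distinct(1))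
    with Suc East have "\<exists>r. Suc p \<le> r \<and> Suc r \<le> q \<and> \<mu> ! r = East \<and> \<mu> ! Suc r = North"
      by (metis Suc_diff_Suc Suc_inject)
    then show ?thesis by (meson Suc_leD)
  next
    case North
    with Suc.prems show ?thesis by (intro exI[of _ p]) auto
  qed
qed auto

locale valley_path =
  fixes \<nu> :: "step list"
begin

abbreviation "n \<equiv> path_n \<nu>"
abbreviation "I \<equiv> E_indices \<nu>"
abbreviation "J \<equiv> N_indices \<nu>"
abbreviation "V \<equiv> I \<inter> J"
abbreviation "w \<equiv> num_valleys \<nu>"
abbreviation "\<mu> \<equiv> ext_path \<nu>"

lemma path_n_eq: "n = canon_index \<mu> (Suc (length \<nu>))"
proof -
  have "{..<length \<mu>} = {..Suc (length \<nu>)}"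
    by (auto simp: ext_path_def)
  then have "canon_index \<mu> ` {..<length \<mu>} = {1..canon_index \<mu> (Suc (length \<nu>))}"
    by (simp only: canon_index_image)
  moreover have "1 \<le> canon_index \<mu> (Suc (length \<nu>))"
    using canon_index_mono[of 0 _ \<mu>] by (metis canon_index.simps(1) zero_le)
  ultimately show ?thesis unfolding path_n_def
    by (simp only:) (rule Max_eqI; simp del: canon_index.simps)
qed

lemma I_Un_J: "I \<union> J = {1..n}"
proof -
  have "{..<length \<mu>} = {..Suc (length \<nu>)}"
    by (auto simp: ext_path_def)
  then have "canon_index \<mu> ` {..<length \<mu>} = {1..n}"
    by (simp only: canon_index_image path_n_eq)
  moreover have "I \<union> J = canon_index \<mu> ` {..<length \<mu>}"
    unfolding E_indices_def N_indices_def by (auto) (metis imageI lessThan_iff step.exhaust)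
  ultimately show ?thesis by simp
qed

lemma one_in_I: "1 \<in> I"
  unfolding E_indices_def by (force simp: ext_path_def intro!: exI[of _ 0])

lemma n_in_J: "n \<in> J"
  unfolding N_indices_def path_n_eq
  by (force simp: ext_path_def nth_append intro!: exI[of _ "Suc (length \<nu>)"])

lemma E_N_pair_valley:
  assumes "Suc r < length \<mu>" "\<mu> ! r = East" "\<mu> ! Suc r = North"
  shows "canon_index \<mu> r \<in> V"
proof -
  have "canon_index \<mu> r \<in> I" unfolding E_indices_def using assms by auto
  moreover have "canon_index \<mu> (Suc r) \<in> J" unfolding N_indices_def using assms by blast
  ultimately show ?thesis using assms by simp
qed

text \<open>If the letter \<open>E\<close> comes first, an \<open>EN\<close> pair lies on the way to
  \<open>N\<close>. If it comes second, monotonicity forces \<open>i = j\<close>, which is then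
  itself a valley.\<close>

lemma valley_between:
  assumes "i \<in> I" "j \<in> J" "i \<le> j"
  shows "\<exists>v\<in>V. i \<le> v \<and> v \<le> j"
proof -
  obtain p where p: "p < length \<mu>" "\<mu> ! p = East" "i = canon_index \<mu> p"
    using assms(1) unfolding E_indices_def by auto
  obtain q where q: "q < length \<mu>" "\<mu> ! q = North" "j = canon_index \<mu> q"
    using assms(2) unfolding N_indices_def by auto
  consider "p < q" | "q < p" using p q by (metis linorder_neqE_nat step.distinct(1))
  then show ?thesis
  proof cases
    case 1
    with ex_East_North[OF p(2) q(2)] obtain r where r: "p \<le> r" "Suc r \<le> q" "\<mu> ! r = East" "\<mu> ! Suc r = North"
      by auto
    then have "canon_index \<mu> r \<in> V" using E_N_pair_valley q(1) by auto
    moreover have "i \<le> canon_index \<mu> r" "canon_index \<mu> r \<le> j"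
      using r p q by (auto intro!: canon_index_mono)
    ultimately show ?thesis by blast
  next
    case 2
    then have "j \<le> i" using p q by (auto intro!: canon_index_mono)
    with assms have "i = j" by simp
    with assms show ?thesis by auto
  qed
qed

text \<open>Turns the condition on a factor of the path into one on indices: the \<open>EN\<close>
  pairs met on the way are the valleys from \<open>i\<close> to \<open>j\<close>, and only those at
  the two ends are allowed.\<close>

lemma edges_G_path:
  "edges (G_path \<nu>) = {(i, j, Fwd) | i j. i \<in> I \<and> j \<in> J \<and> i < j \<and> (\<forall>v\<in>V. \<not> (i < v \<and> v < j))}"
  (is "?L = ?R")
proof (intro subset_antisym subsetI)
  fix e assume "e \<in> ?L"
  then obtain i j p q where e: "e = (i, j, Fwd)" "i < j" and pq: "p < q" "q < length \<mu>"
    "\<mu> ! p = East" "canon_index \<mu> p = i" "\<mu> ! q = North" "canon_index \<mu> q = j"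
    and all: "\<And>r. p \<le> r \<Longrightarrow> Suc r \<le> q \<Longrightarrow> \<mu> ! r = East \<Longrightarrow> \<mu> ! Suc r = North \<Longrightarrow> canon_index \<mu> r \<in> {i, j}"
    unfolding G_path_def by (auto simp: Let_def)
  have "i \<in> I" "j \<in> J" unfolding E_indices_def N_indices_def using pq by auto
  moreover have False if v: "v \<in> V" "i < v" "v < j" for v
  proof -
    obtain r where r: "r < length \<mu>" "\<mu> ! r = East" "v = canon_index \<mu> r"
      using v unfolding E_indices_def by auto
    obtain s where s: "s < length \<mu>" "\<mu> ! s = North" "v = canon_index \<mu> s"
      using v unfolding N_indices_def by auto
    have "r < s"
      using canon_index_eqD[of \<mu> s r] r s by (metis linorder_neqE_nat step.distinct(1))
    then have "s = Suc r" using canon_index_eqD[of \<mu> r s] r s by auto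
    moreover have "p < r" by (rule ccontr) (use canon_index_mono[of r p \<mu>] v r pq in simp)
    moreover have "s < q" by (rule ccontr) (use canon_index_mono[of q s \<mu>] v s pq in simp)
    ultimately have "v \<in> {i, j}" using all[of r] r s by auto
    with v show False by auto
  qed
  ultimately show "e \<in> ?R" using e by blast
next
  fix e assume "e \<in> ?R"
  then obtain i j where e: "e = (i, j, Fwd)" "i \<in> I" "j \<in> J" "i < j"
    and nov: "\<And>v. v \<in> V \<Longrightarrow> \<not> (i < v \<and> v < j)" by auto
  obtain p where p: "p < length \<mu>" "\<mu> ! p = East" "i = canon_index \<mu> p"
    using e unfolding E_indices_def by auto
  obtain q where q: "q < length \<mu>" "\<mu> ! q = North" "j = canon_index \<mu> q"
    using e unfolding N_indices_def by auto
  have "p < q" by (rule ccontr) (use canon_index_mono[of q p \<mu>] p q e in simp)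
  moreover have "canon_index \<mu> r \<in> {i, j}"
    if "p \<le> r" "Suc r \<le> q" "\<mu> ! r = East" "\<mu> ! Suc r = North" for r
  proof -
    have "canon_index \<mu> r \<in> V" using E_N_pair_valley that q(1) by auto
    moreover have "i \<le> canon_index \<mu> r" "canon_index \<mu> r \<le> j"
      using that p q by (auto intro!: canon_index_mono)
    ultimately show ?thesis using nov by fastforce
  qed
  ultimately show "e \<in> ?L"
    unfolding G_path_def Let_def using e p q by auto
qed

lemma verts_G_path: "verts (G_path \<nu>) = {1..n}"
  by (simp add: G_path_def Let_def)

lemma n_ge_1: "1 \<le> n"
  using one_in_I I_Un_J by auto

lemma finite_IJ [simp]: "finite I" "finite J"
  using I_Un_J by (metis finite_Un finite_atLeastAtMost)+

lemma w_ge_1: "1 \<le> w"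
proof -
  have "V \<noteq> {}" using valley_between[OF one_in_I n_in_J n_ge_1] by auto
  then show ?thesis unfolding num_valleys_def by (simp add: Suc_le_eq card_gt_0_iff)
qed

lemma valley_bij: "bij_betw (valley \<nu>) {1..w} V"
proof -
  let ?xs = "sorted_list_of_set V"
  have "bij_betw (\<lambda>k. k - 1) {1..w} {..<w}"
    by (rule bij_betwI[where g = Suc]) auto
  moreover have "bij_betw ((!) ?xs) {..<w} V"
    unfolding num_valleys_def by (rule bij_betw_nth) auto
  ultimately show ?thesis
    unfolding valley_def[abs_def] using bij_betw_trans by (fastforce simp: comp_def)
qed

lemma valley_in: "k \<in> {1..w} \<Longrightarrow> valley \<nu> k \<in> V"
  using valley_bij bij_betwE by blast

lemma valley_less_iff:
  assumes "k \<in> {1..w}" "l \<in> {1..w}"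
  shows "valley \<nu> k < valley \<nu> l \<longleftrightarrow> k < l"
proof -
  have less: "valley \<nu> k < valley \<nu> l" if "k < l" "k \<in> {1..w}" "l \<in> {1..w}" for k l
    unfolding valley_def using that
    by (intro sorted_wrt_nth_less[of "(<)"]) (auto simp: num_valleys_def)
  show ?thesis
    using less[of k l] less[of l k] assms by (metis less_imp_not_less linorder_neqE_nat)
qed

lemma valley_eq_iff:
  assumes "k \<in> {1..w}" "l \<in> {1..w}"
  shows "valley \<nu> k = valley \<nu> l \<longleftrightarrow> k = l"
  using valley_bij assms unfolding bij_betw_def inj_on_def by blast


section \<open>The boundary of a function on arcs\<close>

text \<open>The vertex-arc incidence map: net outflow at \<open>u\<close>. Arc functions are total
  and their support is a side condition, so that coefficients belonging to different trees can be
  compared as functions.\<close>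

definition bd :: "(nat \<times> nat \<Rightarrow> real) \<Rightarrow> nat \<Rightarrow> real" where
  "bd c u = (\<Sum>e\<in>{1..n} \<times> {1..n}. c e * (of_bool (fst e = u) - of_bool (snd e = u)))"

lemma bd_lincomb: "bd (\<lambda>e. s * c e + t * d e) u = s * bd c u + t * bd d u"
  unfolding bd_def by (simp add: sum_distrib_left algebra_simps flip: sum.distrib sum_subtractf)

lemma bd_add: "bd (\<lambda>e. c e + d e) u = bd c u + bd d u"
  using bd_lincomb[of 1 c 1 d] by simp

lemma bd_diff: "bd (\<lambda>e. c e - d e) u = bd c u - bd d u"
  using bd_lincomb[of 1 c "-1" d] by simp

lemma bd_scale: "bd (\<lambda>e. s * c e) u = s * bd c u"
  using bd_lincomb[of s c 0 c] by simp

lemma bd_zero: "bd (\<lambda>e. 0) u = 0"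
  by (simp add: bd_def)

text \<open>Summation by parts. With the indicator of a vertex set for \<phi> it computes the flow
  across a cut.\<close>

lemma bd_pairing:
  "(\<Sum>u\<in>{1..n}. \<phi> u * bd c u) = (\<Sum>e\<in>{1..n} \<times> {1..n}. c e * (\<phi> (fst e) - \<phi> (snd e)))"
proof -
  have *: "(\<Sum>u\<in>{1..n}. \<phi> u * of_bool (a = u)) = \<phi> a" if "a \<in> {1..n}" for a
    using that sum.delta[of "{1..n}" a \<phi>] by (simp add: of_bool_def if_distrib cong: if_cong)
  have "(\<Sum>u\<in>{1..n}. \<phi> u * bd c u) =
      (\<Sum>e\<in>{1..n} \<times> {1..n}. \<Sum>u\<in>{1..n}. c e * (\<phi> u * of_bool (fst e = u) - \<phi> u * of_bool (snd e = u)))"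
    unfolding bd_def by (subst sum.swap) (simp add: sum_distrib_left algebra_simps)
  also have "\<dots> = (\<Sum>e\<in>{1..n} \<times> {1..n}. c e * (\<phi> (fst e) - \<phi> (snd e)))"
    by (rule sum.cong[OF refl]) (auto simp: sum_subtractf * simp flip: sum_distrib_left)
  finally show ?thesis .
qed

lemma bd_pairing_on:
  assumes "S \<subseteq> {1..n} \<times> {1..n}" "\<And>e. e \<notin> S \<Longrightarrow> c e = 0"
  shows "(\<Sum>u\<in>{1..n}. \<phi> u * bd c u) = (\<Sum>e\<in>S. c e * (\<phi> (fst e) - \<phi> (snd e)))"
  unfolding bd_pairing by (rule sum.mono_neutral_right) (use assms in auto)

lemma bd_on:
  assumes "S \<subseteq> {1..n} \<times> {1..n}" "\<And>e. e \<notin> S \<Longrightarrow> c e = 0"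
  shows "bd c u = (\<Sum>e\<in>S. c e * (of_bool (fst e = u) - of_bool (snd e = u)))"
  unfolding bd_def by (rule sum.mono_neutral_right) (use assms in auto)

lemma sum_bd: "(\<Sum>u\<in>{1..n}. bd c u) = 0"
  using bd_pairing[of "\<lambda>_. 1" c] by simp

lemma bd_single:
  assumes "a \<in> {1..n}" "b \<in> {1..n}"
  shows "bd (\<lambda>e. of_bool (e = (a, b))) u = of_bool (a = u) - of_bool (b = u)"
  by (subst bd_on[of "{(a, b)}"]) (use assms in auto)

section \<open>The tree underlying \<open>G(\<nu>)\<close>\<close>

text \<open>The number of the valley to which \<open>a\<close> is attached: an index in
  \<open>I\<close> goes up to the nearest valley, one only in \<open>J\<close> goes down. At a
  valley both counts give its own number.\<close>

definition rk :: "nat \<Rightarrow> nat" where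
  "rk a = (if a \<in> I then Suc (card {v \<in> V. v < a}) else card {v \<in> V. v \<le> a})"

definition hub :: "nat \<Rightarrow> nat" where
  "hub a = valley \<nu> (rk a)"

lemma card_valleys_less:
  assumes "k \<in> {1..w}"
  shows "card {v \<in> V. v < valley \<nu> k} = k - 1"
proof -
  have "{v \<in> V. v < valley \<nu> k} = valley \<nu> ` {1..<k}"
  proof (intro subset_antisym subsetI)
    fix v assume "v \<in> {v \<in> V. v < valley \<nu> k}"
    then obtain l where "l \<in> {1..w}" "v = valley \<nu> l" "v < valley \<nu> k"
      using valley_bij unfolding bij_betw_def by blast
    then show "v \<in> valley \<nu> ` {1..<k}"
      using valley_less_iff assms by auto
  next
    fix v assume "v \<in> valley \<nu> ` {1..<k}"
    then show "v \<in> {v \<in> V. v < valley \<nu> k}"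
      using valley_less_iff assms valley_in by fastforce
  qed
  moreover have "inj_on (valley \<nu>) {1..<k}"
    using valley_bij assms unfolding bij_betw_def by (auto intro: inj_on_subset)
  ultimately show ?thesis by (simp add: card_image)
qed

lemma rk_eq_I:
  assumes "a \<in> I" "k \<in> {1..w}" "a \<le> valley \<nu> k" "\<And>v. v \<in> V \<Longrightarrow> a \<le> v \<Longrightarrow> valley \<nu> k \<le> v"
  shows "rk a = k"
proof -
  have "{v \<in> V. v < a} = {v \<in> V. v < valley \<nu> k}"
    using assms(3,4) by (auto simp: not_le[symmetric])
  then show ?thesis
    using card_valleys_less[OF assms(2)] assms(1,2) by (simp add: rk_def)
qed

lemma rk_valley [simp]: "k \<in> {1..w} \<Longrightarrow> rk (valley \<nu> k) = k"
  using rk_eq_I[of "valley \<nu> k" k] valley_in by auto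

lemma rk_eq_J:
  assumes "a \<in> J" "k \<in> {1..w}" "valley \<nu> k \<le> a" "\<And>v. v \<in> V \<Longrightarrow> v \<le> a \<Longrightarrow> v \<le> valley \<nu> k"
  shows "rk a = k"
proof (cases "a \<in> I")
  case True
  then have "a \<le> valley \<nu> k" using assms(1) assms(4)[of a] by blast
  then have "a = valley \<nu> k" using assms(3) by simp
  with assms show ?thesis by simp
next
  case False
  have "{v \<in> V. v \<le> a} = insert (valley \<nu> k) {v \<in> V. v < valley \<nu> k}"
  proof (intro subset_antisym subsetI)
    fix v assume "v \<in> {v \<in> V. v \<le> a}"
    then show "v \<in> insert (valley \<nu> k) {v \<in> V. v < valley \<nu> k}"
      using assms(4)[of v] by (simp add: order_le_less) blast
  next
    fix v assume "v \<in> insert (valley \<nu> k) {v \<in> V. v < valley \<nu> k}"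
    then show "v \<in> {v \<in> V. v \<le> a}"
      using assms(3) valley_in[OF assms(2)] by auto
  qed
  then have "card {v \<in> V. v \<le> a} = Suc (k - 1)"
    using card_valleys_less[OF assms(2)] by simp
  then show ?thesis using False assms(2) by (simp add: rk_def)
qed

lemma valley_ex: "v \<in> V \<Longrightarrow> \<exists>k\<in>{1..w}. v = valley \<nu> k"
  using valley_bij unfolding bij_betw_def by blast

lemma hub_I:
  assumes "a \<in> I"
  shows "rk a \<in> {1..w}" "a \<le> hub a" "\<And>v. v \<in> V \<Longrightarrow> a \<le> v \<Longrightarrow> hub a \<le> v"
proof -
  let ?A = "{v \<in> V. a \<le> v}"
  have "a \<le> n" using I_Un_J assms by auto
  then have ne: "?A \<noteq> {}" using valley_between[OF assms n_in_J] by auto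
  have fin: "finite ?A" by simp
  obtain k where k: "k \<in> {1..w}" "Min ?A = valley \<nu> k"
    using valley_ex Min_in[OF fin ne] by (metis (no_types, lifting) mem_Collect_eq)
  have "rk a = k"
    using k Min_in[OF fin ne] Min_le[OF fin] by (intro rk_eq_I assms) auto
  with k Min_in[OF fin ne] Min_le[OF fin]
  show "rk a \<in> {1..w}" "a \<le> hub a" "\<And>v. v \<in> V \<Longrightarrow> a \<le> v \<Longrightarrow> hub a \<le> v"
    by (auto simp: hub_def)
qed

lemma hub_J:
  assumes "a \<in> J"
  shows "rk a \<in> {1..w}" "hub a \<le> a" "\<And>v. v \<in> V \<Longrightarrow> v \<le> a \<Longrightarrow> v \<le> hub a"
proof -
  let ?A = "{v \<in> V. v \<le> a}"
  have "1 \<le> a" using I_Un_J assms by auto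
  then have ne: "?A \<noteq> {}" using valley_between[OF one_in_I assms] by auto
  have fin: "finite ?A" by simp
  obtain k where k: "k \<in> {1..w}" "Max ?A = valley \<nu> k"
    using valley_ex Max_in[OF fin ne] by (metis (no_types, lifting) mem_Collect_eq)
  have "rk a = k"
    using k Max_in[OF fin ne] Max_ge[OF fin] by (intro rk_eq_J assms) auto
  with k Max_in[OF fin ne] Max_ge[OF fin]
  show "rk a \<in> {1..w}" "hub a \<le> a" "\<And>v. v \<in> V \<Longrightarrow> v \<le> a \<Longrightarrow> v \<le> hub a"
    by (auto simp: hub_def)
qed

lemma rk_in: "a \<in> {1..n} \<Longrightarrow> rk a \<in> {1..w}"
  using hub_I(1) hub_J(1) I_Un_J by blast

lemma hub_in: "a \<in> {1..n} \<Longrightarrow> hub a \<in> V"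
  using rk_in valley_in unfolding hub_def by blast

lemma hub_V [simp]: "a \<in> V \<Longrightarrow> hub a = a"
  using hub_I[of a] by (meson IntD1 order_antisym order_refl)

text \<open>The arcs of a directed cycle through the valleys. The last one is the added backward
  edge, written in its direction of traversal from the last valley to the first. For a single valley
  it is a loop, which no tree contains.\<close>

definition cyc :: "nat \<Rightarrow> nat \<times> nat" where
  "cyc k = (valley \<nu> k, if k = w then valley \<nu> 1 else valley \<nu> (k + 1))"

definition Leaves :: "(nat \<times> nat) set" where
  "Leaves = (\<lambda>a. (a, hub a)) ` (I - J) \<union> (\<lambda>a. (hub a, a)) ` (J - I)"

lemma I_sub: "I \<subseteq> {1..n}" and J_sub: "J \<subseteq> {1..n}"
  using I_Un_J by auto

lemma V_sub: "V \<subseteq> {1..n}" using I_sub by auto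

lemma Leaves_sub: "Leaves \<subseteq> I \<times> J"
  unfolding Leaves_def using hub_in I_sub J_sub by blast

lemma less_hub: "a \<in> I - J \<Longrightarrow> a < hub a"
  using hub_I(2)[of a] hub_in[of a] I_sub by (metis Diff_iff IntD2 nat_less_le subsetD)

lemma hub_less: "a \<in> J - I \<Longrightarrow> hub a < a"
  using hub_J(2)[of a] hub_in[of a] J_sub by (metis Diff_iff IntD1 nat_less_le subsetD)

lemma Leaves_less: "(a, b) \<in> Leaves \<Longrightarrow> a < b"
  unfolding Leaves_def using less_hub hub_less by auto

lemma Leaves_not_V: "e \<in> Leaves \<Longrightarrow> \<not> (fst e \<in> V \<and> snd e \<in> V)"
  unfolding Leaves_def by auto

lemma cyc_in_V: "k \<in> {1..w} \<Longrightarrow> cyc k \<in> V \<times> V"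
  unfolding cyc_def using valley_in[of k] valley_in[of 1] valley_in[of "k+1"] w_ge_1
  by (cases "k = w") (simp_all del: Int_iff)

lemma Leaves_cyc_disj: "k \<in> {1..w} \<Longrightarrow> cyc k \<notin> Leaves"
  using cyc_in_V[of k] Leaves_not_V[of "cyc k"] by (auto simp: mem_Times_iff)

lemma inj_cyc: "inj_on cyc {1..w}"
  by (rule inj_onI) (auto simp: cyc_def valley_eq_iff)

lemma rk_fst_cyc: "k \<in> {1..w} \<Longrightarrow> rk (fst (cyc k)) = k"
  by (simp add: cyc_def)

lemma rk_hub [simp]: "a \<in> {1..n} \<Longrightarrow> rk (hub a) = rk a"
  unfolding hub_def using rk_in by simp

lemma rk_Leaves: "e \<in> Leaves \<Longrightarrow> rk (fst e) = rk (snd e)"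
  unfolding Leaves_def using I_sub J_sub by (auto simp: subset_iff)

definition tree :: "(nat \<times> nat) set" where
  "tree = Leaves \<union> cyc ` {1..<w}"

lemma cyc_less: "k \<in> {1..<w} \<Longrightarrow> cyc k = (valley \<nu> k, valley \<nu> (k + 1)) \<and> valley \<nu> k < valley \<nu> (k + 1)"
  unfolding cyc_def by (auto simp: valley_less_iff)

lemma tree_less: "(a, b) \<in> tree \<Longrightarrow> a < b"
  unfolding tree_def using Leaves_less cyc_less by fastforce

text \<open>By \<open>valley_between\<close> an edge without a valley strictly inside has a valley
  at an end. Either its other end is no valley, and then the edge joins it to its hub, or both ends
  are consecutive valleys.\<close>

lemma edges_G_path_tree: "edges (G_path \<nu>) = (\<lambda>(a, b). (a, b, Fwd)) ` tree"
proof -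
  have "i \<in> I \<and> j \<in> J \<and> i < j \<and> (\<forall>v\<in>V. \<not> (i < v \<and> v < j)) \<longleftrightarrow> (i, j) \<in> tree" (is "?L \<longleftrightarrow> _") for i j
  proof
    assume ?L
    then have ij: "i \<in> I" "j \<in> J" "i < j" and nov: "\<And>v. v \<in> V \<Longrightarrow> \<not> (i < v \<and> v < j)" by auto
    obtain v where v: "v \<in> V" "i \<le> v" "v \<le> j" using valley_between[of i j] ij by auto
    have "v = i \<or> v = j" using nov[OF v(1)] v by auto
    with v have "i \<in> V \<or> j \<in> V" by auto
    then consider "i \<notin> J" "j \<in> V" | "i \<in> V" "j \<notin> I" | "i \<in> V" "j \<in> V"
      using ij by auto
    then show "(i, j) \<in> tree"
    proof cases
      case 1
      have "hub i \<le> j" using hub_I(3)[of i j] ij 1 by auto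
      moreover have "i < hub i" using less_hub[of i] ij 1 by simp
      moreover have "hub i \<in> V" using hub_in ij I_sub by auto
      ultimately have "hub i = j" using nov[of "hub i"] by auto
      with 1 ij show ?thesis unfolding tree_def Leaves_def by auto
    next
      case 2
      have "i \<le> hub j" using hub_J(3)[of j i] ij 2 by auto
      moreover have "hub j < j" using hub_less[of j] ij 2 by simp
      moreover have "hub j \<in> V" using hub_in ij J_sub by auto
      ultimately have "hub j = i" using nov[of "hub j"] by auto
      with 2 ij show ?thesis unfolding tree_def Leaves_def by auto
    next
      case 3
      then obtain k l where kl: "k \<in> {1..w}" "i = valley \<nu> k" "l \<in> {1..w}" "j = valley \<nu> l"
        using valley_ex by meson
      then have "k < l" using ij valley_less_iff by auto
      have "l = k + 1"
      proof (rule ccontr)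
        assume "l \<noteq> k + 1"
        with \<open>k < l\<close> have "k + 1 < l" "k + 1 \<in> {1..w}" using kl by auto
        then show False
          using nov[OF valley_in[of "k + 1"]] kl valley_less_iff[of k "k+1"] valley_less_iff[of "k+1" l]
          by simp
      qed
      with kl \<open>k < l\<close> have "k \<in> {1..<w}" "(i, j) = cyc k" by (auto simp: cyc_def)
      then show ?thesis unfolding tree_def by blast
    qed
  next
    assume "(i, j) \<in> tree"
    then consider "i \<in> I - J" "j = hub i" | "j \<in> J - I" "i = hub j" | k where "k \<in> {1..<w}" "(i, j) = cyc k"
      unfolding tree_def Leaves_def by auto
    then show ?L
    proof cases
      case 1
      then have "\<not> (i < v \<and> v < j)" if "v \<in> V" for v
        using hub_I(3)[of i v] that by auto
      then show ?thesis using 1 less_hub[of i] hub_in[of i] I_sub by blast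
    next
      case 2
      then have "\<not> (i < v \<and> v < j)" if "v \<in> V" for v
        using hub_J(3)[of j v] that by auto
      then show ?thesis using 2 hub_less[of j] hub_in[of j] J_sub by blast
    next
      case 3
      have False if "v \<in> V" "i < v" "v < j" for v
      proof -
        obtain l where "l \<in> {1..w}" "v = valley \<nu> l" using valley_ex[OF \<open>v \<in> V\<close>] by blast
        then show False using that(2,3) 3 cyc_less[of k] valley_less_iff[of k l] valley_less_iff[of l "k+1"] by simp
      qed
      then show ?thesis using 3 cyc_less[of k] valley_in[of k] valley_in[of "k+1"] by auto
    qed
  qed
  then show ?thesis unfolding edges_G_path by auto
qed


section \<open>Flows on the leaves and the valley cycle\<close>

text \<open>The tree flow with net supplies \<open>d\<close> has the value \<open>cutf d k\<close> on the edge from the \<open>k\<close>-th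
  valley to the next one.\<close>

definition cutf :: "(nat \<Rightarrow> real) \<Rightarrow> nat \<Rightarrow> real" where
  "cutf d k = (\<Sum>a\<in>{1..n}. of_bool (rk a \<le> k) * d a)"

lemma cyc_sub: "cyc ` {1..w} \<subseteq> {1..n} \<times> {1..n}"
proof (rule image_subsetI)
  fix k assume "k \<in> {1..w}"
  then have "cyc k \<in> V \<times> V" by (rule cyc_in_V)
  with V_sub show "cyc k \<in> {1..n} \<times> {1..n}" by (meson Sigma_mono subsetD)
qed

lemma nonvalley_cases:
  assumes "a \<in> {1..n} - V"
  obtains "a \<in> I - J" | "a \<in> J - I"
proof -
  have "a \<in> I \<union> J" using assms by (simp only: I_Un_J DiffD1)
  with assms that show thesis by blast
qed

lemma Leaves_cases:
  assumes "e \<in> Leaves"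
  obtains b where "b \<in> I - J" "e = (b, hub b)" | b where "b \<in> J - I" "e = (hub b, b)"
  using assms unfolding Leaves_def by (elim UnE imageE) simp_all

lemma hub_neq: "b \<in> I \<union> J \<Longrightarrow> a \<notin> V \<Longrightarrow> hub b \<noteq> a"
  using hub_in unfolding I_Un_J by blast

lemma Leaves_sub': "Leaves \<subseteq> {1..n} \<times> {1..n}"
  using Leaves_sub I_sub J_sub by blast

lemma finite_Leaves [simp]: "finite Leaves"
  using Leaves_sub' by (rule finite_subset) simp

text \<open>Pairs the boundary with the indicator of the vertices of rank at most \<open>k\<close>.
  Leaf edges do not cross this cut; of the cycle, only arc \<open>k\<close> leaves it and only arc
  \<open>w\<close> enters it.\<close>

lemma cutf_bd:
  assumes c: "\<And>e. e \<notin> Leaves \<union> cyc ` {1..w} \<Longrightarrow> c e = 0" and k: "k \<in> {1..w}"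
  shows "cutf (bd c) k = c (cyc k) - c (cyc w)"
proof -
  let ?\<phi> = "\<lambda>a. of_bool (rk a \<le> k) :: real"
  have disj: "Leaves \<inter> cyc ` {1..w} = {}"
    using Leaves_cyc_disj by blast
  have "cutf (bd c) k = (\<Sum>e\<in>Leaves \<union> cyc ` {1..w}. c e * (?\<phi> (fst e) - ?\<phi> (snd e)))"
    unfolding cutf_def by (rule bd_pairing_on) (use c cyc_sub Leaves_sub' in auto)
  also have "\<dots> = (\<Sum>e\<in>cyc ` {1..w}. c e * (?\<phi> (fst e) - ?\<phi> (snd e)))"
    by (subst sum.union_disjoint) (use disj rk_Leaves in auto)
  also have "\<dots> = (\<Sum>l\<in>{1..w}. c (cyc l) * (?\<phi> (fst (cyc l)) - ?\<phi> (snd (cyc l))))"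
    using inj_cyc by (simp add: sum.reindex)
  also have "\<dots> = (\<Sum>l\<in>{1..w}. (if l = k then c (cyc l) else 0) - (if l = w then c (cyc l) else 0))"
  proof (rule sum.cong[OF refl])
    fix l assume l: "l \<in> {1..w}"
    show "c (cyc l) * (?\<phi> (fst (cyc l)) - ?\<phi> (snd (cyc l))) =
        (if l = k then c (cyc l) else 0) - (if l = w then c (cyc l) else 0)"
      using l k by (cases "l = w") (auto simp: cyc_def)
  qed
  also have "\<dots> = c (cyc k) - c (cyc w)"
    using k w_ge_1 by (simp add: sum_subtractf)
  finally show ?thesis .
qed

text \<open>A vertex that is no valley has degree one: cycle arcs and hubs consist of
  valleys.\<close>

lemma Leaves_unique_incident:
  assumes e: "e \<in> Leaves" and a: "a \<notin> V" "a = fst e \<or> a = snd e"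
    and e': "e' \<in> Leaves \<union> cyc ` {1..w}" "a = fst e' \<or> a = snd e'"
  shows "e' = e"
proof -
  have "e' \<notin> cyc ` {1..w}"
  proof
    assume "e' \<in> cyc ` {1..w}"
    then have "e' \<in> V \<times> V" using cyc_in_V by blast
    then show False using e'(2) a(1) by (auto simp: mem_Times_iff)
  qed
  then have e'L: "e' \<in> Leaves" using e' by blast
  have "f = (if a \<in> I then (a, hub a) else (hub a, a))" if f: "f \<in> Leaves" "a = fst f \<or> a = snd f" for f
    using f(1)
  proof (cases rule: Leaves_cases)
    case (1 b)
    then have "hub b \<noteq> a" using a(1) by (intro hub_neq) auto
    with 1 f(2) have "a = b" by auto
    with 1 show ?thesis by simp
  next
    case (2 b)
    then have "hub b \<noteq> a" using a(1) by (intro hub_neq) auto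
    with 2 f(2) have "a = b" by auto
    with 2 show ?thesis by simp
  qed
  from this[OF e a(2)] this[OF e'L e'(2)] show ?thesis by simp
qed

lemma bd_leaf:
  assumes c: "\<And>e. e \<notin> Leaves \<union> cyc ` {1..w} \<Longrightarrow> c e = 0"
    and e: "e \<in> Leaves" and a: "a \<notin> V" "a = fst e \<or> a = snd e"
  shows "bd c a = c e * (of_bool (fst e = a) - of_bool (snd e = a))"
proof -
  have "bd c a = (\<Sum>e\<in>Leaves \<union> cyc ` {1..w}. c e * (of_bool (fst e = a) - of_bool (snd e = a)))"
    by (rule bd_on) (use c cyc_sub Leaves_sub' in auto)
  also have "\<dots> = (\<Sum>e\<in>{e}. c e * (of_bool (fst e = a) - of_bool (snd e = a)))"
  proof (rule sum.mono_neutral_right)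
    show "\<forall>e'\<in>Leaves \<union> cyc ` {1..w} - {e}. c e' * (of_bool (fst e' = a) - of_bool (snd e' = a)) = 0"
    proof
      fix e' assume "e' \<in> Leaves \<union> cyc ` {1..w} - {e}"
      then have "fst e' \<noteq> a \<and> snd e' \<noteq> a" using Leaves_unique_incident[OF e a] by blast
      then show "c e' * (of_bool (fst e' = a) - of_bool (snd e' = a)) = 0" by simp
    qed
  qed (use e in auto)
  finally show ?thesis by simp
qed

lemma bd_leaf_out:
  assumes c: "\<And>e. e \<notin> Leaves \<union> cyc ` {1..w} \<Longrightarrow> c e = 0" and a: "a \<in> I - J"
  shows "bd c a = c (a, hub a)"
proof -
  have "(a, hub a) \<in> Leaves" "a \<notin> V" "hub a \<noteq> a" using a less_hub[OF a] unfolding Leaves_def by auto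
  then show ?thesis using bd_leaf[of c "(a, hub a)" a, OF c] by simp
qed

lemma bd_leaf_in:
  assumes c: "\<And>e. e \<notin> Leaves \<union> cyc ` {1..w} \<Longrightarrow> c e = 0" and a: "a \<in> J - I"
  shows "bd c a = - c (hub a, a)"
proof -
  have "(hub a, a) \<in> Leaves" "a \<notin> V" "hub a \<noteq> a" using a hub_less[OF a] unfolding Leaves_def by auto
  then show ?thesis using bd_leaf[of c "(hub a, a)" a, OF c] by simp
qed

text \<open>The difference of the two vectors lives on the valleys, where the cut values are its
  partial sums; all of them vanish.\<close>

lemma cutf_determines:
  assumes leaf: "\<And>a. a \<in> {1..n} - V \<Longrightarrow> d a = d' a"
    and cut: "\<And>k. k \<in> {1..w} \<Longrightarrow> cutf d k = cutf d' k"
    and a: "a \<in> {1..n}"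
  shows "d a = d' a"
proof (cases "a \<in> V")
  case True
  define g where "g a = d a - d' a" for a
  have cutg: "cutf g k = (\<Sum>l\<in>{1..k}. g (valley \<nu> l))" if k: "k \<in> {1..w}" for k
  proof -
    have "cutf g k = (\<Sum>a\<in>V. of_bool (rk a \<le> k) * g a)"
      unfolding cutf_def using leaf V_sub
      by (intro sum.mono_neutral_right) (auto simp: g_def)
    also have "\<dots> = (\<Sum>l\<in>{1..w}. of_bool (rk (valley \<nu> l) \<le> k) * g (valley \<nu> l))"
      by (rule sum.reindex_bij_betw[OF valley_bij, symmetric])
    also have "\<dots> = (\<Sum>l\<in>{1..w}. of_bool (l \<le> k) * g (valley \<nu> l))"
      by (rule sum.cong) auto
    also have "\<dots> = (\<Sum>l\<in>{1..k}. of_bool (l \<le> k) * g (valley \<nu> l))"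
      using k by (intro sum.mono_neutral_right) auto
    finally show ?thesis by simp
  qed
  have cut0: "cutf g k = 0" if "k \<in> {1..w}" for k
    using cut[OF that] unfolding cutf_def g_def by (simp add: algebra_simps sum_subtractf)
  obtain k where k: "k \<in> {1..w}" "a = valley \<nu> k" using valley_ex[OF True] by blast
  have "g (valley \<nu> k) = 0"
  proof (cases "k = 1")
    case True
    then show ?thesis using cutg[OF k(1)] cut0[OF k(1)] by simp
  next
    case False
    then obtain m where m: "k = Suc m" "m \<in> {1..w}" using k by (cases k) auto
    then show ?thesis using cutg[OF k(1)] cut0[OF k(1)] cutg[OF m(2)] cut0[OF m(2)] by simp
  qed
  then show ?thesis using k by (simp add: g_def)
qed (use leaf a in auto)

text \<open>A right inverse of \<open>bd\<close> for suitable \<open>g\<close>. A leaf edge must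
  carry the supply of its end that is no valley, whereas the values \<open>g\<close> on the cycle
  are fixed by the supplies only up to a common constant, the strength of a circulation.\<close>

definition chain_of :: "(nat \<Rightarrow> real) \<Rightarrow> (nat \<Rightarrow> real) \<Rightarrow> nat \<times> nat \<Rightarrow> real" where
  "chain_of d g e = (if e \<in> Leaves then (if fst e \<in> J then - d (snd e) else d (fst e))
     else if e \<in> cyc ` {1..w} then g (rk (fst e)) else 0)"

lemma chain_of_cyc: "k \<in> {1..w} \<Longrightarrow> chain_of d g (cyc k) = g k"
  using Leaves_cyc_disj rk_fst_cyc by (simp add: chain_of_def)

text \<open>By \<open>cutf_determines\<close> it is enough to compare leaves and cuts. At
  \<open>k = w\<close> the hypothesis says that the supplies sum to zero.\<close>

lemma bd_chain_of:
  assumes d: "\<And>k. k \<in> {1..w} \<Longrightarrow> g k - g w = cutf d k" and u: "u \<in> {1..n}"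
  shows "bd (chain_of d g) u = d u"
proof (rule cutf_determines[OF _ _ u])
  have supp: "chain_of d g e = 0" if "e \<notin> Leaves \<union> cyc ` {1..w}" for e
    using that by (auto simp: chain_of_def)
  fix a assume "a \<in> {1..n} - V"
  then consider "a \<in> I - J" | "a \<in> J - I" by (rule nonvalley_cases)
  then show "bd (chain_of d g) a = d a"
  proof cases
    case 1
    then have "(a, hub a) \<in> Leaves" unfolding Leaves_def by auto
    with 1 bd_leaf_out[of "chain_of d g", OF supp 1] show ?thesis by (simp add: chain_of_def)
  next
    case 2
    then have "(hub a, a) \<in> Leaves" "hub a \<in> J" unfolding Leaves_def using hub_in J_sub by auto
    with 2 bd_leaf_in[of "chain_of d g", OF supp 2] show ?thesis by (simp add: chain_of_def)
  qed
next
  have supp: "chain_of d g e = 0" if "e \<notin> Leaves \<union> cyc ` {1..w}" for e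
    using that by (auto simp: chain_of_def)
  fix k assume k: "k \<in> {1..w}"
  then show "cutf (bd (chain_of d g)) k = cutf d k"
    using cutf_bd[of "chain_of d g", OF supp k] chain_of_cyc[of k] chain_of_cyc[of w] w_ge_1 d[OF k] by simp
qed

section \<open>Families of trees with unique representations\<close>

definition nonneg_on :: "(nat \<times> nat) set \<Rightarrow> (nat \<times> nat \<Rightarrow> real) \<Rightarrow> bool" where
  "nonneg_on S c \<longleftrightarrow> (\<forall>e. 0 \<le> c e) \<and> (\<forall>e. e \<notin> S \<longrightarrow> c e = 0)"

lemma nonneg_onD: "nonneg_on S c \<Longrightarrow> 0 \<le> c e" "nonneg_on S c \<Longrightarrow> e \<notin> S \<Longrightarrow> c e = 0"
  unfolding nonneg_on_def by blast+

definition covers :: "(nat \<times> nat) set \<Rightarrow> bool" where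
  "covers S \<longleftrightarrow> (\<forall>a\<in>{1..n} - V. \<exists>e\<in>S. a = fst e \<or> a = snd e)"

text \<open>The vectors e_a - e_b of the arcs in \<open>S\<close> generate, over the integers, all
  integer vectors with sum zero.\<close>

definition int_spanning :: "(nat \<times> nat) set \<Rightarrow> bool" where
  "int_spanning S \<longleftrightarrow> (\<forall>a\<in>{1..n}. \<forall>b\<in>{1..n}. \<exists>c. (\<forall>e. c e \<in> \<int>) \<and> (\<forall>e. e \<notin> S \<longrightarrow> c e = 0) \<and>
     (\<forall>u\<in>{1..n}. bd c u = of_bool (a = u) - of_bool (b = u)))"

text \<open>The vertex vectors \<open>p - q\<close> with \<open>p \<ge> 0\<close> supported on \<open>I\<close> and \<open>q \<ge> 0\<close> supported on \<open>J\<close>, of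
  equal total.\<close>

definition balanced :: "(nat \<Rightarrow> real) \<Rightarrow> bool" where
  "balanced d \<longleftrightarrow> (\<Sum>a\<in>{1..n}. d a) = 0 \<and> (\<forall>a\<in>I - J. 0 \<le> d a) \<and> (\<forall>a\<in>J - I. d a \<le> 0)"

text \<open>The last two conditions say that the cones spanned by the vectors \<open>e\<^sub>a - e\<^sub>b\<close>, \<open>(a, b) \<in> H\<close>, form a
  simplicial fan that covers the balanced vectors.\<close>

definition tree_fan :: "(nat \<times> nat) set set \<Rightarrow> bool" where
  "tree_fan \<T> \<longleftrightarrow> finite \<T> \<and>
     (\<forall>H\<in>\<T>. H \<subseteq> I \<times> J \<and> (\<forall>a. (a, a) \<notin> H) \<and> covers H \<and> int_spanning H \<and> card H = n - 1) \<and>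
     (\<forall>H\<in>\<T>. \<forall>H'\<in>\<T>. \<forall>c c'. nonneg_on H c \<longrightarrow> nonneg_on H' c' \<longrightarrow>
        (\<forall>u\<in>{1..n}. bd c u = bd c' u) \<longrightarrow> c = c') \<and>
     (\<forall>d. balanced d \<longrightarrow> (\<exists>H\<in>\<T>. \<exists>c. nonneg_on H c \<and> (\<forall>u\<in>{1..n}. bd c u = d u)))"

section \<open>The fan of the simplex-subdivision\<close>

text \<open>The arcs common to all G(\<nu>,i) with \<open>i\<close> in \<open>A\<close>: each such
  \<open>i\<close> removes one arc of the valley cycle, and \<open>w\<close> removes the closing
  one.\<close>

definition start :: "nat set \<Rightarrow> (nat \<times> nat) set" where
  "start A = Leaves \<union> cyc ` ({1..w} - A)"

lemma cutf_w: "cutf d w = (\<Sum>a\<in>{1..n}. d a)"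
  unfolding cutf_def using rk_in by (intro sum.cong) auto

lemma card_Leaves: "card Leaves = n - w"
proof -
  have inj1: "inj_on (\<lambda>a. (a, hub a)) (I - J)" and inj2: "inj_on (\<lambda>a. (hub a, a)) (J - I)"
    by (auto simp: inj_on_def)
  have disj: "(\<lambda>a. (a, hub a)) ` (I - J) \<inter> (\<lambda>a. (hub a, a)) ` (J - I) = {}"
    using hub_in I_sub J_sub by auto
  have "card Leaves = card (I - J) + card (J - I)"
    unfolding Leaves_def using disj inj1 inj2 by (simp add: card_Un_disjoint card_image)
  also have "\<dots> = card ((I - J) \<union> (J - I))"
    by (subst card_Un_disjoint) auto
  also have "(I - J) \<union> (J - I) = {1..n} - V" using I_Un_J by auto
  also have "card \<dots> = n - w"
    unfolding num_valleys_def using V_sub by (subst card_Diff_subset) (auto intro: finite_subset)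
  finally show ?thesis .
qed

lemma w_le_n: "w \<le> n"
  unfolding num_valleys_def using card_mono[OF _ V_sub] by simp

lemma start_sub: "A \<noteq> {} \<Longrightarrow> A \<subseteq> {1..w} \<Longrightarrow> start A \<subseteq> I \<times> J"
  unfolding start_def using Leaves_sub cyc_in_V by (intro Un_least image_subsetI) (auto simp: mem_Times_iff)

lemma start_irrefl: "A \<noteq> {} \<Longrightarrow> A \<subseteq> {1..w} \<Longrightarrow> (a, a) \<notin> start A"
proof
  assume A: "A \<noteq> {}" "A \<subseteq> {1..w}" and "(a, a) \<in> start A"
  then obtain k where k: "k \<in> {1..w} - A" "(a, a) = cyc k"
    unfolding start_def using Leaves_less by blast
  then have "k = w" using cyc_less[of k] by (cases "k = w") auto
  with k have "valley \<nu> w = valley \<nu> 1" by (simp add: cyc_def)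
  then have "w = 1" using valley_eq_iff[of w 1] w_ge_1 by auto
  with A k \<open>k = w\<close> show False by auto
qed

lemma covers_start: "A \<noteq> {} \<Longrightarrow> covers (start A)"
proof -
  have "covers Leaves"
    unfolding covers_def
  proof
    fix a assume "a \<in> {1..n} - V"
    then consider "a \<in> I - J" | "a \<in> J - I" by (rule nonvalley_cases)
    then show "\<exists>e\<in>Leaves. a = fst e \<or> a = snd e"
    proof cases
      case 1
      then have "(a, hub a) \<in> Leaves" unfolding Leaves_def by auto
      then show ?thesis by force
    next
      case 2
      then have "(hub a, a) \<in> Leaves" unfolding Leaves_def by auto
      then show ?thesis by force
    qed
  qed
  then show ?thesis unfolding covers_def start_def by blast
qed

lemma start_singleton_tree:
  assumes i: "i \<in> {1..w}"
  shows "covers (start {i})" "int_spanning (start {i})" "card (start {i}) = n - 1"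
proof -
  show "covers (start {i})" by (rule covers_start) simp
  have "card (start {i}) = card Leaves + card (cyc ` ({1..w} - {i}))"
    unfolding start_def using Leaves_cyc_disj by (intro card_Un_disjoint) auto
  also have "card (cyc ` ({1..w} - {i})) = w - 1"
    using inj_cyc i by (subst card_image) (auto intro: inj_on_subset)
  finally show "card (start {i}) = n - 1"
    using card_Leaves w_le_n w_ge_1 by simp
  show "int_spanning (start {i})"
    unfolding int_spanning_def
  proof (intro ballI)
    fix a b assume ab: "a \<in> {1..n}" "b \<in> {1..n}"
    define d :: "nat \<Rightarrow> real" where "d u = of_bool (a = u) - of_bool (b = u)" for u
    have "(\<Sum>u\<in>{1..n}. d u) = 0"
      using ab by (simp add: d_def sum_subtractf of_bool_def)
    then have w0: "cutf d w = 0" by (simp add: cutf_w)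
    \<comment> \<open>Subtracting a circulation of strength \<open>cutf d i\<close> empties the
      removed arc \<open>i\<close>.\<close>
    define c where "c = chain_of d (\<lambda>k. cutf d k - cutf d i)"
    have dint: "d u \<in> \<int>" for u by (simp add: d_def)
    then have "cutf d k \<in> \<int>" for k unfolding cutf_def by (intro Ints_sum Ints_mult) auto
    with dint have "c e \<in> \<int>" for e
      unfolding c_def chain_of_def by auto
    moreover have "c e = 0" if "e \<notin> start {i}" for e
      using that rk_fst_cyc unfolding c_def chain_of_def start_def by auto
    moreover have "bd c u = d u" if "u \<in> {1..n}" for u
      unfolding c_def by (rule bd_chain_of[OF _ that]) (simp add: w0)
    ultimately show "\<exists>c. (\<forall>e. c e \<in> \<int>) \<and> (\<forall>e. e \<notin> start {i} \<longrightarrow> c e = 0) \<and>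
        (\<forall>u\<in>{1..n}. bd c u = of_bool (a = u) - of_bool (b = u))"
      unfolding d_def by blast
  qed
qed

lemma start_supp: "nonneg_on (start A) c \<Longrightarrow> e \<notin> Leaves \<union> cyc ` {1..w} \<Longrightarrow> c e = 0"
  by (rule nonneg_onD(2)) (auto simp: start_def)

lemma cyc_notin_start:
  assumes "i \<in> A" "i \<in> {1..w}"
  shows "cyc i \<notin> start A"
proof
  assume "cyc i \<in> start A"
  then obtain k where "k \<in> {1..w} - A" "cyc i = cyc k"
    unfolding start_def using Leaves_cyc_disj[OF assms(2)] by blast
  then show False using inj_onD[OF inj_cyc, of i k] assms by auto
qed

text \<open>Equal boundaries leave only a circulation along the cycle, that is, one constant. Each
  function is nonnegative and vanishes on some arc of the cycle, so both have minimum 0 there and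
  the constant is 0.\<close>

lemma start_unique:
  assumes i: "i \<in> {1..w}" "j \<in> {1..w}"
    and c: "nonneg_on (start {i}) c" "nonneg_on (start {j}) c'"
    and eq: "\<And>u. u \<in> {1..n} \<Longrightarrow> bd c u = bd c' u"
  shows "c = c'"
proof
  note supp = start_supp[OF c(1)] start_supp[OF c(2)]
  have "cutf (bd c) k = cutf (bd c') k" for k
    unfolding cutf_def using eq by simp
  then have diff: "c (cyc k) - c (cyc w) = c' (cyc k) - c' (cyc w)" if "k \<in> {1..w}" for k
    using cutf_bd[of c, OF supp(1) that] cutf_bd[of c', OF supp(2) that] by simp
  have "c (cyc i) = 0" "c' (cyc j) = 0"
    using cyc_notin_start i by (auto intro!: nonneg_onD(2)[OF c(1)] nonneg_onD(2)[OF c(2)])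
  moreover have "0 \<le> c (cyc j)" "0 \<le> c' (cyc i)"
    using nonneg_onD(1) c by blast+
  ultimately have "c (cyc w) = c' (cyc w)"
    using diff[OF i(1)] diff[OF i(2)] by linarith
  with diff have cyc: "c (cyc k) = c' (cyc k)" if "k \<in> {1..w}" for k
    using that by fastforce
  fix e
  show "c e = c' e"
  proof (cases "e \<in> Leaves")
    case True
    then show ?thesis
    proof (cases rule: Leaves_cases)
      case (1 a)
      then show ?thesis
        using bd_leaf_out[of c, OF supp(1) 1(1)] bd_leaf_out[of c', OF supp(2) 1(1)] eq[of a] I_sub by auto
    next
      case (2 a)
      then show ?thesis
        using bd_leaf_in[of c, OF supp(1) 2(1)] bd_leaf_in[of c', OF supp(2) 2(1)] eq[of a] J_sub by auto
    qed
  next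
    case False
    then show ?thesis using cyc supp by (cases "e \<in> cyc ` {1..w}") auto
  qed
qed

text \<open>Subtracting the least cut value from all arcs of the cycle keeps them nonnegative and
  empties arc \<open>i\<close>. The closing arc has cut value 0 and takes part in the comparison as
  \<open>k = w\<close>.\<close>

lemma start_repr:
  assumes d: "balanced d" and i: "i \<in> {1..w}" and min: "\<And>k. k \<in> {1..w} \<Longrightarrow> cutf d i \<le> cutf d k"
  shows "\<exists>c. nonneg_on (start {i}) c \<and> (\<forall>u\<in>{1..n}. bd c u = d u)"
proof (intro exI conjI ballI)
  let ?c = "chain_of d (\<lambda>k. cutf d k - cutf d i)"
  have w0: "cutf d w = 0" using d by (simp add: cutf_w balanced_def)
  show "bd ?c u = d u" if "u \<in> {1..n}" for u
    by (rule bd_chain_of[OF _ that]) (simp add: w0)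
  have "0 \<le> ?c e" for e
  proof -
    consider a where "a \<in> I - J" "e = (a, hub a)" | a where "a \<in> J - I" "e = (hub a, a)"
      | "e \<notin> Leaves" by (meson Leaves_cases)
    then show ?thesis
    proof cases
      case 1
      then show ?thesis using d by (auto simp: chain_of_def Leaves_def balanced_def)
    next
      case 2
      then have "hub a \<in> J" using hub_in J_sub by auto
      then show ?thesis using 2 d by (auto simp: chain_of_def Leaves_def balanced_def)
    next
      case 3
      then show ?thesis using min rk_fst_cyc by (auto simp: chain_of_def)
    qed
  qed
  moreover have "?c e = 0" if "e \<notin> start {i}" for e
    using that rk_fst_cyc unfolding chain_of_def start_def by auto
  ultimately show "nonneg_on (start {i}) ?c" by (simp add: nonneg_on_def)
qed

text \<open>The converse of \<open>start_repr\<close>; together they describe the cell of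
  \<open>start {i}\<close> by inequalities between cut values.\<close>

lemma start_repr_cutf:
  assumes i: "i \<in> {1..w}" and c: "nonneg_on (start {i}) c" and d: "\<And>u. u \<in> {1..n} \<Longrightarrow> bd c u = d u"
    and k: "k \<in> {1..w}"
  shows "cutf d i \<le> cutf d k"
proof -
  have "c (cyc i) = 0"
    using cyc_notin_start[of i "{i}"] i by (auto intro!: nonneg_onD(2)[OF c])
  moreover have "cutf (bd c) k = cutf d k" for k unfolding cutf_def using d by simp
  moreover have "0 \<le> c (cyc k)" using c by (rule nonneg_onD(1))
  ultimately show ?thesis
    using cutf_bd[of c, OF start_supp[OF c] i] cutf_bd[of c, OF start_supp[OF c] k] by simp
qed

lemma tree_fan_start: "tree_fan ((\<lambda>i. start {i}) ` {1..w})"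
proof -
  have "\<exists>H\<in>(\<lambda>i. start {i}) ` {1..w}. \<exists>c. nonneg_on H c \<and> (\<forall>u\<in>{1..n}. bd c u = d u)"
    if "balanced d" for d
  proof -
    obtain i where "i \<in> {1..w}" "\<And>k. k \<in> {1..w} \<Longrightarrow> cutf d i \<le> cutf d k"
      using w_ge_1 ex_min_if_finite[of "cutf d ` {1..w}"]
      by (metis (no_types, lifting) arg_min_if_finite(1) arg_min_least atLeastatMost_empty_iff2 finite_atLeastAtMost not_le)
    with start_repr[OF that] show ?thesis by blast
  qed
  then show ?thesis
    unfolding tree_fan_def using start_unique start_singleton_tree start_sub start_irrefl by auto
qed


lemma tree_fanD:
  assumes "tree_fan \<T>"
  shows "finite \<T>"
    and "H \<in> \<T> \<Longrightarrow> H \<subseteq> I \<times> J" and "H \<in> \<T> \<Longrightarrow> (a, a) \<notin> H"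
    and "H \<in> \<T> \<Longrightarrow> covers H" and "H \<in> \<T> \<Longrightarrow> int_spanning H" and "H \<in> \<T> \<Longrightarrow> card H = n - 1"
    and "balanced d \<Longrightarrow> \<exists>H\<in>\<T>. \<exists>c. nonneg_on H c \<and> (\<forall>u\<in>{1..n}. bd c u = d u)"
  using assms unfolding tree_fan_def by blast+

lemma tree_fan_unique:
  assumes "tree_fan \<T>" "H \<in> \<T>" "H' \<in> \<T>" "nonneg_on H c" "nonneg_on H' c'"
    "\<And>u. u \<in> {1..n} \<Longrightarrow> bd c u = bd c' u"
  shows "c = c'"
proof -
  have "\<forall>H\<in>\<T>. \<forall>H'\<in>\<T>. \<forall>c c'. nonneg_on H c \<longrightarrow> nonneg_on H' c' \<longrightarrow>
      (\<forall>u\<in>{1..n}. bd c u = bd c' u) \<longrightarrow> c = c'"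
    using assms(1) unfolding tree_fan_def by (elim conjE)
  from this[rule_format, OF assms(2-5)] assms(6) show ?thesis by simp
qed

lemma nonneg_on_mono: "nonneg_on S c \<Longrightarrow> S \<subseteq> S' \<Longrightarrow> nonneg_on S' c"
  unfolding nonneg_on_def by blast

lemma nonneg_onI: "(\<And>e. 0 \<le> c e) \<Longrightarrow> (\<And>e. e \<notin> S \<Longrightarrow> c e = 0) \<Longrightarrow> nonneg_on S c"
  unfolding nonneg_on_def by blast

lemma IJ_sub: "S \<subseteq> I \<times> J \<Longrightarrow> S \<subseteq> {1..n} \<times> {1..n}"
  using I_sub J_sub by blast

lemma IJ_finite: "S \<subseteq> I \<times> J \<Longrightarrow> finite S"
  by (rule finite_subset) auto

section \<open>Cutting a fan along a reduction\<close>

definition both :: "nat \<times> nat \<times> nat \<Rightarrow> (nat \<times> nat) set \<Rightarrow> bool" where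
  "both t H = (case t of (i, j, k) \<Rightarrow> (i, j) \<in> H \<and> (j, k) \<in> H)"

definition cut_tree :: "nat \<times> nat \<times> nat \<Rightarrow> (nat \<times> nat) set \<Rightarrow> (nat \<times> nat) set set" where
  "cut_tree t H = (case t of (i, j, k) \<Rightarrow>
     if both t H then {insert (i, k) (H - {(j, k)}), insert (i, k) (H - {(i, j)})} else {H})"

text \<open>The three sets match the three summands of \<open>replacement\<close>. The last one has
  one arc fewer; it is the wall between the two halves and belongs to the summand with
  \<beta>.\<close>

definition cut_face :: "nat \<times> nat \<times> nat \<Rightarrow> (nat \<times> nat) set \<Rightarrow> (nat \<times> nat) set set" where
  "cut_face t S = (case t of (i, j, k) \<Rightarrow>
     if both t S then {insert (i, k) (S - {(j, k)}), insert (i, k) (S - {(i, j)}),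
       insert (i, k) (S - {(i, j), (j, k)})} else {S})"

definition faces :: "(nat \<times> nat) set set \<Rightarrow> (nat \<times> nat) set set" where
  "faces \<T> = {S. covers S \<and> (\<exists>H\<in>\<T>. S \<subseteq> H)}"

text \<open>Reroutes \<open>m\<close> units from the path through \<open>j\<close> to the direct arc
  from \<open>i\<close> to \<open>k\<close>; a negative \<open>m\<close> sends them back. The added
  function is a multiple of a cycle relation and has boundary 0.\<close>

definition shift :: "nat \<times> nat \<times> nat \<Rightarrow> real \<Rightarrow> (nat \<times> nat \<Rightarrow> real) \<Rightarrow> nat \<times> nat \<Rightarrow> real" where
  "shift t m c e = (case t of (i, j, k) \<Rightarrow>
     c e + m * (of_bool (e = (i, k)) - of_bool (e = (i, j)) - of_bool (e = (j, k))))"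

lemma bd_shift:
  assumes "{i, j, k} \<subseteq> {1..n}"
  shows "bd (shift (i, j, k) m c) u = bd c u"
proof -
  have "shift (i, j, k) m c = (\<lambda>e. 1 * c e + m * (of_bool (e = (i, k)) - of_bool (e = (i, j)) - of_bool (e = (j, k))))"
    by (auto simp: shift_def)
  then have "bd (shift (i, j, k) m c) u =
      1 * bd c u + m * (bd (\<lambda>e. of_bool (e = (i, k)) - of_bool (e = (i, j)) - of_bool (e = (j, k))) u)"
    by (simp only: bd_lincomb)
  also have "bd (\<lambda>e. of_bool (e = (i, k)) - of_bool (e = (i, j)) - of_bool (e = (j, k))) u = 0"
    using assms by (simp add: bd_diff bd_single)
  finally show ?thesis by simp
qed

context
  fixes \<T> i j k
  assumes fan: "tree_fan \<T>" and valid: "valid_triple (i, j, k)"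
begin

lemma valid_neqs: "i \<noteq> j" "j \<noteq> k" "i \<noteq> k"
  using valid by (auto simp: valid_triple_def)

lemma both_in:
  assumes "both (i, j, k) S" "S \<subseteq> H" "H \<in> \<T>"
  shows "{i, j, k} \<subseteq> {1..n}" "i \<in> I" "j \<in> V" "k \<in> J"
proof -
  have "(i, j) \<in> I \<times> J" "(j, k) \<in> I \<times> J"
    using assms tree_fanD(2)[OF fan] unfolding both_def by blast+
  then show "{i, j, k} \<subseteq> {1..n}" "i \<in> I" "j \<in> V" "k \<in> J" using I_sub J_sub by auto
qed

text \<open>Otherwise the path through \<open>j\<close> and the direct arc would be two nonnegative
  representations of the same vector in one tree.\<close>

lemma both_ik_notin:
  assumes H: "H \<in> \<T>" and b: "both (i, j, k) H"
  shows "(i, k) \<notin> H"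
proof
  assume ik: "(i, k) \<in> H"
  let ?c = "\<lambda>e. of_bool (e = (i, j)) + of_bool (e = (j, k)) :: real"
  let ?d = "\<lambda>e. of_bool (e = (i, k)) :: real"
  have "?c = ?d"
  proof (rule tree_fan_unique[OF fan H H])
    show "nonneg_on H ?c" "nonneg_on H ?d"
      using b ik by (auto intro!: nonneg_onI simp: both_def)
    show "bd ?c u = bd ?d u" if "u \<in> {1..n}" for u
      using both_in[OF b order_refl H] by (simp add: bd_add bd_single)
  qed
  then have "?c (i, k) = ?d (i, k)" by (rule fun_cong)
  then show False using valid_neqs by simp
qed

text \<open>Undoes a cut by sending the flow on \<open>(i, k)\<close> back through \<open>j\<close>.
  The second claim is what makes this step invertible in \<open>shift_inject\<close>.\<close>

lemma cut_tree_push: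
  assumes H: "H \<in> \<T>" and b: "both (i, j, k) H" and H': "H' \<in> cut_tree (i, j, k) H"
    and c: "nonneg_on H' c"
  shows "nonneg_on H (shift (i, j, k) (- c (i, k)) c)" "c (i, j) = 0 \<or> c (j, k) = 0"
proof -
  have ik: "(i, k) \<notin> H" by (rule both_ik_notin[OF H b])
  have H'_cases: "H' = insert (i, k) (H - {(j, k)}) \<or> H' = insert (i, k) (H - {(i, j)})"
    using H' b by (simp add: cut_tree_def)
  show "nonneg_on H (shift (i, j, k) (- c (i, k)) c)"
  proof (rule nonneg_onI)
    fix e
    show "0 \<le> shift (i, j, k) (- c (i, k)) c e"
      using nonneg_onD(1)[OF c, of e] nonneg_onD(1)[OF c, of "(i, k)"] valid_neqs
      by (auto simp: shift_def)
    assume e: "e \<notin> H"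
    then have "e \<noteq> (i, j)" "e \<noteq> (j, k)" using b by (auto simp: both_def)
    moreover have "c e = 0" if "e \<noteq> (i, k)"
      using H'_cases e that by (intro nonneg_onD(2)[OF c]) auto
    ultimately show "shift (i, j, k) (- c (i, k)) c e = 0" by (auto simp: shift_def)
  qed
  show "c (i, j) = 0 \<or> c (j, k) = 0"
    using H'_cases valid_neqs nonneg_onD(2)[OF c, of "(i, j)"] nonneg_onD(2)[OF c, of "(j, k)"] by auto
qed

text \<open>The pushed values on \<open>(i, j)\<close> and \<open>(j, k)\<close> exceed the original
  ones by \<open>c (i, k)\<close>, and one of the originals is 0, so \<open>c (i, k)\<close> is
  recovered as the smaller pushed value.\<close>

lemma shift_inject:
  assumes eq: "shift (i, j, k) (- c (i, k)) c = shift (i, j, k) (- c' (i, k)) c'"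
    and nn: "\<And>e. 0 \<le> c e" "\<And>e. 0 \<le> c' e"
    and z: "c (i, j) = 0 \<or> c (j, k) = 0" "c' (i, j) = 0 \<or> c' (j, k) = 0"
  shows "c = c'"
proof -
  have "c (i, j) + c (i, k) = c' (i, j) + c' (i, k)" "c (j, k) + c (i, k) = c' (j, k) + c' (i, k)"
    using fun_cong[OF eq, of "(i, j)"] fun_cong[OF eq, of "(j, k)"] valid_neqs by (auto simp: shift_def)
  then have "c (i, k) = c' (i, k)"
    using z nn(1)[of "(i, j)"] nn(1)[of "(j, k)"] nn(2)[of "(i, j)"] nn(2)[of "(j, k)"] by auto
  show "c = c'"
  proof
    fix e show "c e = c' e"
      using fun_cong[OF eq, of e] \<open>c (i, k) = c' (i, k)\<close> by (simp add: shift_def)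
  qed
qed

text \<open>After the push both functions live in the old fan and agree. But \<open>H2\<close> lacks
  one of the two arcs, where the push leaves at least \<open>c (i, k)\<close>; hence
  \<open>c (i, k)\<close> is 0 and the push changes nothing.\<close>

lemma cut_unique_mixed:
  assumes H: "H1 \<in> \<T>" "H2 \<in> \<T>" and b: "both (i, j, k) H1" "\<not> both (i, j, k) H2"
    and H': "H1' \<in> cut_tree (i, j, k) H1"
    and c: "nonneg_on H1' c" "nonneg_on H2 c'" and eq: "\<And>u. u \<in> {1..n} \<Longrightarrow> bd c u = bd c' u"
  shows "c = c'"
proof -
  let ?s = "shift (i, j, k) (- c (i, k)) c"
  have nn: "nonneg_on H1 ?s" using cut_tree_push[OF H(1) b(1) H' c(1)] by simp
  have s: "?s = c'"
    using eq by (intro tree_fan_unique[OF fan H nn c(2)]) (simp add: bd_shift[OF both_in(1)[OF b(1) order_refl H(1)]])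
  have "?s (i, j) = 0 \<or> ?s (j, k) = 0"
    using b(2) nonneg_onD(2)[OF c(2)] unfolding s by (auto simp: both_def)
  then have "c (i, k) = 0"
    using nonneg_onD(1)[OF c(1), of "(i, k)"] nonneg_onD(1)[OF c(1), of "(i, j)"]
      nonneg_onD(1)[OF c(1), of "(j, k)"] valid_neqs by (auto simp: shift_def)
  then have "?s = c" by (auto simp: shift_def)
  with s show ?thesis by simp
qed

lemma cut_tree_props:
  assumes H: "H \<in> \<T>" and H': "H' \<in> cut_tree (i, j, k) H"
  shows "H' \<subseteq> I \<times> J" "(a, a) \<notin> H'" "covers H'" "int_spanning H'" "card H' = n - 1"
proof -
  have "H' \<subseteq> I \<times> J \<and> (a, a) \<notin> H' \<and> covers H' \<and> int_spanning H' \<and> card H' = n - 1"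
  proof (cases "both (i, j, k) H")
    case False
    then have "H' = H" using H' by (simp add: cut_tree_def)
    then show ?thesis using tree_fanD[OF fan] H by blast
  next
    case True
    note b = both_in[OF True order_refl H]
    have mem: "(i, j) \<in> H" "(j, k) \<in> H" using True by (auto simp: both_def)
    have ik: "(i, k) \<notin> H" by (rule both_ik_notin[OF H True])
    \<comment> \<open>\<open>x\<close> is the arc that was removed and \<open>y\<close> the one that
      was kept; the two halves are treated alike.\<close>
    obtain x y where x: "H' = insert (i, k) (H - {x})" "{x, y} = {(i, j), (j, k)}" "x \<in> H"
      using H' True mem by (auto simp: cut_tree_def insert_commute)
    have sub: "H \<subseteq> I \<times> J" using tree_fanD(2)[OF fan H] .
    have "H' \<subseteq> I \<times> J" using x b sub by auto
    moreover have "(a, a) \<notin> H'" using x valid_neqs tree_fanD(3)[OF fan H] by auto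
    moreover have "covers H'"
      unfolding covers_def
    proof
      fix a assume a: "a \<in> {1..n} - V"
      then obtain e where e: "e \<in> H" "a = fst e \<or> a = snd e"
        using tree_fanD(4)[OF fan H] unfolding covers_def by blast
      show "\<exists>e\<in>H'. a = fst e \<or> a = snd e"
      proof (cases "e = x")
        case True
        then have "e \<in> {(i, j), (j, k)}" using x by blast
        \<comment> \<open>The middle vertex has arcs in and out, so it is a valley and need not be
          covered.\<close>
        moreover have "a \<noteq> j" using a b(3) by blast
        ultimately have "a = i \<or> a = k" using e by auto
        then show ?thesis using x by auto
      next
        case False
        then have "e \<in> H'" using e x by auto
        then show ?thesis using e by blast
      qed
    qed
    moreover have "int_spanning H'"
      unfolding int_spanning_def
    proof (intro ballI)
      fix a b' assume "a \<in> {1..n}" "b' \<in> {1..n}"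
      then obtain c where c: "\<And>e. c e \<in> \<int>" "\<And>e. e \<notin> H \<Longrightarrow> c e = 0"
        "\<And>u. u \<in> {1..n} \<Longrightarrow> bd c u = of_bool (a = u) - of_bool (b' = u)"
        using tree_fanD(5)[OF fan H] unfolding int_spanning_def by blast
      \<comment> \<open>Rerouting \<open>c x\<close> units empties the removed arc and keeps the
        coefficients integral.\<close>
      let ?c = "shift (i, j, k) (c x) c"
      have "?c e \<in> \<int>" for e using c(1) by (auto simp: shift_def)
      moreover have "?c e = 0" if "e \<notin> H'" for e
      proof (cases "e = x")
        case True
        then show ?thesis using x valid_neqs by (auto simp: shift_def doubleton_eq_iff)
      next
        case False
        with that x have "e \<notin> H" "e \<noteq> (i, k)" by auto
        then show ?thesis using c(2) mem by (auto simp: shift_def)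
      qed
      moreover have "bd ?c u = of_bool (a = u) - of_bool (b' = u)" if "u \<in> {1..n}" for u
        using c(3)[OF that] bd_shift[OF b(1)] by simp
      ultimately show "\<exists>c. (\<forall>e. c e \<in> \<int>) \<and> (\<forall>e. e \<notin> H' \<longrightarrow> c e = 0) \<and>
          (\<forall>u\<in>{1..n}. bd c u = of_bool (a = u) - of_bool (b' = u))" by blast
    qed
    moreover have "card H' = n - 1"
    proof -
      have "finite H" using sub by (rule IJ_finite)
      moreover have "card H > 0" using x calculation by (auto simp: card_gt_0_iff)
      ultimately have "card H' = card H" using x ik by simp
      then show ?thesis using tree_fanD(6)[OF fan H] by simp
    qed
    ultimately show ?thesis by blast
  qed
  then show "H' \<subseteq> I \<times> J" "(a, a) \<notin> H'" "covers H'" "int_spanning H'" "card H' = n - 1" by blast+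
qed

text \<open>Reroutes the smaller of the two flows through \<open>(i, k)\<close>; the arc that runs
  empty is the one to remove.\<close>

lemma cut_tree_complete:
  assumes H: "H \<in> \<T>" and c: "nonneg_on H c"
  shows "\<exists>H'\<in>cut_tree (i, j, k) H. \<exists>c'. nonneg_on H' c' \<and> (\<forall>u\<in>{1..n}. bd c' u = bd c u)"
proof (cases "both (i, j, k) H")
  case False
  then show ?thesis using c by (auto simp: cut_tree_def)
next
  case True
  note b = both_in[OF True order_refl H]
  have ik: "(i, k) \<notin> H" by (rule both_ik_notin[OF H True])
  note ck = nonneg_onD(2)[OF c ik]
  define m where "m = min (c (i, j)) (c (j, k))"
  define x where "x = (if c (j, k) \<le> c (i, j) then (j, k) else (i, j))"
  let ?c = "shift (i, j, k) m c"
  have "nonneg_on (insert (i, k) (H - {x})) ?c"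
  proof (rule nonneg_onI)
    fix e
    have "0 \<le> m" unfolding m_def using nonneg_onD(1)[OF c] by simp
    then show "0 \<le> ?c e"
      using nonneg_onD(1)[OF c, of e] ck valid_neqs by (auto simp: shift_def m_def)
    assume "e \<notin> insert (i, k) (H - {x})"
    then have "e \<noteq> (i, k)" "e = x \<or> e \<notin> H" by auto
    then show "?c e = 0"
      using valid_neqs True nonneg_onD(2)[OF c, of e] by (auto simp: shift_def m_def x_def both_def split: if_splits)
  qed
  moreover have "insert (i, k) (H - {x}) \<in> cut_tree (i, j, k) H"
    using True by (auto simp: cut_tree_def x_def)
  ultimately show ?thesis using bd_shift[OF b(1)] by blast
qed

lemma tree_fan_cut: "tree_fan (\<Union>H\<in>\<T>. cut_tree (i, j, k) H)"
proof -
  have fin: "finite (cut_tree (i, j, k) H)" for H by (simp add: cut_tree_def)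
  have unique: "c = c'"
    if H: "H1 \<in> \<T>" "H2 \<in> \<T>" "H1' \<in> cut_tree (i, j, k) H1" "H2' \<in> cut_tree (i, j, k) H2"
      and c: "nonneg_on H1' c" "nonneg_on H2' c'" and eq: "\<forall>u\<in>{1..n}. bd c u = bd c' u"
    for H1 H2 H1' H2' c c'
  proof -
    have unc: "H' = H" if "\<not> both (i, j, k) H" "H' \<in> cut_tree (i, j, k) H" for H H'
      using that by (simp add: cut_tree_def)
    consider "both (i, j, k) H1" "both (i, j, k) H2" | "both (i, j, k) H1" "\<not> both (i, j, k) H2"
      | "\<not> both (i, j, k) H1" "both (i, j, k) H2" | "\<not> both (i, j, k) H1" "\<not> both (i, j, k) H2"
      by blast
    then show ?thesis
    proof cases
      case 1
      note p1 = cut_tree_push[OF H(1) 1(1) H(3) c(1)] and p2 = cut_tree_push[OF H(2) 1(2) H(4) c(2)]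
      have "shift (i, j, k) (- c (i, k)) c = shift (i, j, k) (- c' (i, k)) c'"
        using eq by (intro tree_fan_unique[OF fan H(1,2) p1(1) p2(1)])
          (simp add: bd_shift[OF both_in(1)[OF 1(1) order_refl H(1)]])
      then show ?thesis
        by (rule shift_inject[OF _ nonneg_onD(1)[OF c(1)] nonneg_onD(1)[OF c(2)] p1(2) p2(2)])
    next
      case 2
      then show ?thesis using cut_unique_mixed[OF H(1,2) 2 H(3) c(1)] unc[OF 2(2) H(4)] c eq by blast
    next
      case 3
      have "c' = c"
        using cut_unique_mixed[OF H(2,1) 3(2,1) H(4) c(2)] unc[OF 3(1) H(3)] c eq by force
      then show ?thesis ..
    next
      case 4
      then show ?thesis using tree_fan_unique[OF fan H(1,2)] unc[OF 4(1) H(3)] unc[OF 4(2) H(4)] c eq by blast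
    qed
  qed
  have complete: "\<exists>H'\<in>\<Union>H\<in>\<T>. cut_tree (i, j, k) H. \<exists>c. nonneg_on H' c \<and> (\<forall>u\<in>{1..n}. bd c u = d u)"
    if d: "balanced d" for d
  proof -
    obtain H c where H: "H \<in> \<T>" "nonneg_on H c" "\<And>u. u \<in> {1..n} \<Longrightarrow> bd c u = d u"
      using tree_fanD(7)[OF fan d] by blast
    from cut_tree_complete[OF H(1,2)] H show ?thesis by (metis UN_I)
  qed
  show ?thesis
    unfolding tree_fan_def
  proof (intro conjI)
    show "finite (\<Union>H\<in>\<T>. cut_tree (i, j, k) H)" using tree_fanD(1)[OF fan] fin by blast
    show "\<forall>H\<in>\<Union>H\<in>\<T>. cut_tree (i, j, k) H. H \<subseteq> I \<times> J \<and> (\<forall>a. (a, a) \<notin> H) \<and> covers H \<and>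
        int_spanning H \<and> card H = n - 1"
      using cut_tree_props by (metis (no_types, lifting) UN_E)
    show "\<forall>H\<in>\<Union>H\<in>\<T>. cut_tree (i, j, k) H. \<forall>H'\<in>\<Union>H\<in>\<T>. cut_tree (i, j, k) H. \<forall>c c'.
        nonneg_on H c \<longrightarrow> nonneg_on H' c' \<longrightarrow> (\<forall>u\<in>{1..n}. bd c u = bd c' u) \<longrightarrow> c = c'"
      using unique by (metis (no_types, lifting) UN_E)
    show "\<forall>d. balanced d \<longrightarrow>
        (\<exists>H\<in>\<Union>H\<in>\<T>. cut_tree (i, j, k) H. \<exists>c. nonneg_on H c \<and> (\<forall>u\<in>{1..n}. bd c u = d u))"
      using complete by blast
  qed
qed

lemma facesD:
  assumes "S \<in> faces \<T>"
  obtains H where "H \<in> \<T>" "S \<subseteq> H" "covers S" "S \<subseteq> I \<times> J"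
  using assms tree_fanD(2)[OF fan] unfolding faces_def by blast

text \<open>The ends \<open>i\<close> and \<open>k\<close> of the lost arcs are covered by
  \<open>(i, k)\<close>, and \<open>j\<close> is exempt as a valley.\<close>

lemma covers_swap:
  assumes cov: "covers S" and j: "j \<in> V" and S': "(i, k) \<in> S'" "S - {(i, j), (j, k)} \<subseteq> S'"
  shows "covers S'"
  unfolding covers_def
proof
  fix a assume a: "a \<in> {1..n} - V"
  then obtain e where e: "e \<in> S" "a = fst e \<or> a = snd e"
    using cov unfolding covers_def by blast
  have "a \<noteq> j" using a j by blast
  show "\<exists>e\<in>S'. a = fst e \<or> a = snd e"
  proof (cases "e \<in> {(i, j), (j, k)}")
    case True
    then have "a = i \<or> a = k" using e \<open>a \<noteq> j\<close> by auto
    then show ?thesis using S'(1) by force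
  next
    case False
    then show ?thesis using e S'(2) by blast
  qed
qed

text \<open>Cutting all trees has the same effect as cutting each covering subforest by itself. A
  reduction works on single monomials, so it is this form that the polynomial can follow.\<close>

lemma faces_cut: "faces (\<Union>H\<in>\<T>. cut_tree (i, j, k) H) = (\<Union>S\<in>faces \<T>. cut_face (i, j, k) S)"
proof (intro subset_antisym subsetI)
  fix S' assume "S' \<in> faces (\<Union>H\<in>\<T>. cut_tree (i, j, k) H)"
  then obtain H H' where H: "H \<in> \<T>" "H' \<in> cut_tree (i, j, k) H" "S' \<subseteq> H'" "covers S'"
    unfolding faces_def by blast
  show "S' \<in> (\<Union>S\<in>faces \<T>. cut_face (i, j, k) S)"
  proof (cases "both (i, j, k) H")
    case False
    then have "S' \<subseteq> H" using H by (simp add: cut_tree_def)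
    moreover from this have "\<not> both (i, j, k) S'" using False by (auto simp: both_def)
    ultimately have "S' \<in> faces \<T>" "S' \<in> cut_face (i, j, k) S'"
      using H unfolding faces_def by (auto simp: cut_face_def)
    then show ?thesis by blast
  next
    case True
    have mem: "(i, j) \<in> H" "(j, k) \<in> H" using True by (auto simp: both_def)
    have ik: "(i, k) \<notin> H" by (rule both_ik_notin[OF H(1) True])
    have H': "H' = insert (i, k) (H - {(j, k)}) \<or> H' = insert (i, k) (H - {(i, j)})"
      using H(2) True by (simp add: cut_tree_def)
    have nb: "\<not> ((i, j) \<in> S' \<and> (j, k) \<in> S')" using H' H(3) valid_neqs by auto
    show ?thesis
    proof (cases "(i, k) \<in> S'")
      case False
      then have "S' \<subseteq> H" using H' H(3) by auto
      moreover have "\<not> both (i, j, k) S'" using nb by (auto simp: both_def)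
      ultimately have "S' \<in> faces \<T>" "S' \<in> cut_face (i, j, k) S'"
        using H unfolding faces_def by (auto simp: cut_face_def)
      then show ?thesis by blast
    next
      case ikS: True
      \<comment> \<open>The face that was cut contained both arcs, whichever of them are left in
        \<open>S'\<close>.\<close>
      define S where "S = (S' - {(i, k)}) \<union> {(i, j), (j, k)}"
      have "S \<subseteq> H" using H' H(3) mem unfolding S_def by auto
      moreover have "covers S"
        unfolding covers_def
      proof
        fix a assume "a \<in> {1..n} - V"
        then obtain e where e: "e \<in> S'" "a = fst e \<or> a = snd e"
          using H(4) unfolding covers_def by blast
        show "\<exists>e\<in>S. a = fst e \<or> a = snd e"
          using e by (cases "e = (i, k)") (auto simp: S_def)
      qed
      ultimately have "S \<in> faces \<T>" using H(1) unfolding faces_def by blast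
      moreover have "S' \<in> cut_face (i, j, k) S"
      proof -
        have b: "both (i, j, k) S" by (auto simp: both_def S_def)
        consider "(i, j) \<in> S'" | "(j, k) \<in> S'" | "(i, j) \<notin> S'" "(j, k) \<notin> S'" by blast
        then show ?thesis
        proof cases
          case 1
          then have "S' = insert (i, k) (S - {(j, k)})"
            using nb ikS valid_neqs unfolding S_def by auto
          then show ?thesis using b by (simp add: cut_face_def)
        next
          case 2
          then have "S' = insert (i, k) (S - {(i, j)})"
            using nb ikS valid_neqs unfolding S_def by auto
          then show ?thesis using b by (simp add: cut_face_def)
        next
          case 3
          then have "S' = insert (i, k) (S - {(i, j), (j, k)})"
            using nb ikS valid_neqs unfolding S_def by auto
          then show ?thesis using b by (simp add: cut_face_def)
        qed
      qed
      ultimately show ?thesis by blast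
    qed
  qed
next
  fix S' assume "S' \<in> (\<Union>S\<in>faces \<T>. cut_face (i, j, k) S)"
  then obtain S where S: "S \<in> faces \<T>" "S' \<in> cut_face (i, j, k) S" by blast
  obtain H where H: "H \<in> \<T>" "S \<subseteq> H" "covers S" using S(1) by (rule facesD)
  show "S' \<in> faces (\<Union>H\<in>\<T>. cut_tree (i, j, k) H)"
  proof (cases "both (i, j, k) S")
    case False
    then have S': "S' = S" using S(2) by (simp add: cut_face_def)
    have "\<exists>H'\<in>cut_tree (i, j, k) H. S \<subseteq> H'"
    proof (cases "both (i, j, k) H")
      case True
      with False H(2) show ?thesis by (auto simp: cut_tree_def both_def)
    qed (use H in \<open>simp add: cut_tree_def\<close>)
    then show ?thesis using H S' unfolding faces_def by blast
  next
    case True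
    then have b: "both (i, j, k) H" using H(2) by (auto simp: both_def)
    have S': "S' = insert (i, k) (S - {(j, k)}) \<or> S' = insert (i, k) (S - {(i, j)}) \<or>
        S' = insert (i, k) (S - {(i, j), (j, k)})"
      using S(2) True by (auto simp: cut_face_def)
    then have "covers S'"
      by (intro covers_swap[OF H(3) both_in(3)[OF b order_refl H(1)]]) auto
    moreover have "\<exists>H'\<in>cut_tree (i, j, k) H. S' \<subseteq> H'"
      using b S' H(2) by (auto simp: cut_tree_def)
    ultimately show ?thesis using H(1) unfolding faces_def by blast
  qed
qed

text \<open>A flow with support exactly \<open>S'\<close> becomes, after undoing the cut, a flow with support exactly
  \<open>S1\<close> and with support exactly \<open>S2\<close>; flows are unique.\<close>

lemma cut_face_disjoint:
  assumes S: "S1 \<in> faces \<T>" "S2 \<in> faces \<T>" and S': "S' \<in> cut_face (i, j, k) S1" "S' \<in> cut_face (i, j, k) S2"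
  shows "S1 = S2"
proof -
  let ?c = "\<lambda>e. of_bool (e \<in> S') :: real"
  have "\<exists>H\<in>\<T>. \<exists>c. nonneg_on H c \<and> {e. c e \<noteq> 0} = S \<and> (\<forall>u\<in>{1..n}. bd c u = bd ?c u)"
    if S: "S \<in> faces \<T>" and S': "S' \<in> cut_face (i, j, k) S" for S
  proof -
    obtain H where H: "H \<in> \<T>" "S \<subseteq> H" using S by (rule facesD)
    show ?thesis
    proof (cases "both (i, j, k) S")
      case False
      then have "S' = S" using S' by (simp add: cut_face_def)
      then have "nonneg_on H ?c" "{e. ?c e \<noteq> 0} = S" using H(2) by (auto intro!: nonneg_onI)
      then show ?thesis using H(1) by blast
    next
      case True
      then have b: "both (i, j, k) H" using H(2) by (auto simp: both_def)
      have mem: "(i, j) \<in> S" "(j, k) \<in> S" using True by (auto simp: both_def)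
      have ik: "(i, k) \<notin> S" using both_ik_notin[OF H(1) b] H(2) by blast
      have cases: "S' = insert (i, k) (S - {(j, k)}) \<or> S' = insert (i, k) (S - {(i, j)}) \<or>
          S' = insert (i, k) (S - {(i, j), (j, k)})"
        using S' True by (auto simp: cut_face_def)
      \<comment> \<open>The unit on \<open>(i, k)\<close> goes back through \<open>j\<close>, so
        both arcs get a value of at least 1 and the support becomes exactly
        \<open>S\<close>.\<close>
      let ?s = "shift (i, j, k) (-1) ?c"
      have s: "?s e = (if e = (i, j) \<or> e = (j, k) then 1 + ?c e else if e = (i, k) then 0 else ?c e)" for e
        using cases valid_neqs by (auto simp: shift_def)
      have "?s e \<noteq> 0 \<longleftrightarrow> e \<in> S" "0 \<le> ?s e" for e
        using cases ik mem by (auto simp: s)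
      then have "nonneg_on H ?s" "{e. ?s e \<noteq> 0} = S" using H(2) by (blast intro: nonneg_onI)+
      then show ?thesis using H(1) bd_shift[OF both_in(1)[OF b order_refl H(1)]] by blast
    qed
  qed
  from this[OF S(1) S'(1)] this[OF S(2) S'(2)]
  obtain H1 H2 c1 c2 where "H1 \<in> \<T>" "H2 \<in> \<T>" "nonneg_on H1 c1" "nonneg_on H2 c2"
    "{e. c1 e \<noteq> 0} = S1" "{e. c2 e \<noteq> 0} = S2" "\<And>u. u \<in> {1..n} \<Longrightarrow> bd c1 u = bd c2 u"
    by (metis (no_types, lifting))
  with tree_fan_unique[OF fan] show ?thesis by blast
qed

end

end

section \<open>Reductions\<close>

lemma subdivision_ideal_add:
  assumes "x \<in> subdivision_ideal" "y \<in> subdivision_ideal"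
  shows "x + y \<in> subdivision_ideal"
  using assms(2)
proof induction
  case zero
  then show ?case using assms(1) by simp
next
  case (add p i j k q)
  from subdivision_ideal.add[OF add.IH add.hyps(2), of q] show ?case by (simp add: add.assoc)
qed

lemma subdivision_ideal_sum:
  "(\<And>a. a \<in> A \<Longrightarrow> f a \<in> subdivision_ideal) \<Longrightarrow> sum f A \<in> subdivision_ideal"
  by (induction A rule: infinite_finite_induct)
    (auto intro: subdivision_ideal.zero subdivision_ideal_add)

lemma subdivision_ideal_mult:
  assumes "valid_triple (i, j, k)"
  shows "q * (xvar i j * xvar j k - replacement i j k) \<in> subdivision_ideal"
  using subdivision_ideal.add[OF subdivision_ideal.zero assms, of q] by simp

lemma single_power: "Poly_Mapping.single m (1::int poly) ^ c = Poly_Mapping.single (of_nat c * m) 1"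
  for m :: monomial
  by (induction c) (simp_all add: mult_single algebra_simps)

lemma lookup_of_nat_mult: "Poly_Mapping.lookup (of_nat c * m) e = c * Poly_Mapping.lookup m e"
  for m :: monomial
  by (induction c) (simp_all add: lookup_add algebra_simps)

lemma of_nat_mult_single: "of_nat c * Poly_Mapping.single (e :: nat \<times> nat) (1::nat) = Poly_Mapping.single e c"
  by (rule poly_mapping_eqI) (simp add: lookup_of_nat_mult lookup_single when_def)

text \<open>A monomial with \<open>c\<close> occurrences has the factor b^c replaced by a^c, where
  \<open>b\<close> is the product and \<open>a\<close> its replacement; a - b divides a^c -
  b^c.\<close>

lemma reduce_in_ideal:
  assumes t: "valid_triple t"
  shows "reduce t p - p \<in> subdivision_ideal"
proof -
  obtain i j k where ijk: "t = (i, j, k)" by (metis prod_cases3)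
  define c where "c m = min (Poly_Mapping.lookup m (i, j)) (Poly_Mapping.lookup m (j, k))" for m :: monomial
  define q where "q m = Poly_Mapping.single
      (m - Poly_Mapping.single (i, j) (c m) - Poly_Mapping.single (j, k) (c m)) (Poly_Mapping.lookup p m)" for m
  have neq: "(i, j) \<noteq> (j, k)" using t ijk by (auto simp: valid_triple_def)
  have split: "Poly_Mapping.single m (Poly_Mapping.lookup p m) = q m * (xvar i j * xvar j k) ^ c m" for m
  proof -
    have "m = m - Poly_Mapping.single (i, j) (c m) - Poly_Mapping.single (j, k) (c m)
        + (Poly_Mapping.single (i, j) (c m) + Poly_Mapping.single (j, k) (c m))"
      by (rule poly_mapping_eqI)
        (use neq in \<open>auto simp: lookup_add lookup_minus lookup_single when_def c_def\<close>)
    then have "Poly_Mapping.single m (Poly_Mapping.lookup p m) =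
        q m * Poly_Mapping.single (Poly_Mapping.single (i, j) (c m) + Poly_Mapping.single (j, k) (c m)) 1"
      unfolding q_def by (simp add: mult_single)
    also have "Poly_Mapping.single (Poly_Mapping.single (i, j) (c m) + Poly_Mapping.single (j, k) (c m)) 1
        = (xvar i j * xvar j k) ^ c m"
      unfolding xvar_def by (simp add: mult_single single_power distrib_left of_nat_mult_single del: One_nat_def)
    finally show ?thesis .
  qed
  have p_eq: "p = (\<Sum>m\<in>Poly_Mapping.keys p. Poly_Mapping.single m (Poly_Mapping.lookup p m))"
    by (rule poly_mapping_eqI) (simp add: lookup_sum lookup_single when_def in_keys_iff)
  have "reduce t p - p = (\<Sum>m\<in>Poly_Mapping.keys p. q m * replacement i j k ^ c m) -
      (\<Sum>m\<in>Poly_Mapping.keys p. q m * (xvar i j * xvar j k) ^ c m)"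
    unfolding split[symmetric] p_eq[symmetric]
    by (simp add: reduce_def ijk q_def c_def Let_def)
  also have "\<dots> = (\<Sum>m\<in>Poly_Mapping.keys p. q m * (replacement i j k ^ c m - (xvar i j * xvar j k) ^ c m))"
    by (simp add: algebra_simps sum_subtractf)
  also have "\<dots> \<in> subdivision_ideal"
  proof (rule subdivision_ideal_sum)
    fix m
    let ?a = "replacement i j k" and ?b = "xvar i j * xvar j k"
    obtain z where z: "?a ^ c m - ?b ^ c m = (?a - ?b) * z"
      using power_diff_sumr2[of ?a "c m" ?b] by blast
    have "q m * (?a ^ c m - ?b ^ c m) = - (q m * z) * (?b - ?a)"
      unfolding z by (simp add: algebra_simps)
    then show "q m * (?a ^ c m - ?b ^ c m) \<in> subdivision_ideal"
      using subdivision_ideal_mult t ijk by metis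
  qed
  finally show ?thesis .
qed

lemma fold_reduce_eq:
  assumes "list_all valid_triple ts"
  shows "eq_in_subdivision_algebra (fold reduce ts p) p"
  using assms
proof (induction ts arbitrary: p)
  case Nil
  then show ?case by (simp add: eq_in_subdivision_algebra_def subdivision_ideal.zero)
next
  case (Cons t ts)
  then have "fold reduce ts (reduce t p) - reduce t p + (reduce t p - p) \<in> subdivision_ideal"
    unfolding eq_in_subdivision_algebra_def by (intro subdivision_ideal_add reduce_in_ideal) auto
  then show ?case by (simp add: eq_in_subdivision_algebra_def)
qed

section \<open>Square-free monomials and the polynomial of a family of faces\<close>

definition sf_mono :: "(nat \<times> nat) set \<Rightarrow> monomial" where
  "sf_mono S = (\<Sum>e\<in>S. Poly_Mapping.single e 1)"

lemma lookup_sf_mono: "finite S \<Longrightarrow> Poly_Mapping.lookup (sf_mono S) e = of_bool (e \<in> S)"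
  unfolding sf_mono_def by (simp add: lookup_sum lookup_single when_def)

lemma sf_mono_inject: "finite S \<Longrightarrow> finite S' \<Longrightarrow> sf_mono S = sf_mono S' \<longleftrightarrow> S = S'"
  using lookup_sf_mono by (metis of_bool_eq_iff subsetI subset_antisym)

lemma sf_mono_insert: "finite S \<Longrightarrow> e \<notin> S \<Longrightarrow> sf_mono (insert e S) = Poly_Mapping.single e 1 + sf_mono S"
  by (simp add: sf_mono_def)

lemma prod_xvar: "finite S \<Longrightarrow> (\<Prod>(i, j)\<in>S. xvar i j) = Poly_Mapping.single (sf_mono S) 1"
  by (induction S rule: finite_induct)
    (auto simp: sf_mono_insert xvar_def mult_single sf_mono_def)

context valley_path begin

text \<open>Spanning trees have \<open>n - 1\<close> arcs, so the exponent is the number of arcs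
  missing from a tree; \<open>codim_cell\<close> identifies it with the codimension of the
  cell.\<close>

definition face_term :: "(nat \<times> nat) set \<Rightarrow> spoly" where
  "face_term S = Poly_Mapping.single (sf_mono S) (monom 1 (n - 1 - card S))"

definition face_poly :: "(nat \<times> nat) set set \<Rightarrow> spoly" where
  "face_poly \<S> = (\<Sum>S\<in>\<S>. face_term S)"

text \<open>Different sets have different monomials, so summands never meet and every coefficient is
  0 or a pure power of \<beta>.\<close>

lemma lookup_face_poly:
  assumes "finite \<S>" "\<forall>S\<in>\<S>. finite S"
  shows "Poly_Mapping.lookup (face_poly \<S>) m =
    (if m \<in> sf_mono ` \<S> then monom 1 (n - 1 - card (Poly_Mapping.keys m)) else 0)"
proof -
  have keys: "Poly_Mapping.keys (sf_mono S) = S" if "S \<in> \<S>" for S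
    using lookup_sf_mono[OF bspec[OF assms(2) that]] by (auto simp: in_keys_iff)
  have "Poly_Mapping.lookup (face_poly \<S>) m =
      (\<Sum>S\<in>\<S>. if sf_mono S = m then monom 1 (n - 1 - card S) else 0)"
    by (simp only: face_poly_def face_term_def lookup_sum lookup_single when_def)
  also have "\<dots> = (\<Sum>S\<in>\<S>. if S = Poly_Mapping.keys m \<and> m \<in> sf_mono ` \<S> then monom 1 (n - 1 - card S) else 0)"
    by (rule sum.cong) (use keys in auto)
  also have "\<dots> = (if m \<in> sf_mono ` \<S> then monom 1 (n - 1 - card (Poly_Mapping.keys m)) else 0)"
    using assms(1) keys by (auto simp: if_distrib)
  finally show ?thesis .
qed

lemma keys_face_poly:
  assumes "finite \<S>" "\<forall>S\<in>\<S>. finite S"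
  shows "Poly_Mapping.keys (face_poly \<S>) = sf_mono ` \<S>"
  by (rule set_eqI) (simp add: in_keys_iff lookup_face_poly[OF assms])

lemma keys_sf_mono: "finite S \<Longrightarrow> Poly_Mapping.keys (sf_mono S) = S"
  using lookup_sf_mono by (auto simp: in_keys_iff)

lemma terms_face_poly:
  assumes "finite \<S>" "\<forall>S\<in>\<S>. finite S"
  shows "terms (face_poly \<S>) = face_term ` \<S>"
proof (intro subset_antisym subsetI)
  fix x assume "x \<in> terms (face_poly \<S>)"
  then obtain m k where x: "x = Poly_Mapping.single m (monom (coeff (Poly_Mapping.lookup (face_poly \<S>) m) k) k)"
    "coeff (Poly_Mapping.lookup (face_poly \<S>) m) k \<noteq> 0" unfolding terms_def by blast
  then obtain S where "S \<in> \<S>" "m = sf_mono S" "k = n - 1 - card S"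
    using lookup_face_poly[OF assms, of m] keys_sf_mono assms(2) by (auto split: if_splits)
  moreover from this have "Poly_Mapping.lookup (face_poly \<S>) m = monom 1 k"
    using lookup_face_poly[OF assms, of m] keys_sf_mono assms(2) by auto
  ultimately show "x \<in> face_term ` \<S>" using x by (auto simp: face_term_def)
next
  fix x assume "x \<in> face_term ` \<S>"
  then obtain S where S: "S \<in> \<S>" "x = face_term S" by blast
  have "Poly_Mapping.lookup (face_poly \<S>) (sf_mono S) = monom 1 (n - 1 - card S)"
    using lookup_face_poly[OF assms, of "sf_mono S"] S(1) keys_sf_mono[OF bspec[OF assms(2) S(1)]] by simp
  then show "x \<in> terms (face_poly \<S>)"
    unfolding terms_def S(2) face_term_def
    by (intro CollectI exI[of _ "sf_mono S"] exI[of _ "n - 1 - card S"]) simp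
qed

lemma cut_face_finite: "finite S \<Longrightarrow> S' \<in> cut_face t S \<Longrightarrow> finite S'" "finite (cut_face t S)"
  unfolding cut_face_def by (cases t; auto split: if_splits)+

lemma face_term_reduce:
  assumes S: "finite S" "card S \<le> n - 1" and valid: "valid_triple (i, j, k)"
    and ik: "both (i, j, k) S \<Longrightarrow> (i, k) \<notin> S"
  defines "c \<equiv> min (Poly_Mapping.lookup (sf_mono S) (i, j)) (Poly_Mapping.lookup (sf_mono S) (j, k))"
  shows "Poly_Mapping.single (sf_mono S - Poly_Mapping.single (i, j) c - Poly_Mapping.single (j, k) c)
      (monom 1 (n - 1 - card S)) * replacement i j k ^ c = (\<Sum>S'\<in>cut_face (i, j, k) S. face_term S')"
proof (cases "both (i, j, k) S")
  case False
  then have "c = 0" using S by (auto simp: c_def lookup_sf_mono both_def)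
  then show ?thesis using False by (simp add: cut_face_def face_term_def)
next
  case True
  have neq: "i \<noteq> j" "j \<noteq> k" "i \<noteq> k" using valid by (auto simp: valid_triple_def)
  have mem: "(i, j) \<in> S" "(j, k) \<in> S" and c: "c = 1"
    using True S by (auto simp: c_def lookup_sf_mono both_def)
  note ik = ik[OF True]
  define R where "R = S - {(i, j), (j, k)}"
  have R: "finite R" "(i, j) \<notin> R" "(j, k) \<notin> R" "(i, k) \<notin> R" using S ik by (auto simp: R_def)
  have S_eq: "S = insert (i, j) (insert (j, k) R)" using mem by (auto simp: R_def)
  have cardS: "card S = card R + 2" using R neq by (simp add: S_eq)
  have m: "sf_mono S - Poly_Mapping.single (i, j) c - Poly_Mapping.single (j, k) c = sf_mono R"
    by (rule poly_mapping_eqI)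
      (use R neq S in \<open>auto simp: c lookup_minus lookup_single when_def lookup_sf_mono S_eq\<close>)
  let ?S1 = "insert (i, k) (S - {(j, k)})" and ?S2 = "insert (i, k) (S - {(i, j)})" and ?S3 = "insert (i, k) R"
  have eqs: "?S1 = insert (i, k) (insert (i, j) R)" "?S2 = insert (i, k) (insert (j, k) R)"
    using R neq by (auto simp: S_eq)
  have "cut_face (i, j, k) S = {?S1, ?S2, ?S3}"
    using True by (simp add: cut_face_def R_def)
  moreover have "?S1 \<noteq> ?S2" "?S1 \<noteq> ?S3" "?S2 \<noteq> ?S3"
    using R neq unfolding eqs by auto
  ultimately have "(\<Sum>S'\<in>cut_face (i, j, k) S. face_term S') = face_term ?S1 + face_term ?S2 + face_term ?S3"
    by (simp add: add.assoc)
  also have "\<dots> = Poly_Mapping.single (sf_mono R) (monom 1 (n - 1 - card S)) * replacement i j k"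
  proof -
    \<comment> \<open>The set for the \<beta> summand has one arc fewer than \<open>S\<close>, hence
      one power of \<beta> more. The bound on \<open>card S\<close> keeps the truncated subtraction
      exact.\<close>
    have e: "n - Suc (Suc (card R)) = Suc (n - Suc (Suc (Suc (card R))))"
      using S(2) cardS by simp
    show ?thesis
      using R neq
      by (simp add: eqs face_term_def sf_mono_insert cardS replacement_def xvar_def beta_def mult_single
          distrib_left mult_monom add_ac e)
  qed
  finally show ?thesis by (simp only: m) (simp add: c)
qed

text \<open>The hypothesis \<open>disj\<close> says that no term arises from two faces. Thus nothing
  merges and the result is again a sum with one term for each face.\<close>

lemma reduce_face_poly:
  assumes "finite \<S>" and S: "\<And>S. S \<in> \<S> \<Longrightarrow> finite S \<and> card S \<le> n - 1 \<and> (both (i, j, k) S \<longrightarrow> (i, k) \<notin> S)"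
    and disj: "\<And>S1 S2 S'. S1 \<in> \<S> \<Longrightarrow> S2 \<in> \<S> \<Longrightarrow> S' \<in> cut_face (i, j, k) S1 \<Longrightarrow> S' \<in> cut_face (i, j, k) S2 \<Longrightarrow> S1 = S2"
    and valid: "valid_triple (i, j, k)"
  shows "reduce (i, j, k) (face_poly \<S>) = face_poly (\<Union>S\<in>\<S>. cut_face (i, j, k) S)"
proof -
  have fin: "\<forall>S\<in>\<S>. finite S" using S by blast
  have inj: "inj_on sf_mono \<S>" using fin sf_mono_inject by (auto intro!: inj_onI)
  have "reduce (i, j, k) (face_poly \<S>) = (\<Sum>S\<in>\<S>. \<Sum>S'\<in>cut_face (i, j, k) S. face_term S')"
    unfolding reduce_def prod.case keys_face_poly[OF assms(1) fin] sum.reindex[OF inj] o_def Let_def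
  proof (rule sum.cong[OF refl])
    fix S assume "S \<in> \<S>"
    then have "Poly_Mapping.lookup (face_poly \<S>) (sf_mono S) = monom 1 (n - 1 - card S)"
      using fin by (simp only: lookup_face_poly[OF assms(1) fin] keys_sf_mono bspec[OF fin] imageI if_True)
    then show "Poly_Mapping.single
        (sf_mono S - Poly_Mapping.single (i, j) (min (Poly_Mapping.lookup (sf_mono S) (i, j)) (Poly_Mapping.lookup (sf_mono S) (j, k))) -
          Poly_Mapping.single (j, k) (min (Poly_Mapping.lookup (sf_mono S) (i, j)) (Poly_Mapping.lookup (sf_mono S) (j, k))))
        (Poly_Mapping.lookup (face_poly \<S>) (sf_mono S)) *
        replacement i j k ^ min (Poly_Mapping.lookup (sf_mono S) (i, j)) (Poly_Mapping.lookup (sf_mono S) (j, k)) =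
      (\<Sum>S'\<in>cut_face (i, j, k) S. face_term S')"
      using face_term_reduce[of S i j k] S[OF \<open>S \<in> \<S>\<close>] valid by (simp only: simp_thms)
  qed
  also have "\<dots> = face_poly (\<Union>S\<in>\<S>. cut_face (i, j, k) S)"
    unfolding face_poly_def using assms(1) disj cut_face_finite(2)
    by (subst sum.UNION_disjoint) auto
  finally show ?thesis .
qed

lemma faces_finite:
  assumes "tree_fan \<T>"
  shows "finite (faces \<T>)" "S \<in> faces \<T> \<Longrightarrow> finite S" "S \<in> faces \<T> \<Longrightarrow> card S \<le> n - 1"
proof -
  have H: "finite H" if "H \<in> \<T>" for H using tree_fanD(2)[OF assms that] by (rule IJ_finite)
  have "faces \<T> \<subseteq> \<Union>(Pow ` \<T>)" unfolding faces_def by blast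
  then show "finite (faces \<T>)"
    using H tree_fanD(1)[OF assms] by (metis (no_types, lifting) finite_Pow_iff finite_UN finite_subset)
  assume "S \<in> faces \<T>"
  then obtain H' where "H' \<in> \<T>" "S \<subseteq> H'" unfolding faces_def by blast
  then show "finite S" "card S \<le> n - 1"
    using H card_mono[of H' S] tree_fanD(6)[OF assms] by (auto intro: finite_subset)
qed

theorem reduce_faces:
  assumes fan: "tree_fan \<T>" and valid: "valid_triple t"
  shows "reduce t (face_poly (faces \<T>)) = face_poly (faces (\<Union>H\<in>\<T>. cut_tree t H))"
proof -
  obtain i j k where t: "t = (i, j, k)" by (metis prod_cases3)
  note valid = valid[unfolded t]
  have "both (i, j, k) S \<longrightarrow> (i, k) \<notin> S" if "S \<in> faces \<T>" for S
  proof
    assume b: "both (i, j, k) S"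
    obtain H where H: "H \<in> \<T>" "S \<subseteq> H" using \<open>S \<in> faces \<T>\<close> unfolding faces_def by blast
    with b have "both (i, j, k) H" by (auto simp: both_def)
    from both_ik_notin[OF fan valid H(1) this] H(2) show "(i, k) \<notin> S" by blast
  qed
  then show ?thesis
    unfolding t faces_cut[OF fan valid]
    using faces_finite[OF fan] cut_face_disjoint[OF fan valid] valid
    by (intro reduce_face_poly) auto
qed

end

section \<open>Flows of augmented graphs\<close>

lemma lookup_scaleR [simp]: "Poly_Mapping.lookup (r *\<^sub>R x) e = r *\<^sub>R Poly_Mapping.lookup x e"
proof -
  have "finite {e. r *\<^sub>R Poly_Mapping.lookup x e \<noteq> 0}"
    by (rule finite_subset[OF _ finite_keys[of x]]) (auto simp: in_keys_iff)
  then show ?thesis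
    unfolding scaleR_poly_mapping_def by (simp add: lookup_Abs_poly_mapping)
qed

context valley_path begin

text \<open>Excludes loops and opposite arcs. Then forgetting directions by \<open>upair\<close> is
  injective, and every arc can be stored as a forward or backward edge.\<close>

definition simple :: "(nat \<times> nat) set \<Rightarrow> bool" where
  "simple S \<longleftrightarrow> S \<subseteq> {1..n} \<times> {1..n} \<and> (\<forall>a b. (a, b) \<in> S \<longrightarrow> a \<noteq> b \<and> (b, a) \<notin> S)"

definition upair :: "nat \<times> nat \<Rightarrow> nat \<times> nat" where
  "upair e = (if fst e < snd e then e else (snd e, fst e))"

definition graph_of :: "(nat \<times> nat) set \<Rightarrow> graph" where
  "graph_of S = \<lparr>verts = {1..n},
     edges = {(a, b, Fwd) | a b. (a, b) \<in> S \<and> a < b} \<union> {(b, a, Bwd) | a b. (a, b) \<in> S \<and> b < a}\<rparr>"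

abbreviation "inflow x i \<equiv> Poly_Mapping.lookup x (0, i)"
abbreviation "outflow x j \<equiv> Poly_Mapping.lookup x (j, n + 1)"
abbreviation "src \<equiv> {0} \<times> I"
abbreviation "snk \<equiv> J \<times> {n + 1}"

definition dv :: "flow \<Rightarrow> nat \<Rightarrow> real" where
  "dv x u = of_bool (u \<in> I) * inflow x u - of_bool (u \<in> J) * outflow x u"

text \<open>Reads the coordinates in the direction of traversal, so that the sign conditions on
  forward and backward edges both become nonnegativity.\<close>

definition ch :: "(nat \<times> nat) set \<Rightarrow> flow \<Rightarrow> nat \<times> nat \<Rightarrow> real" where
  "ch S x e = (if e \<in> S then flow_along (fst e) (snd e) x else 0)"

text \<open>The homogeneous linear conditions, kept apart from signs and totals: they define the
  subspace on which \<open>lift\<close> is injective when \<open>S\<close> is a forest.\<close>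

definition lin :: "(nat \<times> nat) set \<Rightarrow> flow \<Rightarrow> bool" where
  "lin S x \<longleftrightarrow> Poly_Mapping.keys x \<subseteq> upair ` S \<union> src \<union> snk \<and> (\<forall>u\<in>{1..n}. bd (ch S x) u = dv x u)"

definition unit_flow :: "flow \<Rightarrow> bool" where
  "unit_flow x \<longleftrightarrow> (\<forall>i\<in>I. 0 \<le> inflow x i) \<and> (\<forall>j\<in>J. 0 \<le> outflow x j) \<and>
     (\<Sum>i\<in>I. inflow x i) = 1 \<and> (\<Sum>j\<in>J. outflow x j) = 1"

lemma zero_notin [simp]: "0 \<notin> I" "0 \<notin> J" "Suc n \<notin> I" "Suc n \<notin> J"
  using I_sub J_sub by auto

lemma edge_pairs_aug: "edge_pairs (partial_aug \<nu> H) = edge_pairs H \<union> src \<union> snk"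
  unfolding edge_pairs_def partial_aug_def by (auto simp: image_iff) force+

lemma netflow_aug:
  assumes H: "edge_pairs H \<subseteq> {1..n} \<times> {1..n}" and u: "u \<in> {1..n}"
  shows "netflow (partial_aug \<nu> H) x u =
    (\<Sum>e\<in>edge_pairs H. Poly_Mapping.lookup x e * (of_bool (fst e = u) - of_bool (snd e = u))) - dv x u"
proof -
  let ?l = "Poly_Mapping.lookup x"
  have fin: "finite (edge_pairs H)" using H by (rule finite_subset) simp
  have out: "{e \<in> edge_pairs (partial_aug \<nu> H). fst e = u} =
      {e \<in> edge_pairs H. fst e = u} \<union> (if u \<in> J then {(u, n + 1)} else {})"
    unfolding edge_pairs_aug using u H by auto
  have inn: "{e \<in> edge_pairs (partial_aug \<nu> H). snd e = u} =
      {e \<in> edge_pairs H. snd e = u} \<union> (if u \<in> I then {(0, u)} else {})"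
    unfolding edge_pairs_aug using u H by auto
  have "(\<Sum>e\<in>{e \<in> edge_pairs (partial_aug \<nu> H). fst e = u}. ?l e) =
      (\<Sum>e\<in>{e \<in> edge_pairs H. fst e = u}. ?l e) + of_bool (u \<in> J) * ?l (u, n + 1)"
    unfolding out using fin H by (subst sum.union_disjoint) auto
  moreover have "(\<Sum>e\<in>{e \<in> edge_pairs (partial_aug \<nu> H). snd e = u}. ?l e) =
      (\<Sum>e\<in>{e \<in> edge_pairs H. snd e = u}. ?l e) + of_bool (u \<in> I) * ?l (0, u)"
    unfolding inn using fin H by (subst sum.union_disjoint) auto
  moreover have "(\<Sum>e\<in>{e \<in> edge_pairs H. fst e = u}. ?l e) = (\<Sum>e\<in>edge_pairs H. ?l e * of_bool (fst e = u))"
    "(\<Sum>e\<in>{e \<in> edge_pairs H. snd e = u}. ?l e) = (\<Sum>e\<in>edge_pairs H. ?l e * of_bool (snd e = u))"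
    using fin by (simp_all add: sum.inter_filter of_bool_def if_distrib cong: if_cong)
  ultimately show ?thesis
    unfolding netflow_def dv_def by (simp add: algebra_simps sum_subtractf)
qed

lemma netflow_aug_ends:
  assumes H: "edge_pairs H \<subseteq> {1..n} \<times> {1..n}"
  shows "netflow (partial_aug \<nu> H) x 0 = (\<Sum>i\<in>I. inflow x i)"
    and "netflow (partial_aug \<nu> H) x (n + 1) = - (\<Sum>j\<in>J. outflow x j)"
proof -
  have "{e \<in> edge_pairs (partial_aug \<nu> H). fst e = 0} = Pair 0 ` I"
    "{e \<in> edge_pairs (partial_aug \<nu> H). snd e = 0} = {}"
    "{e \<in> edge_pairs (partial_aug \<nu> H). fst e = n + 1} = {}"
    "{e \<in> edge_pairs (partial_aug \<nu> H). snd e = n + 1} = (\<lambda>j. (j, n + 1)) ` J"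
    unfolding edge_pairs_aug by (auto dest!: subsetD[OF H])
  note eqs = this
  show "netflow (partial_aug \<nu> H) x 0 = (\<Sum>i\<in>I. inflow x i)"
    "netflow (partial_aug \<nu> H) x (n + 1) = - (\<Sum>j\<in>J. outflow x j)"
    unfolding netflow_def eqs by (simp_all add: sum.reindex inj_on_def)
qed

lemma flow_polytope_aug:
  assumes H: "edge_pairs H \<subseteq> {1..n} \<times> {1..n}"
  shows "x \<in> flow_polytope (partial_aug \<nu> H) \<longleftrightarrow>
    Poly_Mapping.keys x \<subseteq> edge_pairs H \<union> src \<union> snk \<and>
    (\<forall>i j. (i, j, Fwd) \<in> edges H \<longrightarrow> 0 \<le> Poly_Mapping.lookup x (i, j)) \<and>
    (\<forall>i j. (i, j, Bwd) \<in> edges H \<longrightarrow> Poly_Mapping.lookup x (i, j) \<le> 0) \<and> unit_flow x \<and>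
    (\<forall>u\<in>{1..n}. (\<Sum>e\<in>edge_pairs H. Poly_Mapping.lookup x e * (of_bool (fst e = u) - of_bool (snd e = u))) = dv x u)"
proof -
  have verts: "verts (partial_aug \<nu> H) = insert 0 (insert (n + 1) {1..n})"
    by (auto simp: partial_aug_def)
  have "Min (verts (partial_aug \<nu> H)) = 0" "Max (verts (partial_aug \<nu> H)) = n + 1"
    by (auto simp: partial_aug_def intro: Max_eqI Min_eqI)
  then have "(\<forall>v\<in>verts (partial_aug \<nu> H). netflow (partial_aug \<nu> H) x v =
        (if v = Min (verts (partial_aug \<nu> H)) then 1 else if v = Max (verts (partial_aug \<nu> H)) then - 1 else 0)) \<longleftrightarrow>
      (\<Sum>i\<in>I. inflow x i) = 1 \<and> (\<Sum>j\<in>J. outflow x j) = 1 \<and>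
      (\<forall>u\<in>{1..n}. (\<Sum>e\<in>edge_pairs H. Poly_Mapping.lookup x e * (of_bool (fst e = u) - of_bool (snd e = u))) = dv x u)"
    unfolding verts ball_simps using netflow_aug[OF H, of _ x] netflow_aug_ends[OF H, of x] by auto
  then show ?thesis
    unfolding flow_polytope_def unit_flow_def mem_Collect_eq edge_pairs_aug
    by (auto simp: partial_aug_def)
qed

lemma edges_graph_of:
  "(i, j, Fwd) \<in> edges (graph_of S) \<longleftrightarrow> (i, j) \<in> S \<and> i < j"
  "(i, j, Bwd) \<in> edges (graph_of S) \<longleftrightarrow> (j, i) \<in> S \<and> i < j"
  "(i, j, Bidir) \<notin> edges (graph_of S)"
  by (auto simp: graph_of_def)

lemma simpleD: "simple S \<Longrightarrow> (a, b) \<in> S \<Longrightarrow> a \<noteq> b" "simple S \<Longrightarrow> (a, b) \<in> S \<Longrightarrow> (b, a) \<notin> S"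
  "simple S \<Longrightarrow> S \<subseteq> {1..n} \<times> {1..n}"
  unfolding simple_def by simp_all

lemma simple_finite: "simple S \<Longrightarrow> finite S"
  by (rule finite_subset[OF simpleD(3)]) simp_all

lemma edge_pairs_graph_of: "simple S \<Longrightarrow> edge_pairs (graph_of S) = upair ` S"
proof -
  assume S: "simple S"
  show ?thesis
  proof (intro subset_antisym subsetI)
    fix e assume "e \<in> edge_pairs (graph_of S)"
    then obtain a b where "e = (a, b)" "(a, b) \<in> S \<and> a < b \<or> (b, a) \<in> S \<and> a < b"
      unfolding edge_pairs_def graph_of_def by auto
    then show "e \<in> upair ` S" unfolding upair_def by (auto simp: image_iff intro: bexI[of _ "(b, a)"] bexI[of _ "(a, b)"])
  next
    fix e assume "e \<in> upair ` S"
    then obtain a b where ab: "(a, b) \<in> S" "e = upair (a, b)" by auto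
    then consider "a < b" "e = (a, b)" | "b < a" "e = (b, a)"
      using simpleD(1)[OF S ab(1)] by (auto simp: upair_def split: if_splits)
    then show "e \<in> edge_pairs (graph_of S)"
    proof cases
      case 1
      then have "(a, b, Fwd) \<in> edges (graph_of S)" using ab by (simp add: edges_graph_of)
      then show ?thesis using 1 unfolding edge_pairs_def by force
    next
      case 2
      then have "(b, a, Bwd) \<in> edges (graph_of S)" using ab by (simp add: edges_graph_of)
      then show ?thesis using 2 unfolding edge_pairs_def by force
    qed
  qed
qed

lemma upair_inj: "simple S \<Longrightarrow> inj_on upair S"
  by (rule inj_onI) (auto simp: upair_def simple_def split: if_splits)

lemma upair_sub: "simple S \<Longrightarrow> upair ` S \<subseteq> {1..n} \<times> {1..n}"
proof (rule image_subsetI)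
  fix e assume "simple S" "e \<in> S"
  then have "e \<in> {1..n} \<times> {1..n}" using simpleD(3) by blast
  then show "upair e \<in> {1..n} \<times> {1..n}" by (auto simp: upair_def)
qed

lemma bd_ch:
  assumes S: "simple S"
  shows "bd (ch S x) u = (\<Sum>e\<in>upair ` S. Poly_Mapping.lookup x e * (of_bool (fst e = u) - of_bool (snd e = u)))"
proof -
  have "bd (ch S x) u = (\<Sum>e\<in>S. ch S x e * (of_bool (fst e = u) - of_bool (snd e = u)))"
    by (rule bd_on[OF simpleD(3)[OF S]]) (simp add: ch_def)
  also have "\<dots> = (\<Sum>e\<in>S. Poly_Mapping.lookup x (upair e) * (of_bool (fst (upair e) = u) - of_bool (snd (upair e) = u)))"
    by (rule sum.cong[OF refl]) (auto simp: ch_def flow_along_def upair_def algebra_simps)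
  also have "\<dots> = (\<Sum>e\<in>upair ` S. Poly_Mapping.lookup x e * (of_bool (fst e = u) - of_bool (snd e = u)))"
    by (simp add: sum.reindex[OF upair_inj[OF S]])
  finally show ?thesis .
qed

definition FP :: "(nat \<times> nat) set \<Rightarrow> flow set" where
  "FP S = flow_polytope (partial_aug \<nu> (graph_of S))"

lemma FP_iff:
  assumes S: "simple S"
  shows "x \<in> FP S \<longleftrightarrow> lin S x \<and> unit_flow x \<and> (\<forall>e\<in>S. 0 \<le> ch S x e)"
proof -
  have "(\<forall>e\<in>S. 0 \<le> ch S x e) \<longleftrightarrow>
     (\<forall>i j. (i, j, Fwd) \<in> edges (graph_of S) \<longrightarrow> 0 \<le> Poly_Mapping.lookup x (i, j)) \<and>
     (\<forall>i j. (i, j, Bwd) \<in> edges (graph_of S) \<longrightarrow> Poly_Mapping.lookup x (i, j) \<le> 0)" (is "?L \<longleftrightarrow> ?R")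
  proof
    assume ?L
    then show ?R by (fastforce simp: edges_graph_of ch_def flow_along_def)
  next
    assume ?R
    show ?L
    proof
      fix e assume "e \<in> S"
      obtain a b where "e = (a, b)" by fastforce
      with \<open>?R\<close> \<open>e \<in> S\<close> simpleD(1)[OF S, of a b] show "0 \<le> ch S x e"
        by (auto simp: edges_graph_of ch_def flow_along_def not_less order_le_less)
    qed
  qed
  then show ?thesis
    unfolding FP_def flow_polytope_aug[OF upair_sub[OF S, folded edge_pairs_graph_of[OF S]]]
    unfolding edge_pairs_graph_of[OF S] lin_def bd_ch[OF S] by (simp only: conj_ac)
qed

section \<open>The lift to the tree\<close>

lemma tree_sub: "tree \<subseteq> I \<times> J"
  unfolding tree_def using Leaves_sub cyc_in_V by (intro Un_least image_subsetI) (auto simp: mem_Times_iff)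

lemma simple_tree: "simple tree"
  unfolding simple_def using IJ_sub[OF tree_sub] tree_less by (meson less_asym less_irrefl)

lemma upair_tree: "upair ` tree = tree"
proof -
  have "upair e = e" if "e \<in> tree" for e using tree_less[of "fst e" "snd e"] that by (simp add: upair_def)
  then show ?thesis by simp
qed

lemma valley_pairs_cyc: "valley_pairs \<nu> = cyc ` {1..<w}"
  unfolding valley_pairs_def using cyc_less by (force simp: image_iff)

lemma edge_pairs_GB: "edge_pairs (GB_path \<nu>) = tree"
  and edges_GB_Fwd: "(i, j, Fwd) \<in> edges (GB_path \<nu>) \<longleftrightarrow> (i, j) \<in> Leaves"
  and edges_GB_Bidir: "(i, j, Bidir) \<in> edges (GB_path \<nu>) \<longleftrightarrow> (i, j) \<in> cyc ` {1..<w}"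
  and edges_GB_Bwd: "(i, j, Bwd) \<notin> edges (GB_path \<nu>)"
proof -
  have *: "(i, j, Fwd) \<in> edges (G_path \<nu>) \<longleftrightarrow> (i, j) \<in> tree" for i j
    unfolding edges_G_path_tree by auto
  have disj: "Leaves \<inter> cyc ` {1..<w} = {}" using Leaves_cyc_disj by fastforce
  show F: "(i, j, Fwd) \<in> edges (GB_path \<nu>) \<longleftrightarrow> (i, j) \<in> Leaves" for i j
    using disj unfolding GB_path_def by (auto simp: * valley_pairs_cyc tree_def)
  show B: "(i, j, Bidir) \<in> edges (GB_path \<nu>) \<longleftrightarrow> (i, j) \<in> cyc ` {1..<w}" for i j
    unfolding GB_path_def by (auto simp: valley_pairs_cyc)
  show W: "(i, j, Bwd) \<notin> edges (GB_path \<nu>)" for i j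
    unfolding GB_path_def by auto
  show "edge_pairs (GB_path \<nu>) = tree"
  proof (intro subset_antisym subsetI)
    fix e assume "e \<in> edge_pairs (GB_path \<nu>)"
    then obtain s where s: "(fst e, snd e, s) \<in> edges (GB_path \<nu>)" unfolding edge_pairs_def by force
    then show "e \<in> tree" using F B W by (cases s) (auto simp: tree_def)
  next
    fix e assume "e \<in> tree"
    then have "(fst e, snd e) \<in> Leaves \<or> (fst e, snd e) \<in> cyc ` {1..<w}" by (simp add: tree_def)
    then have "\<exists>s. (fst e, snd e, s) \<in> edges (GB_path \<nu>)" using F B by blast
    then show "e \<in> edge_pairs (GB_path \<nu>)" unfolding edge_pairs_def by force
  qed
qed

lemma ch_tree: "e \<in> tree \<Longrightarrow> ch tree x e = Poly_Mapping.lookup x e"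
  using tree_less[of "fst e" "snd e"] by (simp add: ch_def flow_along_def)

lemma ch_tree_supp: "e \<notin> Leaves \<union> cyc ` {1..w} \<Longrightarrow> ch tree x e = 0"
  unfolding ch_def tree_def by auto

lemma ch_tree_cyc_w: "ch tree x (cyc w) = 0"
proof -
  have "cyc w \<notin> tree"
  proof
    assume "cyc w \<in> tree"
    then obtain k where "k \<in> {1..<w}" "cyc w = cyc k"
      unfolding tree_def using Leaves_cyc_disj[of w] w_ge_1 by auto
    then show False using inj_onD[OF inj_cyc, of w k] by auto
  qed
  then show ?thesis by (simp add: ch_def)
qed

text \<open>The bidirectional edges carry no sign condition, and a leaf edge carries just the source
  or sink flow of its leaf. So the inequalities of \<open>unit_flow\<close> are the only ones
  left.\<close>

lemma P_iff: "x \<in> cyclic_flow_polytope \<nu> \<longleftrightarrow> lin tree x \<and> unit_flow x"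
proof -
  have "0 \<le> Poly_Mapping.lookup x e" if x: "lin tree x" "unit_flow x" and e: "e \<in> Leaves" for e
  proof -
    have t: "e \<in> tree" using e by (simp add: tree_def)
    from e show ?thesis
    proof (cases rule: Leaves_cases)
      case (1 b)
      then have "bd (ch tree x) b = Poly_Mapping.lookup x e"
        using bd_leaf_out[of "ch tree x" b] ch_tree_supp ch_tree[OF t] by simp
      moreover have "bd (ch tree x) b = dv x b" using x(1) 1 I_sub unfolding lin_def by blast
      moreover have "0 \<le> inflow x b" using x(2) 1 unfolding unit_flow_def by blast
      ultimately show ?thesis using 1 by (simp add: dv_def)
    next
      case (2 b)
      then have "bd (ch tree x) b = - Poly_Mapping.lookup x e"
        using bd_leaf_in[of "ch tree x" b] ch_tree_supp ch_tree[OF t] by simp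
      moreover have "bd (ch tree x) b = dv x b" using x(1) 2 J_sub unfolding lin_def by blast
      moreover have "0 \<le> outflow x b" using x(2) 2 unfolding unit_flow_def by blast
      ultimately show ?thesis using 2 by (simp add: dv_def)
    qed
  qed
  moreover have "edge_pairs (GB_path \<nu>) \<subseteq> {1..n} \<times> {1..n}"
    unfolding edge_pairs_GB using IJ_sub[OF tree_sub] .
  ultimately show ?thesis
    unfolding cyclic_flow_polytope_def
    by (subst flow_polytope_aug)
      (auto simp: edges_GB_Fwd edges_GB_Bwd edge_pairs_GB lin_def bd_ch[OF simple_tree] upair_tree)
qed

definition mk :: "(nat \<times> nat) set \<Rightarrow> (nat \<Rightarrow> real) \<Rightarrow> (nat \<Rightarrow> real) \<Rightarrow> (nat \<times> nat \<Rightarrow> real) \<Rightarrow> flow" where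
  "mk S p q c = (\<Sum>i\<in>I. Poly_Mapping.single (0, i) (p i)) + (\<Sum>j\<in>J. Poly_Mapping.single (j, n + 1) (q j)) +
     (\<Sum>e\<in>S. Poly_Mapping.single (upair e) (if fst e < snd e then c e else - c e))"

lemma lookup_mk:
  assumes S: "simple S"
  shows "Poly_Mapping.lookup (mk S p q c) (a, b) =
    of_bool (a = 0 \<and> b \<in> I) * p b + of_bool (a \<in> J \<and> b = n + 1) * q a +
    of_bool (a < b \<and> (a, b) \<in> S) * c (a, b) - of_bool (a < b \<and> (b, a) \<in> S) * c (b, a)"
proof -
  have 1: "Poly_Mapping.lookup (\<Sum>i\<in>I. Poly_Mapping.single (0, i) (p i)) (a, b) = of_bool (a = 0 \<and> b \<in> I) * p b"
    unfolding lookup_sum lookup_single when_def by (cases "a = 0") auto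
  have 2: "Poly_Mapping.lookup (\<Sum>j\<in>J. Poly_Mapping.single (j, n + 1) (q j)) (a, b) = of_bool (a \<in> J \<and> b = n + 1) * q a"
    unfolding lookup_sum lookup_single when_def by (cases "b = n + 1") auto
  have "Poly_Mapping.lookup (\<Sum>e\<in>S. Poly_Mapping.single (upair e) (if fst e < snd e then c e else - c e)) (a, b) =
     (\<Sum>e\<in>S. (if e = (a, b) then of_bool (a < b) * c e else 0) - (if e = (b, a) then of_bool (a < b) * c e else 0))"
    unfolding lookup_sum
  proof (rule sum.cong[OF refl])
    fix e assume "e \<in> S"
    obtain x y where e: "e = (x, y)" by fastforce
    have "x \<noteq> y" using simpleD(1)[OF S] \<open>e \<in> S\<close> e by blast
    then show "Poly_Mapping.lookup (Poly_Mapping.single (upair e) (if fst e < snd e then c e else - c e)) (a, b) =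
        (if e = (a, b) then of_bool (a < b) * c e else 0) - (if e = (b, a) then of_bool (a < b) * c e else 0)"
      by (auto simp: e lookup_single when_def upair_def)
  qed
  also have "\<dots> = of_bool (a < b \<and> (a, b) \<in> S) * c (a, b) - of_bool (a < b \<and> (b, a) \<in> S) * c (b, a)"
    using simple_finite[OF S] by (auto simp: sum_subtractf)
  finally show ?thesis unfolding mk_def lookup_add 1 2 by simp
qed

lemma lookup_mk_src: "simple S \<Longrightarrow> i \<in> I \<Longrightarrow> inflow (mk S p q c) i = p i"
  using simpleD(3)[of S] by (auto simp: lookup_mk of_bool_def)

lemma lookup_mk_snk: "simple S \<Longrightarrow> j \<in> J \<Longrightarrow> outflow (mk S p q c) j = q j"
  using simpleD(3)[of S] J_sub by (auto simp: lookup_mk of_bool_def)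

lemma ch_mk:
  assumes S: "simple S" and c: "\<And>e. e \<notin> S \<Longrightarrow> c e = 0"
  shows "ch S (mk S p q c) = c"
proof
  fix e show "ch S (mk S p q c) e = c e"
  proof (cases "e \<in> S")
    case True
    obtain a b where e: "e = (a, b)" by fastforce
    have "a \<in> {1..n}" "b \<in> {1..n}" "a \<noteq> b" "(b, a) \<notin> S"
      using simpleD[OF S] True e by auto
    then show ?thesis using True unfolding e
      by (auto simp: ch_def flow_along_def lookup_mk[OF S] of_bool_def)
  qed (simp add: ch_def c)
qed

lemma dv_mk: "simple S \<Longrightarrow> dv (mk S p q c) u = of_bool (u \<in> I) * p u - of_bool (u \<in> J) * q u"
  unfolding dv_def using lookup_mk_src lookup_mk_snk by (simp add: of_bool_def)

lemma keys_mk: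
  assumes S: "simple S"
  shows "Poly_Mapping.keys (mk S p q c) \<subseteq> upair ` S \<union> src \<union> snk"
proof
  fix e assume "e \<in> Poly_Mapping.keys (mk S p q c)"
  then obtain a b where e: "e = (a, b)" "Poly_Mapping.lookup (mk S p q c) (a, b) \<noteq> 0"
    by (metis in_keys_iff surj_pair)
  then consider "a = 0 \<and> b \<in> I" | "a \<in> J \<and> b = n + 1" | "a < b \<and> (a, b) \<in> S" | "a < b \<and> (b, a) \<in> S"
    unfolding lookup_mk[OF S] by (auto simp: of_bool_def split: if_splits)
  then show "e \<in> upair ` S \<union> src \<union> snk"
  proof cases
    case 3
    then have "e = upair (a, b)" using e by (simp add: upair_def)
    with 3 show ?thesis by blast
  next
    case 4
    then have "e = upair (b, a)" using e by (simp add: upair_def)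
    with 4 show ?thesis by blast
  qed (use e in auto)
qed

lemma lin_mk:
  assumes "simple S" "\<And>e. e \<notin> S \<Longrightarrow> c e = 0"
    "\<And>u. u \<in> {1..n} \<Longrightarrow> bd c u = of_bool (u \<in> I) * p u - of_bool (u \<in> J) * q u"
  shows "lin S (mk S p q c)"
  unfolding lin_def using keys_mk[OF assms(1)] assms(3) by (simp add: ch_mk[OF assms(1,2)] dv_mk[OF assms(1)])

lemma flow_eqI:
  assumes S: "simple S" and keys: "Poly_Mapping.keys x \<subseteq> upair ` S \<union> src \<union> snk" "Poly_Mapping.keys y \<subseteq> upair ` S \<union> src \<union> snk"
    and "\<And>i. i \<in> I \<Longrightarrow> inflow x i = inflow y i"
    and "\<And>j. j \<in> J \<Longrightarrow> outflow x j = outflow y j"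
    and ch: "\<And>e. e \<in> S \<Longrightarrow> ch S x e = ch S y e"
  shows "x = y"
proof (rule poly_mapping_eqI)
  fix e
  consider "e \<in> upair ` S" | "e \<in> src" | "e \<in> snk" | "e \<notin> upair ` S \<union> src \<union> snk" by blast
  then show "Poly_Mapping.lookup x e = Poly_Mapping.lookup y e"
  proof cases
    case 1
    then obtain e' where "e' \<in> S" "e = upair e'" by blast
    then show ?thesis using ch[of e'] by (auto simp: ch_def flow_along_def upair_def split: if_splits)
  next
    case 4
    then have "e \<notin> Poly_Mapping.keys x" "e \<notin> Poly_Mapping.keys y" using keys by blast+
    then show ?thesis by (simp add: in_keys_iff)
  qed (use assms(4,5) in auto)
qed

text \<open>The guard matters where the supplies do not sum to zero: there \<open>chain_of\<close>
  gives the closing arc a value other than 0, although the tree has no such arc.\<close>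

definition tflow :: "flow \<Rightarrow> nat \<times> nat \<Rightarrow> real" where
  "tflow x e = (if e \<in> tree then chain_of (dv x) (cutf (dv x)) e else 0)"

definition lift :: "flow \<Rightarrow> flow" where
  "lift x = mk tree (\<lambda>i. inflow x i) (\<lambda>j. outflow x j) (tflow x)"

lemma lookup_lift_src: "i \<in> I \<Longrightarrow> inflow (lift x) i = inflow x i"
  unfolding lift_def by (rule lookup_mk_src[OF simple_tree])

lemma lookup_lift_snk: "j \<in> J \<Longrightarrow> outflow (lift x) j = outflow x j"
  unfolding lift_def by (rule lookup_mk_snk[OF simple_tree])

lemma dv_lift: "dv (lift x) = dv x"
  unfolding dv_def using lookup_lift_src lookup_lift_snk by (auto simp: of_bool_def)

lemma ch_lift: "ch tree (lift x) = tflow x"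
  unfolding lift_def by (rule ch_mk[OF simple_tree]) (simp add: tflow_def)

lemma keys_lift: "Poly_Mapping.keys (lift x) \<subseteq> upair ` tree \<union> src \<union> snk"
  unfolding lift_def by (rule keys_mk[OF simple_tree])

lemma dv_lincomb: "dv (s *\<^sub>R x + t *\<^sub>R y) u = s * dv x u + t * dv y u"
  unfolding dv_def by (simp add: lookup_add algebra_simps)

lemma cutf_lincomb: "cutf (\<lambda>u. s * d u + t * d' u) k = s * cutf d k + t * cutf d' k"
  unfolding cutf_def sum_distrib_left sum.distrib[symmetric]
  by (rule sum.cong[OF refl]) (simp only: algebra_simps)

lemma ch_lincomb: "ch S (s *\<^sub>R x + t *\<^sub>R y) e = s * ch S x e + t * ch S y e"
  unfolding ch_def flow_along_def by (simp add: lookup_add algebra_simps)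

lemma tflow_lincomb: "tflow (s *\<^sub>R x + t *\<^sub>R y) e = s * tflow x e + t * tflow y e"
proof -
  have dv: "dv (s *\<^sub>R x + t *\<^sub>R y) = (\<lambda>u. s * dv x u + t * dv y u)" using dv_lincomb by blast
  show ?thesis unfolding tflow_def chain_of_def dv by (simp add: cutf_lincomb algebra_simps)
qed

lemma lift_lincomb: "lift (s *\<^sub>R x + t *\<^sub>R y) = s *\<^sub>R lift x + t *\<^sub>R lift y"
proof (rule flow_eqI[OF simple_tree keys_lift])
  show "Poly_Mapping.keys (s *\<^sub>R lift x + t *\<^sub>R lift y) \<subseteq> upair ` tree \<union> src \<union> snk"
    (is "_ \<subseteq> ?A")
  proof
    fix e assume e: "e \<in> Poly_Mapping.keys (s *\<^sub>R lift x + t *\<^sub>R lift y)"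
    have "e \<in> Poly_Mapping.keys (lift x) \<or> e \<in> Poly_Mapping.keys (lift y)"
    proof (rule ccontr)
      assume "\<not> ?thesis"
      then have "Poly_Mapping.lookup (lift x) e = 0" "Poly_Mapping.lookup (lift y) e = 0"
        by (simp_all add: in_keys_iff)
      then show False using e by (simp add: in_keys_iff lookup_add)
    qed
    then show "e \<in> ?A" using keys_lift by blast
  qed
qed (simp_all add: lookup_lift_src lookup_lift_snk[simplified] lookup_add ch_lift ch_lincomb tflow_lincomb)

lemma linear_lift: "linear lift"
proof (rule linearI)
  show "lift (x + y) = lift x + lift y" for x y
    using lift_lincomb[of 1 x 1 y] by (simp only: scaleR_one)
  show "lift (r *\<^sub>R x) = r *\<^sub>R lift x" for r x
    using lift_lincomb[of r x 0 x] by (simp only: scaleR_zero_left add_0_right)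
qed

lemma lin_sum_dv: "lin S x \<Longrightarrow> (\<Sum>u\<in>{1..n}. dv x u) = 0"
  using sum_bd[of "ch S x"] unfolding lin_def by simp

lemma sum_dv: "(\<Sum>u\<in>{1..n}. dv x u) = (\<Sum>i\<in>I. inflow x i) - (\<Sum>j\<in>J. outflow x j)"
proof -
  have "(\<Sum>u\<in>{1..n}. of_bool (u \<in> A) * f u) = (\<Sum>u\<in>A. f u)" if "A \<subseteq> {1..n}" for A and f :: "nat \<Rightarrow> real"
    using that by (intro sum.mono_neutral_cong_right) auto
  then show ?thesis unfolding dv_def using I_sub J_sub by (simp add: sum_subtractf)
qed

lemma lin_lift:
  assumes "(\<Sum>u\<in>{1..n}. dv x u) = 0"
  shows "lin tree (lift x)"
proof -
  have w0: "cutf (dv x) w = 0" using assms by (simp add: cutf_w)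
  have "tflow x = chain_of (dv x) (cutf (dv x))"
  proof
    fix e
    show "tflow x e = chain_of (dv x) (cutf (dv x)) e"
    proof (cases "e \<in> tree \<or> e \<notin> cyc ` {1..w}")
      case True
      then show ?thesis by (auto simp: tflow_def tree_def chain_of_def)
    next
      case False
      then obtain k where "k \<in> {1..w}" "e = cyc k" "e \<notin> tree" by blast
      \<comment> \<open>Only the closing arc lies on the cycle but not in the tree; it carries
        nothing because the supplies sum to zero.\<close>
      then have "e = cyc w" by (cases "k = w") (auto simp: tree_def)
      then show ?thesis using chain_of_cyc[of w] w0 w_ge_1 \<open>e \<notin> tree\<close> by (simp add: tflow_def)
    qed
  qed
  then show ?thesis
    unfolding lin_def using keys_lift[of x] bd_chain_of[of "cutf (dv x)" "dv x"] w0 by (simp add: ch_lift dv_lift)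
qed

text \<open>A tree flow is determined by its supplies: leaf edges by the supply of their leaf, spine
  edges by the cuts.\<close>

lemma lift_id:
  assumes x: "lin tree x"
  shows "lift x = x"
proof (rule flow_eqI[OF simple_tree keys_lift])
  show "Poly_Mapping.keys x \<subseteq> upair ` tree \<union> src \<union> snk" using x unfolding lin_def by blast
  have lin': "lin tree (lift x)" by (rule lin_lift[OF lin_sum_dv[OF x]])
  have bd_eq: "bd (ch tree (lift x)) u = bd (ch tree x) u" if "u \<in> {1..n}" for u
    using x lin' that unfolding lin_def dv_lift by simp
  then have cut: "cutf (bd (ch tree (lift x))) k = cutf (bd (ch tree x)) k" for k
    unfolding cutf_def by simp
  fix e assume e: "e \<in> tree"
  show "ch tree (lift x) e = ch tree x e"
  proof (cases "e \<in> Leaves")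
    case True
    then show ?thesis
    proof (cases rule: Leaves_cases)
      case (1 b)
      then show ?thesis
        using bd_leaf_out[of "ch tree x" b] bd_leaf_out[of "ch tree (lift x)" b] ch_tree_supp bd_eq[of b] I_sub by auto
    next
      case (2 b)
      then show ?thesis
        using bd_leaf_in[of "ch tree x" b] bd_leaf_in[of "ch tree (lift x)" b] ch_tree_supp bd_eq[of b] J_sub by auto
    qed
  next
    case False
    then obtain k where k: "k \<in> {1..w}" "e = cyc k" using e unfolding tree_def by fastforce
    then show ?thesis
      using cutf_bd[of "ch tree x" k] cutf_bd[of "ch tree (lift x)" k] ch_tree_supp ch_tree_cyc_w cut[of k] by simp
  qed
qed (simp_all add: lookup_lift_src lookup_lift_snk[simplified])

lemma unit_flow_lift: "unit_flow (lift x) \<longleftrightarrow> unit_flow x"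
  unfolding unit_flow_def using lookup_lift_src[of _ x] lookup_lift_snk[of _ x] by simp

lemma unit_flow_sum_dv: "unit_flow x \<Longrightarrow> (\<Sum>u\<in>{1..n}. dv x u) = 0"
  unfolding sum_dv unit_flow_def by simp

lemma lift_in_P: "unit_flow x \<Longrightarrow> lift x \<in> cyclic_flow_polytope \<nu>"
  unfolding P_iff unit_flow_lift using lin_lift unit_flow_sum_dv by blast

lemma lift_integral:
  assumes "x \<in> lattice_points"
  shows "lift x \<in> lattice_points"
proof -
  have x: "Poly_Mapping.lookup x e \<in> \<int>" for e using assms unfolding lattice_points_def by blast
  then have dv: "dv x u \<in> \<int>" for u by (simp add: dv_def of_bool_def)
  then have "cutf (dv x) k \<in> \<int>" for k unfolding cutf_def by (auto intro!: Ints_sum)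
  with dv have t: "tflow x e \<in> \<int>" for e unfolding tflow_def chain_of_def by auto
  have "Poly_Mapping.lookup (lift x) (a, b) \<in> \<int>" for a b
    unfolding lift_def lookup_mk[OF simple_tree] using x t by (simp add: of_bool_def)
  then show ?thesis unfolding lattice_points_def by auto
qed

end

section \<open>Integrality\<close>

lemma affineD: "affine A \<Longrightarrow> a \<in> A \<Longrightarrow> b \<in> A \<Longrightarrow> s + t = 1 \<Longrightarrow> s *\<^sub>R a + t *\<^sub>R b \<in> A"
  unfolding affine_def by blast

lemma affineI: "(\<And>a b s t. a \<in> A \<Longrightarrow> b \<in> A \<Longrightarrow> s + t = 1 \<Longrightarrow> s *\<^sub>R a + t *\<^sub>R b \<in> A) \<Longrightarrow> affine A"
  unfolding affine_def by blast

lemma affine_hull_linear: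
  fixes f :: "'a::real_vector \<Rightarrow> 'b::real_vector"
  assumes f: "linear f"
  shows "f ` (affine hull X) = affine hull (f ` X)"
proof
  have "affine {x. f x \<in> affine hull (f ` X)}"
    by (rule affineI) (simp add: linear_add[OF f] linear_scale[OF f] affineD[OF affine_affine_hull])
  moreover have "X \<subseteq> {x. f x \<in> affine hull (f ` X)}"
    by (auto intro: hull_inc)
  ultimately have "affine hull X \<subseteq> {x. f x \<in> affine hull (f ` X)}"
    by (simp only: hull_minimal)
  then show "f ` (affine hull X) \<subseteq> affine hull (f ` X)" by blast
  have "affine (f ` (affine hull X))"
  proof (rule affineI)
    fix x y and s t :: real
    assume "x \<in> f ` (affine hull X)" "y \<in> f ` (affine hull X)" and st: "s + t = 1"
    then obtain a b where ab: "a \<in> affine hull X" "x = f a" "b \<in> affine hull X" "y = f b" by blast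
    have "s *\<^sub>R x + t *\<^sub>R y = f (s *\<^sub>R a + t *\<^sub>R b)"
      using ab by (simp add: linear_add[OF f] linear_scale[OF f])
    then show "s *\<^sub>R x + t *\<^sub>R y \<in> f ` (affine hull X)"
      using affineD[OF affine_affine_hull ab(1,3) st] by blast
  qed
  moreover have "f ` X \<subseteq> f ` (affine hull X)"
    by (intro image_mono hull_subset)
  ultimately show "affine hull (f ` X) \<subseteq> f ` (affine hull X)"
    by (simp only: hull_minimal)
qed

text \<open>A strictly positive vector can be moved a little in any direction. This serves for
  source and sink flows as well as for arc coefficients.\<close>

lemma small_step:
  fixes f k :: "'a \<Rightarrow> real"
  assumes "finite A" "\<And>a. a \<in> A \<Longrightarrow> 0 < f a"
  shows "\<exists>\<delta>>0. \<forall>\<epsilon>. 0 \<le> \<epsilon> \<and> \<epsilon> \<le> \<delta> \<longrightarrow> (\<forall>a\<in>A. 0 \<le> f a + \<epsilon> * k a)"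
  using assms
proof (induction A rule: finite_induct)
  case empty
  show ?case by (intro exI[of _ 1]) simp
next
  case (insert b A)
  then obtain \<delta> where d: "\<delta> > 0" "\<And>\<epsilon> a. 0 \<le> \<epsilon> \<Longrightarrow> \<epsilon> \<le> \<delta> \<Longrightarrow> a \<in> A \<Longrightarrow> 0 \<le> f a + \<epsilon> * k a" by auto
  \<comment> \<open>The summand 1 avoids a division by zero when \<open>k b\<close>
    vanishes.\<close>
  define \<delta>' where "\<delta>' = min \<delta> (f b / (\<bar>k b\<bar> + 1))"
  have fb: "0 < f b" using insert.prems by simp
  have "0 < \<delta>'" using d(1) fb by (simp add: \<delta>'_def)
  moreover have "0 \<le> f b + \<epsilon> * k b" if e: "0 \<le> \<epsilon>" "\<epsilon> \<le> \<delta>'" for \<epsilon>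
  proof -
    have "\<epsilon> * \<bar>k b\<bar> \<le> f b / (\<bar>k b\<bar> + 1) * \<bar>k b\<bar>"
      using e by (intro mult_right_mono) (auto simp: \<delta>'_def)
    also have "\<dots> \<le> f b" using fb by (simp add: field_simps)
    finally have "\<bar>\<epsilon> * k b\<bar> \<le> f b" using e by (simp add: abs_mult)
    then show ?thesis by linarith
  qed
  ultimately show ?case using d(2) by (intro exI[of _ \<delta>']) (auto simp: \<delta>'_def)
qed

context valley_path begin

text \<open>The last condition says that the incidence matrix of \<open>S\<close> is unimodular.\<close>

definition forest :: "(nat \<times> nat) set \<Rightarrow> bool" where
  "forest S \<longleftrightarrow> S \<subseteq> I \<times> J \<and> simple S \<and>
     (\<forall>c. (\<forall>e. e \<notin> S \<longrightarrow> c e = 0) \<longrightarrow> (\<forall>u\<in>{1..n}. bd c u = 0) \<longrightarrow> (\<forall>e. c e = 0)) \<and>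
     (\<forall>c. (\<forall>e. e \<notin> S \<longrightarrow> c e = 0) \<longrightarrow> (\<forall>u\<in>{1..n}. bd c u \<in> \<int>) \<longrightarrow> (\<forall>e. c e \<in> \<int>))"

lemma forestD:
  assumes "forest S"
  shows "S \<subseteq> I \<times> J" "simple S" "finite S"
  using assms simple_finite unfolding forest_def by auto

lemma forest_unique:
  assumes S: "forest S" and c: "\<And>e. e \<notin> S \<Longrightarrow> c e = 0" "\<And>e. e \<notin> S \<Longrightarrow> c' e = 0"
    and eq: "\<And>u. u \<in> {1..n} \<Longrightarrow> bd c u = bd c' u"
  shows "c = c'"
proof -
  have "\<forall>e. c e - c' e = 0"
  proof -
    have "(\<forall>e. e \<notin> S \<longrightarrow> c e - c' e = 0)" using c by simp
    moreover have "\<forall>u\<in>{1..n}. bd (\<lambda>e. c e - c' e) u = 0" using eq by (simp add: bd_diff)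
    moreover have "\<forall>c. (\<forall>e. e \<notin> S \<longrightarrow> c e = 0) \<longrightarrow> (\<forall>u\<in>{1..n}. bd c u = 0) \<longrightarrow> (\<forall>e. c e = 0)"
      using S unfolding forest_def by (elim conjE)
    ultimately show ?thesis by (elim allE[of _ "\<lambda>e. c e - c' e"] impE)
  qed
  then show ?thesis by (intro ext) (metis eq_iff_diff_eq_0)
qed

lemma forest_integral:
  assumes "forest S" "\<And>e. e \<notin> S \<Longrightarrow> c e = 0" "\<And>u. u \<in> {1..n} \<Longrightarrow> bd c u \<in> \<int>"
  shows "c e \<in> \<int>"
proof -
  have "\<forall>c. (\<forall>e. e \<notin> S \<longrightarrow> c e = 0) \<longrightarrow> (\<forall>u\<in>{1..n}. bd c u \<in> \<int>) \<longrightarrow> (\<forall>e. c e \<in> \<int>)"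
    using assms(1) unfolding forest_def by (elim conjE)
  then show ?thesis using assms(2,3) by blast
qed

lemma bd_sum: "bd (\<lambda>e. \<Sum>a\<in>A. f a e) u = (\<Sum>a\<in>A. bd (f a) u)"
  unfolding bd_def by (simp add: sum_distrib_right) (rule sum.swap)

lemma forest_mono: "forest S \<Longrightarrow> S' \<subseteq> S \<Longrightarrow> forest S'"
proof -
  assume S: "forest S" and sub: "S' \<subseteq> S"
  have "simple S'" using forestD(2)[OF S] sub unfolding simple_def by blast
  moreover have "S' \<subseteq> I \<times> J" using forestD(1)[OF S] sub by blast
  moreover have "\<forall>e. c e = 0" if "\<forall>e. e \<notin> S' \<longrightarrow> c e = 0" "\<forall>u\<in>{1..n}. bd c u = 0" for c
    using that sub forest_unique[OF S, of c "\<lambda>_. 0"] by (auto simp: bd_zero dest: fun_cong)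
  moreover have "\<forall>e. c e \<in> \<int>" if "\<forall>e. e \<notin> S' \<longrightarrow> c e = 0" "\<forall>u\<in>{1..n}. bd c u \<in> \<int>" for c
    using that sub forest_integral[OF S, of c] by blast
  ultimately show ?thesis unfolding forest_def by simp
qed

text \<open>The positive and negative parts of \<open>c\<close> are two nonnegative functions with
  the same boundary, so they coincide.\<close>

lemma tree_fan_signed_unique:
  assumes fan: "tree_fan \<T>" and H: "H \<in> \<T>" and c: "\<And>e. e \<notin> H \<Longrightarrow> c e = 0"
    and bd: "\<And>u. u \<in> {1..n} \<Longrightarrow> bd c u = 0"
  shows "c e = 0"
proof -
  let ?p = "\<lambda>e. max (c e) 0" and ?q = "\<lambda>e. max (- c e) 0"
  have "?p = ?q"
  proof (rule tree_fan_unique[OF fan H H])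
    show "nonneg_on H ?p" "nonneg_on H ?q" using c by (auto intro!: nonneg_onI)
    fix u assume "u \<in> {1..n}"
    have "(\<lambda>e. ?p e - ?q e) = c" by (auto simp: max_def)
    then have "bd ?p u - bd ?q u = bd c u" using bd_diff[of ?p ?q u] by simp
    then show "bd ?p u = bd ?q u" using bd[OF \<open>u \<in> {1..n}\<close>] by simp
  qed
  then have "?p e = ?q e" by (rule fun_cong)
  then show ?thesis by (auto simp: max_def split: if_splits)
qed

text \<open>Combines representations of e_a - e_1 with weights \<open>d a\<close>. The multiples of
  e_1 cancel since \<open>d\<close> has sum zero, and integral weights give an integral
  result.\<close>

lemma tree_fan_span:
  assumes fan: "tree_fan \<T>" and H: "H \<in> \<T>" and d: "(\<Sum>u\<in>{1..n}. d u) = 0"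
  shows "\<exists>c. (\<forall>e. e \<notin> H \<longrightarrow> c e = 0) \<and> (\<forall>u\<in>{1..n}. bd c u = d u) \<and>
    ((\<forall>u\<in>{1..n}. d u \<in> \<int>) \<longrightarrow> (\<forall>e. c e \<in> \<int>))"
proof -
  have one: "1 \<in> {1..n}" using n_ge_1 by simp
  have "\<forall>a\<in>{1..n}. \<exists>z. (\<forall>e. z e \<in> \<int>) \<and> (\<forall>e. e \<notin> H \<longrightarrow> z e = 0) \<and>
     (\<forall>u\<in>{1..n}. bd z u = of_bool (a = u) - of_bool (1 = u))"
    using tree_fanD(5)[OF fan H] one unfolding int_spanning_def by blast
  then obtain z where z: "\<And>a e. a \<in> {1..n} \<Longrightarrow> z a e \<in> \<int>" "\<And>a e. a \<in> {1..n} \<Longrightarrow> e \<notin> H \<Longrightarrow> z a e = 0"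
    "\<And>a u. a \<in> {1..n} \<Longrightarrow> u \<in> {1..n} \<Longrightarrow> bd (z a) u = of_bool (a = u) - of_bool (1 = u)"
    by metis
  define c where "c e = (\<Sum>a\<in>{1..n}. d a * z a e)" for e
  have "bd c u = d u" if u: "u \<in> {1..n}" for u
  proof -
    have "bd c u = (\<Sum>a\<in>{1..n}. d a * bd (z a) u)"
      unfolding c_def bd_sum bd_scale ..
    also have "\<dots> = (\<Sum>a\<in>{1..n}. (if a = u then d a else 0) - d a * of_bool (1 = u))"
      by (rule sum.cong[OF refl]) (simp only: z(3)[OF _ u], simp add: algebra_simps)
    also have "\<dots> = d u - (\<Sum>a\<in>{1..n}. d a) * of_bool (1 = u)"
      using u by (simp add: sum_subtractf sum_distrib_right)
    finally show ?thesis using d by simp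
  qed
  moreover have "c e = 0" if "e \<notin> H" for e unfolding c_def using z(2) that by simp
  moreover have "c e \<in> \<int>" if "\<forall>u\<in>{1..n}. d u \<in> \<int>" for e
    unfolding c_def using z(1) that by (intro Ints_sum Ints_mult) auto
  ultimately show ?thesis by blast
qed

text \<open>An integral boundary has an integral preimage by \<open>tree_fan_span\<close>, and
  independence makes it the only one.\<close>

lemma tree_fan_forest:
  assumes fan: "tree_fan \<T>" and H: "H \<in> \<T>"
  shows "forest H"
proof -
  have "\<not> ((a, b) \<in> H \<and> (b, a) \<in> H)" for a b
  proof
    assume ab: "(a, b) \<in> H \<and> (b, a) \<in> H"
    then have in_n: "a \<in> {1..n}" "b \<in> {1..n}" using IJ_sub[OF tree_fanD(2)[OF fan H]] by auto
    \<comment> \<open>Two opposite arcs would carry a nonzero circulation.\<close>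
    let ?c = "\<lambda>e. of_bool (e = (a, b)) + of_bool (e = (b, a)) :: real"
    have "?c (a, b) = 0"
    proof (rule tree_fan_signed_unique[OF fan H, of ?c])
      show "?c e = 0" if "e \<notin> H" for e
      proof -
        have "e \<noteq> (a, b)" "e \<noteq> (b, a)" using ab that by blast+
        then show ?thesis by simp
      qed
      show "bd ?c u = 0" for u unfolding bd_add bd_single[OF in_n] bd_single[OF in_n(2,1)] by simp
    qed
    then show False by (auto simp: of_bool_def split: if_splits)
  qed
  moreover have "a \<noteq> b" if "(a, b) \<in> H" for a b
    using tree_fanD(3)[OF fan H, of a] that by auto
  ultimately have "simple H"
    unfolding simple_def using IJ_sub[OF tree_fanD(2)[OF fan H]] by simp
  moreover have "c e \<in> \<int>" if c: "\<forall>e. e \<notin> H \<longrightarrow> c e = 0" "\<forall>u\<in>{1..n}. bd c u \<in> \<int>" for c e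
  proof -
    obtain c' where c': "\<forall>e. e \<notin> H \<longrightarrow> c' e = 0" "\<forall>u\<in>{1..n}. bd c' u = bd c u" "\<forall>e. c' e \<in> \<int>"
      using tree_fan_span[OF fan H, of "bd c"] sum_bd c(2) by blast
    have "c e - c' e = 0"
      by (rule tree_fan_signed_unique[OF fan H, of "\<lambda>e. c e - c' e"]) (use c c' in \<open>auto simp: bd_diff\<close>)
    then have "c e = c' e" by simp
    then show ?thesis using c'(3) by metis
  qed
  ultimately show ?thesis
    unfolding forest_def using tree_fanD(2)[OF fan H] tree_fan_signed_unique[OF fan H] by blast
qed

lemma lin_inject:
  assumes S: "forest S" and x: "lin S x" and y: "lin S y"
    and src: "\<And>i. i \<in> I \<Longrightarrow> inflow x i = inflow y i"
    and snk: "\<And>j. j \<in> J \<Longrightarrow> outflow x j = outflow y j"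
  shows "x = y"
proof -
  have "dv x = dv y" unfolding dv_def using src snk by (auto simp: of_bool_def)
  then have "bd (ch S x) u = bd (ch S y) u" if "u \<in> {1..n}" for u
    using x y that unfolding lin_def by simp
  then have "ch S x = ch S y" by (intro forest_unique[OF S]) (auto simp: ch_def)
  then show ?thesis
    using x y unfolding lin_def
    by (intro flow_eqI[OF forestD(2)[OF S] _ _ src snk]) auto
qed

lemma lin_lincomb:
  assumes "lin S x" "lin S y"
  shows "lin S (s *\<^sub>R x + t *\<^sub>R y)"
proof -
  have "Poly_Mapping.keys (s *\<^sub>R x + t *\<^sub>R y) \<subseteq> Poly_Mapping.keys x \<union> Poly_Mapping.keys y"
  proof
    fix e assume e: "e \<in> Poly_Mapping.keys (s *\<^sub>R x + t *\<^sub>R y)"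
    show "e \<in> Poly_Mapping.keys x \<union> Poly_Mapping.keys y"
    proof (rule ccontr)
      assume "\<not> ?thesis"
      then have "Poly_Mapping.lookup x e = 0" "Poly_Mapping.lookup y e = 0"
        by (simp_all add: in_keys_iff)
      then show False using e by (simp add: in_keys_iff lookup_add)
    qed
  qed
  moreover have "ch S (s *\<^sub>R x + t *\<^sub>R y) = (\<lambda>e. s * ch S x e + t * ch S y e)"
    using ch_lincomb by blast
  ultimately show ?thesis
    using assms unfolding lin_def by (simp add: bd_lincomb dv_lincomb) blast
qed

text \<open>Otherwise the flow that enters the set of vertices reachable from \<open>i\<close> could not leave it.\<close>

lemma support_path:
  assumes c: "\<And>e. 0 \<le> c e" "\<And>e. e \<notin> {1..n} \<times> {1..n} \<Longrightarrow> c e = 0"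
    and d: "\<And>u. u \<in> {1..n} \<Longrightarrow> bd c u = of_bool (u \<in> I) * p u - of_bool (u \<in> J) * q u"
    and p: "\<And>i. i \<in> I \<Longrightarrow> 0 \<le> p i" and i: "i \<in> I" "0 < p i" and q: "\<And>j. j \<in> J \<Longrightarrow> 0 \<le> q j"
  shows "\<exists>j\<in>J. 0 < q j \<and> (i, j) \<in> {e. 0 < c e}\<^sup>*"
proof (rule ccontr)
  assume no: "\<not> ?thesis"
  define R where "R = {u. (i, u) \<in> {e. 0 < c e}\<^sup>*}"
  have i_n: "i \<in> {1..n}" using i I_sub by auto
  have step: "snd e \<in> R" if "fst e \<in> R" "0 < c e" for e
    using that rtrancl_into_rtrancl[of i "fst e" "{e. 0 < c e}" "snd e"] by (auto simp: R_def)
  have "(\<Sum>u\<in>{1..n}. of_bool (u \<in> R) * bd c u) = (\<Sum>e\<in>{1..n} \<times> {1..n}. c e * (of_bool (fst e \<in> R) - of_bool (snd e \<in> R)))"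
    by (rule bd_pairing)
  also have "\<dots> \<le> 0"
  proof (rule sum_nonpos)
    fix e
    show "c e * (of_bool (fst e \<in> R) - of_bool (snd e \<in> R)) \<le> 0"
      using step[of e] c(1)[of e] by (cases "c e = 0") (auto simp: of_bool_def)
  qed
  finally have "(\<Sum>u\<in>{1..n}. of_bool (u \<in> R) * bd c u) \<le> 0" .
  moreover have "(\<Sum>u\<in>{1..n}. of_bool (u \<in> R) * bd c u) = (\<Sum>u\<in>{1..n}. of_bool (u \<in> R \<and> u \<in> I) * p u)"
  proof (rule sum.cong[OF refl])
    fix u assume u: "u \<in> {1..n}"
    have "q u = 0" if "u \<in> R" "u \<in> J" using no q[of u] that unfolding R_def by force
    then show "of_bool (u \<in> R) * bd c u = of_bool (u \<in> R \<and> u \<in> I) * p u"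
      using d[OF u] by (auto simp: of_bool_def)
  qed
  moreover have "p i \<le> (\<Sum>u\<in>{1..n}. of_bool (u \<in> R \<and> u \<in> I) * p u)"
  proof -
    have "of_bool (i \<in> R \<and> i \<in> I) * p i \<le> (\<Sum>u\<in>{1..n}. of_bool (u \<in> R \<and> u \<in> I) * p u)"
      using i_n p by (intro member_le_sum) (auto simp: of_bool_def)
    then show ?thesis using i by (simp add: R_def)
  qed
  ultimately show False using i by simp
qed

text \<open>A walk may pass an arc repeatedly, so the coefficients are natural numbers and not only
  0 and 1. Integrality and nonnegativity are what a lattice point of the flow polytope
  needs.\<close>

lemma path_chain:
  assumes "(i, j) \<in> E\<^sup>*" "E \<subseteq> {1..n} \<times> {1..n}"
  shows "\<exists>z. (\<forall>e. z e \<in> \<nat>) \<and> (\<forall>e. e \<notin> E \<longrightarrow> z e = 0) \<and> (\<forall>u. bd z u = of_bool (i = u) - of_bool (j = u))"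
  using assms(1)
proof induction
  case base
  show ?case by (intro exI[of _ "\<lambda>_. 0"]) (simp add: bd_zero)
next
  case (step a b)
  then obtain z where z: "\<forall>e. z e \<in> \<nat>" "\<forall>e. e \<notin> E \<longrightarrow> z e = 0" "\<forall>u. bd z u = of_bool (i = u) - of_bool (a = u)"
    by blast
  let ?z = "\<lambda>e. z e + of_bool (e = (a, b))"
  have "a \<in> {1..n}" "b \<in> {1..n}" using step.hyps assms(2) by auto
  then have "bd ?z u = of_bool (i = u) - of_bool (b = u)" for u
    using z(3) by (simp add: bd_add bd_single)
  moreover have "?z e \<in> \<nat>" for e using spec[OF z(1), of e] by (auto intro: Nats_add)
  moreover have "?z e = 0" if "e \<notin> E" for e using spec[OF z(2), of e] step.hyps that by auto
  ultimately show ?case by (intro exI[of _ ?z] conjI allI impI)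
qed

section \<open>Flow polytopes as hulls of their lattice points\<close>

definition coords :: "(nat \<times> nat) set \<Rightarrow> (nat \<times> nat) set" where
  "coords S = S \<union> src \<union> snk"

abbreviation coord :: "nat \<times> nat \<Rightarrow> flow \<Rightarrow> real" where
  "coord e y \<equiv> flow_along (fst e) (snd e) y"

lemma coord_src: "i \<in> I \<Longrightarrow> coord (0, i) y = inflow y i"
  using I_sub by (auto simp: flow_along_def)

lemma coord_snk: "j \<in> J \<Longrightarrow> coord (j, n + 1) y = outflow y j"
  using J_sub by (auto simp: flow_along_def)

lemma coord_lincomb: "coord e (s *\<^sub>R x + t *\<^sub>R y) = s * coord e x + t * coord e y"
  by (simp add: flow_along_def lookup_add algebra_simps)

lemma finite_coords: "forest S \<Longrightarrow> finite (coords S)"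
  using forestD(3) by (simp add: coords_def)

definition FPV :: "(nat \<times> nat) set \<Rightarrow> flow set" where
  "FPV S = FP S \<inter> lattice_points"

lemma FP_coords:
  assumes "simple S"
  shows "y \<in> FP S \<longleftrightarrow> lin S y \<and> (\<Sum>i\<in>I. inflow y i) = 1 \<and>
    (\<Sum>j\<in>J. outflow y j) = 1 \<and> (\<forall>e\<in>coords S. 0 \<le> coord e y)"
proof -
  have "(\<forall>e\<in>coords S. 0 \<le> coord e y) \<longleftrightarrow> (\<forall>e\<in>S. 0 \<le> ch S y e) \<and>
      (\<forall>i\<in>I. 0 \<le> inflow y i) \<and> (\<forall>j\<in>J. 0 \<le> outflow y j)"
    unfolding coords_def ball_Un using coord_src[of _ y] coord_snk[of _ y] by (simp add: ch_def)
  then show ?thesis unfolding FP_iff[OF assms] unit_flow_def by (simp only: conj_ac)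
qed

text \<open>At a lattice point the source flows are nonnegative integers with sum 1, and so are the
  sink flows. Hence they are 0 or 1, and they determine the flow on a forest.\<close>

lemma finite_FPV:
  assumes S: "forest S"
  shows "finite (FPV S)"
proof -
  let ?f = "\<lambda>y. ({i\<in>I. inflow y i = (1::real)}, {j\<in>J. outflow y j = (1::real)})"
  have zero_one: "r = 0 \<or> r = 1" if "r \<in> \<int>" "0 \<le> r" "r \<le> 1" for r :: real
  proof -
    obtain m where "r = of_int m" using \<open>r \<in> \<int>\<close> by (rule Ints_cases)
    with that show ?thesis by auto
  qed
  have p01: "inflow y i = 0 \<or> inflow y i = 1" if "y \<in> FPV S" "i \<in> I" for y i
  proof -
    have y: "unit_flow y" "y \<in> lattice_points" using that FP_iff[OF forestD(2)[OF S]] by (auto simp: FPV_def)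
    have "inflow y i \<le> (\<Sum>i\<in>I. inflow y i)"
      using y(1) that(2) unfolding unit_flow_def by (intro member_le_sum) auto
    then show ?thesis
      using y that(2) unfolding unit_flow_def lattice_points_def by (intro zero_one) auto
  qed
  have q01: "outflow y j = 0 \<or> outflow y j = 1" if "y \<in> FPV S" "j \<in> J" for y j
  proof -
    have y: "unit_flow y" "y \<in> lattice_points" using that FP_iff[OF forestD(2)[OF S]] by (auto simp: FPV_def)
    have "outflow y j \<le> (\<Sum>j\<in>J. outflow y j)"
      using y(1) that(2) unfolding unit_flow_def by (intro member_le_sum) auto
    then show ?thesis
      using y that(2) unfolding unit_flow_def lattice_points_def by (intro zero_one) auto
  qed
  have "inj_on ?f (FPV S)"
  proof (rule inj_onI)
    fix x y assume x: "x \<in> FPV S" and y: "y \<in> FPV S" and eq: "?f x = ?f y"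
    have "lin S x" "lin S y" using x y FP_iff[OF forestD(2)[OF S]] by (auto simp: FPV_def)
    then show "x = y"
    proof (rule lin_inject[OF S])
      have eq1: "{i\<in>I. inflow x i = 1} = {i\<in>I. inflow y i = 1}"
        and eq2: "{j\<in>J. outflow x j = 1} = {j\<in>J. outflow y j = 1}"
        using eq by blast+
      show "inflow x i = inflow y i" if "i \<in> I" for i
        using p01[OF x that] p01[OF y that] that eqset_imp_iff[OF eq1, of i] by auto
      show "outflow x j = outflow y j" if "j \<in> J" for j
        using q01[OF x that] q01[OF y that] that eqset_imp_iff[OF eq2, of j] by auto
    qed
  qed
  moreover have "?f ` FPV S \<subseteq> Pow I \<times> Pow J" by auto
  then have "finite (?f ` FPV S)" by (rule finite_subset) simp
  ultimately show ?thesis by (rule finite_imageD[rotated])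
qed

text \<open>Flow decomposition: unit path flows inside the support are peeled off until nothing is
  left. It is stated for the cone over the polytope because the remainders no longer have total
  1.\<close>

lemma cone_decomp:
  assumes S: "forest S" and y: "lin S y" "\<forall>e\<in>coords S. 0 \<le> coord e y"
  shows "\<exists>l. (\<forall>v\<in>FPV S. 0 \<le> l v) \<and> y = (\<Sum>v\<in>FPV S. l v *\<^sub>R v)"
  using y
proof (induction "card {e \<in> coords S. coord e y \<noteq> 0}" arbitrary: y rule: less_induct)
  case less
  note simple = forestD(2)[OF S] and fin = finite_coords[OF S]
  have S_n: "S \<subseteq> {1..n} \<times> {1..n}" by (rule simpleD(3)[OF simple])
  have src: "0 \<le> inflow y i" if "i \<in> I" for i
    using bspec[OF less.prems(2), of "(0, i)"] coord_src[OF that, of y] that by (simp add: coords_def)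
  have snk: "0 \<le> outflow y j" if "j \<in> J" for j
    using bspec[OF less.prems(2), of "(j, n + 1)"] coord_snk[OF that, of y] that by (simp add: coords_def)
  have ch_nn: "0 \<le> ch S y e" for e using less.prems(2) by (auto simp: ch_def coords_def)
  have bd_y: "bd (ch S y) u = dv y u" if "u \<in> {1..n}" for u
    using less.prems(1) that unfolding lin_def by blast
  show ?case
  proof (cases "\<exists>i\<in>I. 0 < inflow y i")
    case False
    \<comment> \<open>Without source flow there is no sink flow, and a forest carries no
      circulation.\<close>
    then have p0: "inflow y i = 0" if "i \<in> I" for i using src[OF that] that by force
    have "(\<Sum>j\<in>J. outflow y j) = 0"
    proof -
      have "(\<Sum>i\<in>I. inflow y i) = 0" by (rule sum.neutral) (use p0 in blast)
      then show ?thesis using lin_sum_dv[OF less.prems(1)] sum_dv[of y] by linarith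
    qed
    then have q0: "outflow y j = 0" if "j \<in> J" for j
      using sum_nonneg_0[of J "\<lambda>j. outflow y j" j] snk that finite_IJ(2) by blast
    have "lin S 0" using lin_lincomb[OF less.prems(1) less.prems(1), of 0 0] by simp
    then have "y = 0" using p0 q0 by (intro lin_inject[OF S less.prems(1)]) auto
    then show ?thesis by (intro exI[of _ "\<lambda>_. 0"]) simp
  next
    case True
    then obtain i where i: "i \<in> I" "0 < inflow y i" by blast
    have "\<exists>j\<in>J. 0 < outflow y j \<and> (i, j) \<in> {e. 0 < ch S y e}\<^sup>*"
    proof (rule support_path[where p = "\<lambda>i. inflow y i"])
      show "ch S y e = 0" if "e \<notin> {1..n} \<times> {1..n}" for e using that S_n by (auto simp: ch_def)
      show "bd (ch S y) u = of_bool (u \<in> I) * inflow y u - of_bool (u \<in> J) * outflow y u"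
        if "u \<in> {1..n}" for u using bd_y[OF that] by (simp only: dv_def)
    qed (use ch_nn src snk i in auto)
    then obtain j where j: "j \<in> J" "0 < outflow y j" "(i, j) \<in> {e. 0 < ch S y e}\<^sup>*"
      by blast
    have "{e. 0 < ch S y e} \<subseteq> {1..n} \<times> {1..n}" using S_n by (auto simp: ch_def split: if_splits)
    with path_chain[OF j(3)] obtain z where z: "\<And>e. z e \<in> \<nat>" "\<And>e. \<not> 0 < ch S y e \<Longrightarrow> z e = 0"
      "\<And>u. bd z u = of_bool (i = u) - of_bool (j = u)" by auto
    define v where "v = mk S (\<lambda>u. of_bool (i = u)) (\<lambda>u. of_bool (j = u)) z"
    have zS: "z e = 0" if "e \<notin> S" for e using z(2)[of e] that by (auto simp: ch_def)
    have ch_v: "ch S v = z" unfolding v_def by (rule ch_mk[OF simple zS])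
    have lin_v: "lin S v"
      unfolding v_def by (rule lin_mk[OF simple zS]) (use z(3) i j in auto)
    have v_src: "inflow v u = of_bool (i = u)" if "u \<in> I" for u
      unfolding v_def by (rule lookup_mk_src[OF simple that])
    have v_snk: "outflow v u = of_bool (j = u)" if "u \<in> J" for u
      unfolding v_def by (rule lookup_mk_snk[OF simple that])
    have z_nn: "0 \<le> z e" for e using z(1)[of e] by (auto elim: Nats_cases)
    have v_unit: "unit_flow v"
      unfolding unit_flow_def using v_src v_snk i j by (simp add: of_bool_def)
    have "v \<in> FP S"
      unfolding FP_iff[OF simple] ch_v using lin_v v_unit z_nn by simp
    moreover have "v \<in> lattice_points"
    proof -
      have "z e \<in> \<int>" for e using z(1)[of e] by (auto elim!: Nats_cases)
      then have "Poly_Mapping.lookup v (a, b) \<in> \<int>" for a b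
        unfolding v_def lookup_mk[OF simple] by (auto simp: of_bool_def)
      then show ?thesis unfolding lattice_points_def by auto
    qed
    ultimately have v: "v \<in> FPV S" by (simp add: FPV_def)
    have v_nn: "\<forall>e\<in>coords S. 0 \<le> coord e v" using \<open>v \<in> FP S\<close> by (simp add: FP_coords[OF simple])
    have pos: "0 < coord e y" if e: "e \<in> coords S" "0 < coord e v" for e
    proof -
      consider "e \<in> S" | u where "u \<in> I" "e = (0, u)" | u where "u \<in> J" "e = (u, n + 1)"
        using e(1) unfolding coords_def by auto
      then show ?thesis
      proof cases
        case 1
        then have "0 < z e" using e(2) fun_cong[OF ch_v, of e] by (simp add: ch_def)
        then have "0 < ch S y e" using z(2)[of e] by linarith
        then show ?thesis using 1 by (simp add: ch_def)
      next
        case 2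
        then have "i = u" using e(2) v_src[of u] coord_src[of u v] by (cases "i = u") auto
        then show ?thesis using 2 i coord_src[of u y] by simp
      next
        case 3
        then have "j = u" using e(2) v_snk[of u] coord_snk[of u v] by (cases "j = u") auto
        then show ?thesis using 3 j coord_snk[of u y] by simp
      qed
    qed
    define A where "A = {e \<in> coords S. 0 < coord e v}"
    have A: "finite A" "A \<noteq> {}"
    proof -
      show "finite A" using fin by (simp add: A_def)
      have "(0, i) \<in> A" using i v_src[OF i(1)] coord_src[OF i(1), of v] by (simp add: A_def coords_def)
      then show "A \<noteq> {}" by blast
    qed
    \<comment> \<open>The largest multiple of \<open>v\<close> that can be subtracted; a coordinate
      where the minimum is attained becomes 0, which lowers the induction measure.\<close>
    define \<epsilon> where "\<epsilon> = Min ((\<lambda>e. coord e y / coord e v) ` A)"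
    obtain e0 where e0: "e0 \<in> A" "\<epsilon> = coord e0 y / coord e0 v"
    proof -
      have "\<epsilon> \<in> (\<lambda>e. coord e y / coord e v) ` A"
        unfolding \<epsilon>_def using A by (intro Min_in) auto
      then show thesis using that by blast
    qed
    have eps_le: "\<epsilon> \<le> coord e y / coord e v" if "e \<in> A" for e
      unfolding \<epsilon>_def using A(1) that by (intro Min_le) auto
    have eps_pos: "0 < \<epsilon>" using e0 pos by (auto simp: A_def)
    define y' where "y' = 1 *\<^sub>R y + (- \<epsilon>) *\<^sub>R v"
    have coord_y': "coord e y' = coord e y - \<epsilon> * coord e v" for e
      unfolding y'_def coord_lincomb by simp
    have lin_y': "lin S y'" unfolding y'_def by (rule lin_lincomb[OF less.prems(1) lin_v])
    have nn_y': "\<forall>e\<in>coords S. 0 \<le> coord e y'"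
    proof
      fix e assume e: "e \<in> coords S"
      show "0 \<le> coord e y'"
      proof (cases "e \<in> A")
        case True
        then have "0 < coord e v" by (simp add: A_def)
        then have "\<epsilon> * coord e v \<le> coord e y" using eps_le[OF True] by (simp only: pos_le_divide_eq)
        then show ?thesis by (simp add: coord_y')
      next
        case False
        then have "coord e v = 0" using e v_nn by (force simp: A_def)
        then show ?thesis using less.prems(2) e by (simp add: coord_y')
      qed
    qed
    have "{e \<in> coords S. coord e y' \<noteq> 0} \<subset> {e \<in> coords S. coord e y \<noteq> 0}"
    proof
      show "{e \<in> coords S. coord e y' \<noteq> 0} \<subseteq> {e \<in> coords S. coord e y \<noteq> 0}"
      proof
        fix e assume e: "e \<in> {e \<in> coords S. coord e y' \<noteq> 0}"
        have "coord e v = 0" if "coord e y = 0"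
          using pos[of e] v_nn e that by force
        then show "e \<in> {e \<in> coords S. coord e y \<noteq> 0}" using e by (auto simp: coord_y')
      qed
      have e0': "e0 \<in> coords S" "0 < coord e0 v" using e0(1) by (auto simp: A_def)
      then have "coord e0 y' = 0" "coord e0 y \<noteq> 0" using e0(2) pos[of e0] by (auto simp: coord_y')
      then show "{e \<in> coords S. coord e y' \<noteq> 0} \<noteq> {e \<in> coords S. coord e y \<noteq> 0}" using e0' by blast
    qed
    then have "card {e \<in> coords S. coord e y' \<noteq> 0} < card {e \<in> coords S. coord e y \<noteq> 0}"
      using fin by (intro psubset_card_mono) auto
    from less.hyps[OF this lin_y' nn_y'] obtain l where l: "\<forall>v\<in>FPV S. 0 \<le> l v" "y' = (\<Sum>v\<in>FPV S. l v *\<^sub>R v)"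
      by blast
    let ?l = "\<lambda>x. l x + (if x = v then \<epsilon> else 0)"
    have "(\<Sum>x\<in>FPV S. ?l x *\<^sub>R x) = y' + \<epsilon> *\<^sub>R v"
      using finite_FPV[OF S] v unfolding l(2)
      by (simp add: scaleR_add_left sum.distrib if_distrib[of "\<lambda>r. r *\<^sub>R _"] cong: if_cong)
    also have "\<dots> = y" unfolding y'_def by simp
    finally show ?thesis using l(1) eps_pos by (intro exI[of _ ?l]) auto
  qed
qed

lemma unit_flow_convex:
  assumes "unit_flow x" "unit_flow y" "0 \<le> s" "0 \<le> t" "s + t = 1"
  shows "unit_flow (s *\<^sub>R x + t *\<^sub>R y)"
  using assms unfolding unit_flow_def
  by (simp add: lookup_add sum.distrib flip: sum_distrib_left)

lemma convex_FP:
  assumes "simple S"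
  shows "convex (FP S)"
proof (rule convexI)
  fix x y and s t :: real
  assume "x \<in> FP S" "y \<in> FP S" "0 \<le> s" "0 \<le> t" "s + t = 1"
  then show "s *\<^sub>R x + t *\<^sub>R y \<in> FP S"
    unfolding FP_iff[OF assms] using lin_lincomb unit_flow_convex by (simp add: ch_lincomb)
qed

theorem FP_hull:
  assumes S: "forest S"
  shows "FP S = convex hull (FPV S)"
proof
  note simple = forestD(2)[OF S]
  show "convex hull (FPV S) \<subseteq> FP S"
    by (rule hull_minimal) (auto simp: FPV_def convex_FP[OF simple])
  show "FP S \<subseteq> convex hull (FPV S)"
  proof
    fix y assume "y \<in> FP S"
    then have y: "lin S y" "\<forall>e\<in>coords S. 0 \<le> coord e y" "(\<Sum>i\<in>I. inflow y i) = 1"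
      using FP_coords[OF simple] by blast+
    obtain l where l: "\<forall>v\<in>FPV S. 0 \<le> l v" "y = (\<Sum>v\<in>FPV S. l v *\<^sub>R v)"
      using cone_decomp[OF S y(1,2)] by blast
    \<comment> \<open>Every lattice point has total source flow 1, so comparing totals shows that
      the weights sum to 1.\<close>
    have "1 = (\<Sum>i\<in>I. \<Sum>v\<in>FPV S. l v * inflow v i)"
      using y(3) l(2) by (simp add: lookup_sum)
    also have "\<dots> = (\<Sum>v\<in>FPV S. l v * (\<Sum>i\<in>I. inflow v i))"
      by (subst sum.swap) (simp add: sum_distrib_left)
    also have "\<dots> = (\<Sum>v\<in>FPV S. l v)"
      by (rule sum.cong[OF refl]) (auto simp: FPV_def FP_iff[OF simple] unit_flow_def)
    finally show "y \<in> convex hull (FPV S)"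
      using l unfolding convex_hull_finite[OF finite_FPV[OF S]] by auto
  qed
qed

end

section \<open>Cells\<close>

text \<open>The point \<open>x\<close> lies strictly between \<open>y\<close> and the extended
  point, both in \<open>C\<close>, so a face through \<open>x\<close> contains them.\<close>

lemma face_contains_extension:
  fixes x y :: "'a::real_vector"
  assumes "F face_of C" "x \<in> F" "y \<in> C" "\<epsilon> > 0" "x + \<epsilon> *\<^sub>R (x - y) \<in> C"
  shows "y \<in> F"
proof (cases "x = y")
  case True
  then show ?thesis using assms by simp
next
  case False
  let ?z = "x + \<epsilon> *\<^sub>R (x - y)"
  have "x \<in> open_segment y ?z"
  proof -
    \<comment> \<open>Obtained by solving \<open>x = (1 - t) *\<^sub>R y + t *\<^sub>R ?z\<close>
      for \<open>t\<close>.\<close>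
    define t where "t = 1 / (1 + \<epsilon>)"
    have t: "t + t * \<epsilon> = 1" "0 < t" "t < 1" using assms(4) by (simp_all add: t_def field_simps)
    have "(1 - t) *\<^sub>R y + t *\<^sub>R ?z = (t + t * \<epsilon>) *\<^sub>R x + (1 - (t + t * \<epsilon>)) *\<^sub>R y"
      by (simp add: algebra_simps)
    then have "x = (1 - t) *\<^sub>R y + t *\<^sub>R ?z" unfolding t(1) by simp
    moreover have "y \<noteq> ?z"
    proof
      assume "y = ?z"
      then have "(1 + \<epsilon>) *\<^sub>R (x - y) = 0" by (simp add: algebra_simps)
      then show False using False assms(4) by simp
    qed
    ultimately show ?thesis unfolding in_segment using t by blast
  qed
  then show ?thesis using assms unfolding face_of_def by blast
qed

context valley_path begin

abbreviation "\<P> \<equiv> cyclic_flow_polytope \<nu>"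

definition cell :: "(nat \<times> nat) set \<Rightarrow> flow set" where
  "cell S = {x \<in> \<P>. \<exists>c. nonneg_on S c \<and> (\<forall>u\<in>{1..n}. bd c u = dv x u)}"

lemma nonneg_on_ch: "y \<in> FP S \<Longrightarrow> simple S \<Longrightarrow> nonneg_on S (ch S y)"
  by (rule nonneg_onI) (auto simp: FP_iff ch_def)

text \<open>Stronger than surjectivity of \<open>lift\<close> onto the cell: the arc flows of the
  preimage are prescribed too, and \<open>cut_half\<close> compares them.\<close>

lemma FP_ch_ge: "simple S \<Longrightarrow> x \<in> \<P> \<Longrightarrow> nonneg_on S c \<Longrightarrow> (\<And>u. u \<in> {1..n} \<Longrightarrow> bd c u = dv x u) \<Longrightarrow>
    \<exists>y\<in>FP S. lift y = x \<and> ch S y = c"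
proof -
  assume S: "simple S" and x: "x \<in> \<P>" and c: "nonneg_on S c" and bd: "\<And>u. u \<in> {1..n} \<Longrightarrow> bd c u = dv x u"
  define y where "y = mk S (\<lambda>i. inflow x i) (\<lambda>j. outflow x j) c"
  have c0: "c e = 0" if "e \<notin> S" for e using nonneg_onD(2)[OF c that] .
  have chy: "ch S y = c" unfolding y_def by (rule ch_mk[OF S c0])
  have src: "inflow y i = inflow x i" if "i \<in> I" for i
    unfolding y_def by (rule lookup_mk_src[OF S that])
  have snk: "outflow y j = outflow x j" if "j \<in> J" for j
    unfolding y_def by (rule lookup_mk_snk[OF S that])
  have x': "lin tree x" "unit_flow x" using x by (auto simp: P_iff)
  have unit: "unit_flow y" using x'(2) src snk unfolding unit_flow_def by simp
  have "lin S y" unfolding y_def by (rule lin_mk[OF S c0]) (use bd in \<open>auto simp: dv_def\<close>)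
  then have "y \<in> FP S" unfolding FP_iff[OF S] chy using unit nonneg_onD(1)[OF c] by blast
  moreover have "lift y = x"
  proof -
    have dv: "dv y = dv x" unfolding dv_def using src snk by (auto simp: of_bool_def)
    have "lift y = lift x"
    proof (rule flow_eqI[OF simple_tree keys_lift keys_lift])
      show "ch tree (lift y) e = ch tree (lift x) e" for e unfolding ch_lift tflow_def dv ..
    qed (simp_all only: lookup_lift_src lookup_lift_snk src snk)
    then show ?thesis using lift_id[OF x'(1)] by simp
  qed
  ultimately show ?thesis using chy by blast
qed

lemma lift_FP:
  assumes S: "simple S"
  shows "lift ` FP S = cell S"
proof (intro subset_antisym subsetI)
  fix x assume "x \<in> lift ` FP S"
  then obtain y where y: "y \<in> FP S" "x = lift y" by blast
  have "unit_flow y" "lin S y" using y(1) by (simp_all add: FP_iff[OF S])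
  then show "x \<in> cell S"
    unfolding cell_def y(2) using lift_in_P nonneg_on_ch[OF y(1) S] by (auto simp: lin_def dv_lift)
next
  fix x assume "x \<in> cell S"
  then obtain c where "x \<in> \<P>" "nonneg_on S c" "\<And>u. u \<in> {1..n} \<Longrightarrow> bd c u = dv x u"
    unfolding cell_def by blast
  then show "x \<in> lift ` FP S" using FP_ch_ge[OF S] by blast
qed

lemma inj_lift: "forest S \<Longrightarrow> inj_on lift {y. lin S y}"
proof (rule inj_onI)
  fix x y assume S: "forest S" and "x \<in> {y. lin S y}" "y \<in> {y. lin S y}" and eq: "lift x = lift y"
  then show "x = y"
    using lookup_lift_src[of _ x] lookup_lift_src[of _ y] lookup_lift_snk[of _ x] lookup_lift_snk[of _ y]
    by (intro lin_inject[OF S]) auto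
qed

lemma affine_lin: "affine {y. lin S y}"
  by (rule affineI) (simp add: lin_lincomb)

lemma lattice_polytope_FP: "forest S \<Longrightarrow> lattice_polytope (FP S)"
  unfolding lattice_polytope_def
  by (intro exI[of _ "FPV S"] conjI finite_FPV FP_hull) (auto simp: FPV_def)

lemma cell_hull: "forest S \<Longrightarrow> cell S = convex hull (lift ` FPV S)"
  using lift_FP[OF forestD(2)] FP_hull convex_hull_linear_image[OF linear_lift] by metis

lemma lattice_polytope_cell: "forest S \<Longrightarrow> lattice_polytope (cell S)"
  unfolding lattice_polytope_def using lift_integral
  by (intro exI[of _ "lift ` FPV S"] conjI cell_hull finite_imageI finite_FPV) (auto simp: FPV_def)

lemma polytope_cell: "forest S \<Longrightarrow> polytope (cell S)"
  unfolding polytope_def using finite_FPV cell_hull by blast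

text \<open>The inverse preserves lattice points because \<open>lift\<close> keeps source and sink
  flows: they make the boundary integral, and on a forest an integral boundary forces integral arc
  flows.\<close>

theorem integral_equivalence_lift:
  assumes S: "forest S"
  shows "integral_equivalence lift (FP S) (cell S)"
proof -
  note simple = forestD(2)[OF S]
  have hull_sub: "affine hull (FP S) \<subseteq> {y. lin S y}"
    by (rule hull_minimal) (auto simp: affine_lin FP_iff[OF simple])
  have hull_img: "lift ` (affine hull (FP S)) = affine hull (cell S)"
    using affine_hull_linear[OF linear_lift] lift_FP[OF simple] by metis
  have "bij_betw lift (FP S) (cell S)"
    unfolding bij_betw_def
    using lift_FP[OF simple] inj_on_subset[OF inj_lift[OF S], of "FP S"] FP_iff[OF simple] by blast
  moreover have "bij_betw lift (affine hull (FP S) \<inter> lattice_points) (affine hull (cell S) \<inter> lattice_points)"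
    unfolding bij_betw_def
  proof
    show "inj_on lift (affine hull (FP S) \<inter> lattice_points)"
      using inj_on_subset[OF inj_lift[OF S]] hull_sub by blast
    show "lift ` (affine hull (FP S) \<inter> lattice_points) = affine hull (cell S) \<inter> lattice_points"
    proof (intro subset_antisym subsetI)
      fix x assume "x \<in> lift ` (affine hull (FP S) \<inter> lattice_points)"
      then show "x \<in> affine hull (cell S) \<inter> lattice_points"
        using hull_img lift_integral by blast
    next
      fix x assume x: "x \<in> affine hull (cell S) \<inter> lattice_points"
      then obtain y where y: "y \<in> affine hull (FP S)" "x = lift y" using hull_img by blast
      have lin: "lin S y" using y hull_sub by blast
      have xint: "Poly_Mapping.lookup x e \<in> \<int>" for e using x unfolding lattice_points_def by blast
      have src: "inflow y i \<in> \<int>" if "i \<in> I" for i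
        using xint[of "(0, i)"] lookup_lift_src[OF that] y by simp
      have snk: "outflow y j \<in> \<int>" if "j \<in> J" for j
        using xint[of "(j, n + 1)"] lookup_lift_snk[OF that] y by simp
      have "bd (ch S y) u \<in> \<int>" if "u \<in> {1..n}" for u
        using lin that src snk unfolding lin_def by (auto simp: dv_def of_bool_def)
      then have chint: "ch S y e \<in> \<int>" for e
        by (intro forest_integral[OF S, of "ch S y"]) (auto simp: ch_def)
      have "Poly_Mapping.lookup y e \<in> \<int>" for e
      proof -
        consider "e \<in> upair ` S" | "e \<in> src" | "e \<in> snk" | "e \<notin> upair ` S \<union> src \<union> snk" by blast
        then show ?thesis
        proof cases
          case 1
          then obtain e' where "e' \<in> S" "e = upair e'" by blast
          then show ?thesis using chint[of e']
            by (auto simp: ch_def flow_along_def upair_def split: if_splits)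
        next
          case 2
          then show ?thesis using src by auto
        next
          case 3
          then show ?thesis using snk by auto
        next
          case 4
          then have "e \<notin> Poly_Mapping.keys y" using lin unfolding lin_def by blast
          then show ?thesis by (simp add: in_keys_iff)
        qed
      qed
      then have "y \<in> lattice_points" unfolding lattice_points_def by blast
      then show "x \<in> lift ` (affine hull (FP S) \<inter> lattice_points)" using y by blast
    qed
  qed
  moreover have "affine_map lift"
    unfolding affine_map_def using linear_lift by (intro exI[of _ lift] exI[of _ 0]) simp
  ultimately show ?thesis
    unfolding integral_equivalence_def using lattice_polytope_FP[OF S] lattice_polytope_cell[OF S] by blast
qed

lemma convex_P: "convex \<P>"
proof (rule convexI)
  fix x y and s t :: real
  assume "x \<in> \<P>" "y \<in> \<P>" "0 \<le> s" "0 \<le> t" "s + t = 1"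
  then show "s *\<^sub>R x + t *\<^sub>R y \<in> \<P>"
    unfolding P_iff using lin_lincomb unit_flow_convex by blast
qed

lemma nonneg_on_lincomb:
  assumes "nonneg_on S c" "nonneg_on S d" "0 \<le> s" "0 \<le> t"
  shows "nonneg_on S (\<lambda>e. s * c e + t * d e)"
  by (rule nonneg_onI) (use nonneg_onD[OF assms(1)] nonneg_onD[OF assms(2)] assms(3,4) in auto)

lemma cellI: "x \<in> \<P> \<Longrightarrow> nonneg_on S c \<Longrightarrow> (\<And>u. u \<in> {1..n} \<Longrightarrow> bd c u = dv x u) \<Longrightarrow> x \<in> cell S"
  unfolding cell_def by blast

lemma convex_cell: "convex (cell S)"
proof (rule convexI)
  fix x y and s t :: real
  assume xy: "x \<in> cell S" "y \<in> cell S" and st: "0 \<le> s" "0 \<le> t" "s + t = 1"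
  obtain c where c: "x \<in> \<P>" "nonneg_on S c" "\<And>u. u \<in> {1..n} \<Longrightarrow> bd c u = dv x u" using xy(1) unfolding cell_def by blast
  obtain d where d: "y \<in> \<P>" "nonneg_on S d" "\<And>u. u \<in> {1..n} \<Longrightarrow> bd d u = dv y u" using xy(2) unfolding cell_def by blast
  show "s *\<^sub>R x + t *\<^sub>R y \<in> cell S"
  proof (rule cellI)
    show "s *\<^sub>R x + t *\<^sub>R y \<in> \<P>" using convexD[OF convex_P c(1) d(1) st] .
    show "nonneg_on S (\<lambda>e. s * c e + t * d e)" using nonneg_on_lincomb[OF c(2) d(2) st(1,2)] .
  qed (simp add: bd_lincomb dv_lincomb c(3) d(3))
qed

lemma forest_unique_nonneg:
  assumes "forest S" "nonneg_on S c" "nonneg_on S c'" "\<And>u. u \<in> {1..n} \<Longrightarrow> bd c u = bd c' u"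
  shows "c = c'"
  by (rule forest_unique[OF assms(1) nonneg_onD(2)[OF assms(2)] nonneg_onD(2)[OF assms(3)] assms(4)])

text \<open>By uniqueness the coefficients depend affinely on the point. A coefficient that vanishes
  strictly inside a segment and is nonnegative at its ends vanishes at the ends.\<close>

lemma cell_face_of:
  assumes S: "forest S" and R: "R \<subseteq> S"
  shows "cell R face_of cell S"
  unfolding face_of_def
proof (intro conjI ballI impI)
  show "cell R \<subseteq> cell S" unfolding cell_def using nonneg_on_mono[OF _ R] by blast
  show "convex (cell R)" by (rule convex_cell)
  fix a b x assume a: "a \<in> cell S" and b: "b \<in> cell S" and x: "x \<in> cell R" and seg: "x \<in> open_segment a b"
  obtain t where t: "0 < t" "t < 1" "x = (1 - t) *\<^sub>R a + t *\<^sub>R b" using seg by (auto simp: in_segment)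
  obtain c where c: "a \<in> \<P>" "nonneg_on S c" "\<And>u. u \<in> {1..n} \<Longrightarrow> bd c u = dv a u" using a unfolding cell_def by blast
  obtain d where d: "b \<in> \<P>" "nonneg_on S d" "\<And>u. u \<in> {1..n} \<Longrightarrow> bd d u = dv b u" using b unfolding cell_def by blast
  obtain e where e: "nonneg_on R e" "\<And>u. u \<in> {1..n} \<Longrightarrow> bd e u = dv x u" using x unfolding cell_def by blast
  have ce: "(\<lambda>z. (1 - t) * c z + t * d z) = e"
  proof (rule forest_unique_nonneg[OF S _ nonneg_on_mono[OF e(1) R]])
    show "nonneg_on S (\<lambda>z. (1 - t) * c z + t * d z)" using nonneg_on_lincomb[OF c(2) d(2)] t by simp
    show "bd (\<lambda>z. (1 - t) * c z + t * d z) u = bd e u" if "u \<in> {1..n}" for u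
      using that by (simp add: bd_lincomb c(3) d(3) e(2) t(3) dv_lincomb)
  qed
  have "c z = 0 \<and> d z = 0" if "z \<notin> R" for z
  proof -
    have "(1 - t) * c z + t * d z = 0" using fun_cong[OF ce, of z] nonneg_onD(2)[OF e(1) that] by simp
    moreover have "0 \<le> (1 - t) * c z" "0 \<le> t * d z" using nonneg_onD(1)[OF c(2)] nonneg_onD(1)[OF d(2)] t by auto
    ultimately have "(1 - t) * c z = 0" "t * d z = 0" by linarith+
    then show ?thesis using t by auto
  qed
  then have "nonneg_on R c" "nonneg_on R d"
    using nonneg_onD(1)[OF c(2)] nonneg_onD(1)[OF d(2)] by (auto intro!: nonneg_onI)
  then show "a \<in> cell R" "b \<in> cell R" using cellI c d by blast+
qed

section \<open>Interior points of cells\<close>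

definition positive :: "flow \<Rightarrow> bool" where
  "positive x \<longleftrightarrow> (\<forall>i\<in>I. 0 < inflow x i) \<and> (\<forall>j\<in>J. 0 < outflow x j)"

text \<open>Points in the relative interior of \<open>cell S\<close> that also avoid the boundary of
  the whole polytope; they serve as base points for perturbations.\<close>

definition full :: "(nat \<times> nat) set \<Rightarrow> flow \<Rightarrow> bool" where
  "full S x \<longleftrightarrow> x \<in> \<P> \<and> positive x \<and> (\<exists>c. nonneg_on S c \<and> (\<forall>e\<in>S. 0 < c e) \<and> (\<forall>u\<in>{1..n}. bd c u = dv x u))"

lemma full_cell: "full S x \<Longrightarrow> x \<in> cell S"
  unfolding full_def cell_def by blast

text \<open>One unit on every arc gives each leaf a supply of the right sign, because the leaf is
  covered. Source and sink flows are then chosen positive with these supplies and scaled to total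
  1.\<close>

lemma full_exists:
  assumes S: "forest S" and cov: "covers S"
  shows "\<exists>x. full S x"
proof -
  note simple = forestD(2)[OF S]
  let ?c = "\<lambda>e. of_bool (e \<in> S) :: real"
  define d where "d = bd ?c"
  have d_eq: "d u = (\<Sum>e\<in>S. of_bool (fst e = u)) - (\<Sum>e\<in>S. of_bool (snd e = u))" for u
    unfolding d_def by (subst bd_on[OF simpleD(3)[OF simple]]) (auto simp: sum_subtractf)
  have dI: "0 < d u" if u: "u \<in> I - J" for u
  proof -
    have "u \<in> {1..n} - V" using u I_sub by auto
    then obtain e where e: "e \<in> S" "u = fst e \<or> u = snd e" using cov unfolding covers_def by blast
    have nj: "snd e' \<noteq> u" if "e' \<in> S" for e' using that u forestD(1)[OF S] by auto
    then have "u = fst e" using e by blast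
    then have "0 < (\<Sum>e\<in>S. of_bool (fst e = u) :: real)"
      using e(1) forestD(3)[OF S] by (intro sum_pos2[of _ e]) auto
    moreover have "(\<Sum>e\<in>S. of_bool (snd e = u) :: real) = 0" using nj by (intro sum.neutral) auto
    ultimately show ?thesis unfolding d_eq by simp
  qed
  have dJ: "d u < 0" if u: "u \<in> J - I" for u
  proof -
    have "u \<in> {1..n} - V" using u J_sub by auto
    then obtain e where e: "e \<in> S" "u = fst e \<or> u = snd e" using cov unfolding covers_def by blast
    have nj: "fst e' \<noteq> u" if "e' \<in> S" for e' using that u forestD(1)[OF S] by auto
    then have "u = snd e" using e by blast
    then have "0 < (\<Sum>e\<in>S. of_bool (snd e = u) :: real)"
      using e(1) forestD(3)[OF S] by (intro sum_pos2[of _ e]) auto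
    moreover have "(\<Sum>e\<in>S. of_bool (fst e = u) :: real) = 0" using nj by (intro sum.neutral) auto
    ultimately show ?thesis unfolding d_eq by simp
  qed
  \<comment> \<open>At a valley only the difference of source and sink flow is prescribed, so adding
    1 to both makes them positive.\<close>
  define p where "p u = (if u \<in> J then 1 + max (d u) 0 else d u)" for u
  define q where "q u = (if u \<in> I then 1 + max (- d u) 0 else - d u)" for u
  have p: "0 < p u" if "u \<in> I" for u using dI[of u] that by (auto simp: p_def)
  have q: "0 < q u" if "u \<in> J" for u using dJ[of u] that by (auto simp: q_def)
  have pq: "of_bool (u \<in> I) * p u - of_bool (u \<in> J) * q u = d u" if "u \<in> {1..n}" for u
  proof -
    have "u \<in> I \<union> J" using that by (simp only: I_Un_J)
    then show ?thesis by (auto simp: p_def q_def)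
  qed
  define s where "s = (\<Sum>i\<in>I. p i)"
  have s: "0 < s" unfolding s_def using p one_in_I by (intro sum_pos) auto
  define y where "y = mk S (\<lambda>u. p u / s) (\<lambda>u. q u / s) (\<lambda>e. 1 / s * ?c e)"
  have chy: "ch S y = (\<lambda>e. 1 / s * ?c e)" unfolding y_def by (rule ch_mk[OF simple]) simp
  have lin: "lin S y"
    unfolding y_def
  proof (rule lin_mk[OF simple])
    fix u assume "u \<in> {1..n}"
    then have "bd (\<lambda>e. 1 / s * ?c e) u = 1 / s * (of_bool (u \<in> I) * p u - of_bool (u \<in> J) * q u)"
      unfolding bd_scale d_def[symmetric] by (simp only: pq)
    then show "bd (\<lambda>e. 1 / s * ?c e) u = of_bool (u \<in> I) * (p u / s) - of_bool (u \<in> J) * (q u / s)"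
      by (simp add: algebra_simps diff_divide_distrib)
  qed simp
  have src: "inflow y i = p i / s" if "i \<in> I" for i
    unfolding y_def by (rule lookup_mk_src[OF simple that])
  have snk: "outflow y j = q j / s" if "j \<in> J" for j
    unfolding y_def by (rule lookup_mk_snk[OF simple that])
  have sum1: "(\<Sum>i\<in>I. inflow y i) = 1"
    using src s by (simp add: s_def flip: sum_divide_distrib)
  then have sum2: "(\<Sum>j\<in>J. outflow y j) = 1"
    using lin_sum_dv[OF lin] sum_dv[of y] by linarith
  have pos: "positive y" using p q s src snk unfolding positive_def by simp
  then have unit: "unit_flow y" using sum1 sum2 unfolding unit_flow_def positive_def by (auto simp: less_imp_le)
  have "full S (lift y)"
    unfolding full_def
  proof (intro conjI exI)
    show "lift y \<in> \<P>" by (rule lift_in_P[OF unit])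
    show "positive (lift y)"
      using pos lookup_lift_src[of _ y] lookup_lift_snk[of _ y] unfolding positive_def by simp
    show "nonneg_on S (ch S y)" unfolding chy using s by (auto intro!: nonneg_onI)
    show "\<forall>e\<in>S. 0 < ch S y e" unfolding chy using s by simp
    show "\<forall>u\<in>{1..n}. bd (ch S y) u = dv (lift y) u" using lin unfolding lin_def dv_lift by blast
  qed
  then show ?thesis by blast
qed

text \<open>By \<open>P_iff\<close> the only inequalities concern source and sink flows, and these
  are strict at \<open>x\<close>.\<close>

lemma P_step:
  assumes x: "x \<in> \<P>" "positive x" and k: "lin tree k" "(\<Sum>i\<in>I. inflow k i) = 0"
    "(\<Sum>j\<in>J. outflow k j) = 0"
  shows "\<exists>\<delta>>0. \<forall>\<epsilon>. 0 \<le> \<epsilon> \<and> \<epsilon> \<le> \<delta> \<longrightarrow> x + \<epsilon> *\<^sub>R k \<in> \<P>"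
proof -
  obtain \<delta>1 where d1: "\<delta>1 > 0" "\<And>\<epsilon>. 0 \<le> \<epsilon> \<Longrightarrow> \<epsilon> \<le> \<delta>1 \<Longrightarrow>
      \<forall>i\<in>I. 0 \<le> inflow x i + \<epsilon> * inflow k i"
    using small_step[of I "\<lambda>i. inflow x i" "\<lambda>i. inflow k i"] x(2)
    unfolding positive_def by auto
  obtain \<delta>2 where d2: "\<delta>2 > 0" "\<And>\<epsilon>. 0 \<le> \<epsilon> \<Longrightarrow> \<epsilon> \<le> \<delta>2 \<Longrightarrow>
      \<forall>j\<in>J. 0 \<le> outflow x j + \<epsilon> * outflow k j"
    using small_step[of J "\<lambda>j. outflow x j" "\<lambda>j. outflow k j"] x(2)
    unfolding positive_def by auto
  have x': "lin tree x" "unit_flow x" using x(1) by (auto simp: P_iff)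
  have "x + \<epsilon> *\<^sub>R k \<in> \<P>" if e: "0 \<le> \<epsilon>" "\<epsilon> \<le> min \<delta>1 \<delta>2" for \<epsilon>
  proof -
    have "lin tree (x + \<epsilon> *\<^sub>R k)" using lin_lincomb[OF x'(1) k(1), of 1 \<epsilon>] by simp
    moreover have "\<forall>i\<in>I. 0 \<le> inflow (x + \<epsilon> *\<^sub>R k) i"
      "\<forall>j\<in>J. 0 \<le> outflow (x + \<epsilon> *\<^sub>R k) j"
      using d1(2)[of \<epsilon>] d2(2)[of \<epsilon>] e by (simp_all add: lookup_add)
    moreover have "(\<Sum>i\<in>I. inflow (x + \<epsilon> *\<^sub>R k) i) = 1"
      "(\<Sum>j\<in>J. outflow (x + \<epsilon> *\<^sub>R k) j) = 1"
      using x'(2) k(2,3) unfolding unit_flow_def by (simp_all add: lookup_add sum.distrib flip: sum_distrib_left)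
    ultimately show ?thesis unfolding P_iff unit_flow_def by blast
  qed
  then show ?thesis using d1(1) d2(1) by (intro exI[of _ "min \<delta>1 \<delta>2"]) simp
qed

lemma full_step:
  assumes S: "forest S" and x: "full S x" and k: "lin tree k" "(\<Sum>i\<in>I. inflow k i) = 0"
    "(\<Sum>j\<in>J. outflow k j) = 0"
    and g: "\<And>e. e \<notin> S \<Longrightarrow> g e = 0" "\<And>u. u \<in> {1..n} \<Longrightarrow> bd g u = dv k u"
  shows "\<exists>\<epsilon>>0. x + \<epsilon> *\<^sub>R k \<in> cell S"
proof -
  obtain c where c: "x \<in> \<P>" "positive x" "nonneg_on S c" "\<And>e. e \<in> S \<Longrightarrow> 0 < c e" "\<And>u. u \<in> {1..n} \<Longrightarrow> bd c u = dv x u"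
    using x unfolding full_def by blast
  obtain \<delta>1 where d1: "\<delta>1 > 0" "\<And>\<epsilon>. 0 \<le> \<epsilon> \<Longrightarrow> \<epsilon> \<le> \<delta>1 \<Longrightarrow> \<forall>e\<in>S. 0 \<le> c e + \<epsilon> * g e"
    using small_step[of S c g] forestD(3)[OF S] c(4) by auto
  obtain \<delta>2 where d2: "\<delta>2 > 0" "\<And>\<epsilon>. 0 \<le> \<epsilon> \<Longrightarrow> \<epsilon> \<le> \<delta>2 \<Longrightarrow> x + \<epsilon> *\<^sub>R k \<in> \<P>"
    using P_step[OF c(1,2) k] by auto
  define \<epsilon> where "\<epsilon> = min \<delta>1 \<delta>2"
  have e: "0 < \<epsilon>" "0 \<le> \<epsilon>" "\<epsilon> \<le> \<delta>1" "\<epsilon> \<le> \<delta>2" using d1(1) d2(1) by (auto simp: \<epsilon>_def)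
  have "x + \<epsilon> *\<^sub>R k \<in> cell S"
  proof (rule cellI)
    show "x + \<epsilon> *\<^sub>R k \<in> \<P>" by (rule d2(2)[OF e(2,4)])
    show "nonneg_on S (\<lambda>e. 1 * c e + \<epsilon> * g e)"
    proof (rule nonneg_onI)
      fix z
      show zero: "1 * c z + \<epsilon> * g z = 0" if "z \<notin> S" using g(1)[OF that] nonneg_onD(2)[OF c(3) that] by simp
      show "0 \<le> 1 * c z + \<epsilon> * g z"
        using d1(2)[OF e(2,3)] zero by (cases "z \<in> S") auto
    qed
    fix u assume u: "u \<in> {1..n}"
    have "dv (1 *\<^sub>R x + \<epsilon> *\<^sub>R k) u = 1 * dv x u + \<epsilon> * dv k u" by (rule dv_lincomb)
    then show "bd (\<lambda>e. 1 * c e + \<epsilon> * g e) u = dv (x + \<epsilon> *\<^sub>R k) u"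
      unfolding bd_lincomb c(5)[OF u] g(2)[OF u] by simp
  qed
  then show ?thesis using e(1) by blast
qed

lemma P_diff:
  assumes "x \<in> \<P>" "y \<in> \<P>"
  shows "lin tree (x - y)" "(\<Sum>i\<in>I. inflow (x - y) i) = 0"
    "(\<Sum>j\<in>J. outflow (x - y) j) = 0"
  using assms lin_lincomb[of tree x y 1 "-1"] unfolding P_iff unit_flow_def
  by (simp_all add: lookup_minus sum_subtractf)

lemma dv_diff: "dv (x - y) u = dv x u - dv y u"
  using dv_lincomb[of 1 x "-1" y u] by simp

lemma full_extend:
  assumes S: "forest S" and x: "full S x" and y: "y \<in> cell S"
  shows "\<exists>\<epsilon>>0. x + \<epsilon> *\<^sub>R (x - y) \<in> cell S"
proof -
  obtain c where c: "nonneg_on S c" "\<And>u. u \<in> {1..n} \<Longrightarrow> bd c u = dv x u" using full_cell[OF x] unfolding cell_def by blast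
  obtain d where d: "y \<in> \<P>" "nonneg_on S d" "\<And>u. u \<in> {1..n} \<Longrightarrow> bd d u = dv y u" using y unfolding cell_def by blast
  have x': "x \<in> \<P>" using x by (simp add: full_def)
  show ?thesis
  proof (rule full_step[OF S x P_diff[OF x' d(1)]])
    show "c e - d e = 0" if "e \<notin> S" for e using nonneg_onD(2)[OF c(1) that] nonneg_onD(2)[OF d(2) that] by simp
    show "bd (\<lambda>e. c e - d e) u = dv (x - y) u" if "u \<in> {1..n}" for u
      using c(2)[OF that] d(3)[OF that] by (simp add: bd_diff dv_diff)
  qed
qed


section \<open>Interior faces\<close>

text \<open>From \<open>x\<close> one can step a little away from any \<open>y\<close> without
  leaving the polytope, so a face through \<open>x\<close> contains every \<open>y\<close>.\<close>

lemma positive_notin_boundary: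
  assumes x: "x \<in> \<P>" "positive x"
  shows "x \<notin> polytope_boundary \<P>"
proof
  assume "x \<in> polytope_boundary \<P>"
  then obtain F where F: "F face_of \<P>" "F \<noteq> \<P>" "x \<in> F" unfolding polytope_boundary_def by blast
  have "y \<in> F" if y: "y \<in> \<P>" for y
  proof -
    obtain \<delta> where "\<delta> > 0" "x + \<delta> *\<^sub>R (x - y) \<in> \<P>"
      using P_step[OF x P_diff[OF x(1) y]] by auto
    then show ?thesis using face_contains_extension[OF F(1,3) y] by blast
  qed
  then show False using F(1,2) face_of_imp_subset by blast
qed

lemma lookup_zero_face:
  assumes nn: "\<And>x. x \<in> \<P> \<Longrightarrow> 0 \<le> Poly_Mapping.lookup x e"
  shows "{x \<in> \<P>. Poly_Mapping.lookup x e = 0} face_of \<P>"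
  unfolding face_of_def
proof (intro conjI ballI impI)
  show "convex {x \<in> \<P>. Poly_Mapping.lookup x e = 0}"
    using convexD[OF convex_P] by (auto intro!: convexI simp: lookup_add)
  fix a b x assume a: "a \<in> \<P>" and b: "b \<in> \<P>" and x: "x \<in> {x \<in> \<P>. Poly_Mapping.lookup x e = 0}"
    and seg: "x \<in> open_segment a b"
  obtain t where t: "0 < t" "t < 1" "x = (1 - t) *\<^sub>R a + t *\<^sub>R b" using seg by (auto simp: in_segment)
  have "(1 - t) * Poly_Mapping.lookup a e + t * Poly_Mapping.lookup b e = 0" using x t(3) by (simp add: lookup_add)
  moreover have "0 \<le> (1 - t) * Poly_Mapping.lookup a e" "0 \<le> t * Poly_Mapping.lookup b e"
    using nn[OF a] nn[OF b] t by auto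
  ultimately have "(1 - t) * Poly_Mapping.lookup a e = 0" "t * Poly_Mapping.lookup b e = 0" by linarith+
  then show "a \<in> {x \<in> \<P>. Poly_Mapping.lookup x e = 0}" "b \<in> {x \<in> \<P>. Poly_Mapping.lookup x e = 0}"
    using a b t by auto
qed auto

text \<open>A vanishing source or sink flow puts \<open>x\<close> on a coordinate face; the positive
  point \<open>z\<close> shows that this face is proper.\<close>

lemma not_positive_in_boundary:
  assumes x: "x \<in> \<P>" "\<not> positive x" and z: "z \<in> \<P>" "positive z"
  shows "x \<in> polytope_boundary \<P>"
proof -
  have "\<exists>e. Poly_Mapping.lookup x e = 0 \<and> Poly_Mapping.lookup z e \<noteq> 0 \<and> (\<forall>y\<in>\<P>. 0 \<le> Poly_Mapping.lookup y e)"
  proof -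
    have nn: "0 \<le> inflow y i" if "y \<in> \<P>" "i \<in> I" for y i
      using that unfolding P_iff unit_flow_def by blast
    have nn': "0 \<le> outflow y j" if "y \<in> \<P>" "j \<in> J" for y j
      using that unfolding P_iff unit_flow_def by blast
    from x(2) consider i where "i \<in> I" "\<not> 0 < inflow x i"
      | j where "j \<in> J" "\<not> 0 < outflow x j" unfolding positive_def by blast
    then show ?thesis
    proof cases
      case (1 i)
      have "inflow x i = 0" using 1 nn[OF x(1) 1(1)] by simp
      moreover have "0 < inflow z i" using z(2) 1(1) unfolding positive_def by blast
      ultimately show ?thesis using nn 1(1) by (intro exI[of _ "(0, i)"]) auto
    next
      case (2 j)
      have "outflow x j = 0" using 2 nn'[OF x(1) 2(1)] by simp
      moreover have "0 < outflow z j" using z(2) 2(1) unfolding positive_def by blast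
      ultimately show ?thesis using nn' 2(1) by (intro exI[of _ "(j, n + 1)"]) auto
    qed
  qed
  then obtain e where e: "Poly_Mapping.lookup x e = 0" "Poly_Mapping.lookup z e \<noteq> 0"
    "\<And>y. y \<in> \<P> \<Longrightarrow> 0 \<le> Poly_Mapping.lookup y e" by blast
  have "{y \<in> \<P>. Poly_Mapping.lookup y e = 0} face_of \<P>" by (rule lookup_zero_face) (rule e(3))
  moreover have "{y \<in> \<P>. Poly_Mapping.lookup y e = 0} \<noteq> \<P>" using z(1) e(2) by blast
  ultimately show ?thesis unfolding polytope_boundary_def using x(1) e(1) by blast
qed

text \<open>A vertex without arcs has boundary 0. If it is no valley, its supply is a single source
  or sink flow up to sign, and that is not 0 at a positive point.\<close>

lemma positive_covers:
  assumes x: "x \<in> \<P>" "positive x" and S: "S \<subseteq> I \<times> J"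
    and c: "\<And>e. e \<notin> S \<Longrightarrow> c e = 0" "\<And>u. u \<in> {1..n} \<Longrightarrow> bd c u = dv x u"
  shows "covers S"
  unfolding covers_def
proof (rule ballI, rule ccontr)
  fix a assume a: "a \<in> {1..n} - V" and no: "\<not> (\<exists>e\<in>S. a = fst e \<or> a = snd e)"
  have "bd c a = (\<Sum>e\<in>S. c e * (of_bool (fst e = a) - of_bool (snd e = a)))"
    by (rule bd_on[OF IJ_sub[OF S] c(1)])
  also have "\<dots> = 0" using no by (intro sum.neutral) auto
  finally have z: "dv x a = 0" using c(2)[of a] a by simp
  from a consider "a \<in> I - J" | "a \<in> J - I" by (rule nonvalley_cases)
  then show False
  proof cases
    case 1
    then have "0 < inflow x a" using x(2) unfolding positive_def by blast
    then show False using z 1 by (simp add: dv_def)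
  next
    case 2
    then have "0 < outflow x a" using x(2) unfolding positive_def by blast
    then show False using z 2 by (simp add: dv_def)
  qed
qed

text \<open>The face is the cell of the support of a positive point whose support is largest.\<close>

lemma face_is_cell:
  assumes H: "forest H" and F: "F face_of cell H" and x0: "x0 \<in> F" "positive x0"
  shows "\<exists>S\<subseteq>H. covers S \<and> F = cell S"
proof -
  define c where "c x = (SOME c. nonneg_on H c \<and> (\<forall>u\<in>{1..n}. bd c u = dv x u))" for x
  have c': "nonneg_on H (c x) \<and> (\<forall>u\<in>{1..n}. bd (c x) u = dv x u)" if "x \<in> cell H" for x
    using that someI_ex[of "\<lambda>c. nonneg_on H c \<and> (\<forall>u\<in>{1..n}. bd c u = dv x u)"]
    unfolding c_def cell_def by blast
  have c1: "nonneg_on H (c x)" if "x \<in> cell H" for x using c'[OF that] by blast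
  have c2: "bd (c x) u = dv x u" if "x \<in> cell H" "u \<in> {1..n}" for x u using c'[OF that(1)] that(2) by blast
  note c = c1 c2
  define supp where "supp x = {e \<in> H. 0 < c x e}" for x
  have FH: "F \<subseteq> cell H" using F by (rule face_of_imp_subset)
  have "\<exists>x. (x \<in> F \<and> positive x) \<and> (\<forall>y. y \<in> F \<and> positive y \<longrightarrow> card (supp y) \<le> card (supp x))"
  proof (rule ex_has_greatest_nat[of "\<lambda>y. y \<in> F \<and> positive y" x0 "\<lambda>y. card (supp y)" "Suc (card H)"])
    show "x0 \<in> F \<and> positive x0" using x0 by blast
    show "\<forall>y. y \<in> F \<and> positive y \<longrightarrow> card (supp y) < Suc (card H)"
      using forestD(3)[OF H] by (auto intro!: card_mono simp: supp_def less_Suc_eq_le)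
  qed
  then obtain x where x: "x \<in> F" "positive x" "\<And>y. y \<in> F \<Longrightarrow> positive y \<Longrightarrow> card (supp y) \<le> card (supp x)"
    by blast
  define S where "S = supp x"
  have S: "S \<subseteq> H" by (auto simp: S_def supp_def)
  have forS: "forest S" using forest_mono[OF H S] .
  have xH: "x \<in> cell H" using x FH by blast
  then have xP: "x \<in> \<P>" unfolding cell_def by blast
  have cx0: "c x e = 0" if "e \<notin> S" for e
    using that nonneg_onD[OF c(1)[OF xH], of e] unfolding S_def supp_def by force
  have nnS: "nonneg_on S (c x)" using nonneg_onD(1)[OF c(1)[OF xH]] cx0 by (intro nonneg_onI)
  have full: "full S x"
    unfolding full_def using xP x(2) nnS c(2)[OF xH] by (auto simp: S_def supp_def)
  have "covers S" by (rule positive_covers[OF xP x(2) forestD(1)[OF forS] cx0 c(2)[OF xH]])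
  moreover have "F = cell S"
  proof (intro subset_antisym subsetI)
    fix y assume y: "y \<in> cell S"
    obtain \<epsilon> where "\<epsilon> > 0" "x + \<epsilon> *\<^sub>R (x - y) \<in> cell S" using full_extend[OF forS full y] by blast
    moreover have "cell S \<subseteq> cell H" using cell_face_of[OF H S] by (rule face_of_imp_subset)
    ultimately show "y \<in> F" using face_contains_extension[OF F x(1)] y by blast
  next
    fix y assume yF: "y \<in> F"
    then have yH: "y \<in> cell H" using FH by blast
    then have yP: "y \<in> \<P>" unfolding cell_def by blast
    \<comment> \<open>The support of the midpoint contains those of \<open>x\<close> and
      \<open>y\<close>; maximality of the support of \<open>x\<close> then confines that of
      \<open>y\<close>.\<close>
    define z where "z = (1/2) *\<^sub>R x + (1/2) *\<^sub>R y"
    have zF: "z \<in> F" unfolding z_def using face_of_imp_convex[OF F] x(1) yF by (intro convexD) auto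
    then have zH: "z \<in> cell H" using FH by blast
    have cz: "(\<lambda>e. 1/2 * c x e + 1/2 * c y e) = c z"
    proof (rule forest_unique_nonneg[OF H nonneg_on_lincomb[OF c(1)[OF xH] c(1)[OF yH]] c(1)[OF zH]])
      show "bd (\<lambda>e. 1/2 * c x e + 1/2 * c y e) u = bd (c z) u" if "u \<in> {1..n}" for u
        unfolding bd_lincomb c(2)[OF xH that] c(2)[OF yH that] c(2)[OF zH that] by (simp only: z_def dv_lincomb)
    qed simp_all
    have "positive z"
      using x(2) yP unfolding z_def positive_def P_iff unit_flow_def
      by (auto simp: lookup_add add_pos_nonneg)
    then have card: "card (supp z) \<le> card (supp x)" using x(3) zF by blast
    have supz: "supp x \<subseteq> supp z" "supp y \<subseteq> supp z"
      using nonneg_onD(1)[OF c(1)[OF xH]] nonneg_onD(1)[OF c(1)[OF yH]] fun_cong[OF cz]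
      by (auto simp: supp_def simp flip: cz intro: add_pos_nonneg add_nonneg_pos)
    have "supp z \<subseteq> H" by (auto simp: supp_def)
    then have "finite (supp z)" using forestD(3)[OF H] finite_subset by blast
    then have "supp x = supp z" using card_seteq supz(1) card by blast
    then have "supp y \<subseteq> S" using supz by (simp add: S_def)
    then have "c y e = 0" if "e \<notin> S" for e
      using that nonneg_onD[OF c(1)[OF yH], of e] unfolding supp_def by force
    then have "nonneg_on S (c y)" using nonneg_onD(1)[OF c(1)[OF yH]] by (intro nonneg_onI)
    then show "y \<in> cell S" using cellI yP c(2)[OF yH] by blast
  qed
  ultimately show ?thesis using S by blast
qed

lemma faces_forest:
  assumes "tree_fan \<T>" "S \<in> faces \<T>"
  shows "forest S" "covers S"
proof -
  obtain H where H: "H \<in> \<T>" "S \<subseteq> H" and cov: "covers S" using assms(2) unfolding faces_def by blast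
  from forest_mono[OF tree_fan_forest[OF assms(1) H(1)] H(2)] cov show "forest S" "covers S" by blast+
qed

lemma trees_subset_faces: "tree_fan \<T> \<Longrightarrow> \<T> \<subseteq> faces \<T>"
  unfolding faces_def using tree_fanD(4) by blast

theorem interior_faces_fan:
  assumes fan: "tree_fan \<T>"
  shows "interior_faces \<P> (cell ` \<T>) = cell ` faces \<T>"
proof (intro subset_antisym subsetI)
  fix F assume "F \<in> interior_faces \<P> (cell ` \<T>)"
  then obtain H where H: "H \<in> \<T>" "F face_of cell H" "\<not> F \<subseteq> polytope_boundary \<P>"
    unfolding interior_faces_def by blast
  have "F \<subseteq> \<P>" using face_of_imp_subset[OF H(2)] unfolding cell_def by blast
  obtain z where z: "z \<in> \<P>" "positive z"
    using full_exists[OF tree_fan_forest[OF fan H(1)] tree_fanD(4)[OF fan H(1)]] unfolding full_def by blast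
  obtain x0 where "x0 \<in> F" "positive x0"
    using H(3) not_positive_in_boundary[OF _ _ z] \<open>F \<subseteq> \<P>\<close> by blast
  then show "F \<in> cell ` faces \<T>"
    using face_is_cell[OF tree_fan_forest[OF fan H(1)] H(2)] H(1) unfolding faces_def by blast
next
  fix F assume "F \<in> cell ` faces \<T>"
  then obtain S H where S: "S \<in> faces \<T>" "F = cell S" "H \<in> \<T>" "S \<subseteq> H" unfolding faces_def by blast
  have "F face_of cell H" unfolding S(2) by (rule cell_face_of[OF tree_fan_forest[OF fan S(3)] S(4)])
  moreover obtain x where x: "full S x" using full_exists[OF faces_forest[OF fan S(1)]] by blast
  then have "x \<in> F" "x \<notin> polytope_boundary \<P>"
    using full_cell positive_notin_boundary S(2) unfolding full_def by blast+
  ultimately show "F \<in> interior_faces \<P> (cell ` \<T>)" unfolding interior_faces_def using S(3) by blast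
qed

text \<open>The coefficients of a full point of \<open>cell S\<close> have support \<open>S\<close>
  and are unique across the fan, so the cell determines \<open>S\<close>.\<close>

lemma cell_inj:
  assumes fan: "tree_fan \<T>"
  shows "inj_on cell (faces \<T>)"
proof (rule inj_onI)
  have sub: "S \<subseteq> S'" if S: "S \<in> faces \<T>" "S' \<in> faces \<T>" "cell S = cell S'" for S S'
  proof -
    obtain H H' where H: "H \<in> \<T>" "S \<subseteq> H" "H' \<in> \<T>" "S' \<subseteq> H'" using S unfolding faces_def by blast
    obtain x where x: "full S x" using full_exists[OF faces_forest[OF fan S(1)]] by blast
    then obtain c where c: "nonneg_on S c" "\<And>e. e \<in> S \<Longrightarrow> 0 < c e" "\<And>u. u \<in> {1..n} \<Longrightarrow> bd c u = dv x u"
      unfolding full_def by blast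
    have "x \<in> cell S'" using full_cell[OF x] S(3) by simp
    then obtain c' where c': "nonneg_on S' c'" "\<And>u. u \<in> {1..n} \<Longrightarrow> bd c' u = dv x u" unfolding cell_def by blast
    have "c = c'"
      using c(3) c'(2) by (intro tree_fan_unique[OF fan H(1,3) nonneg_on_mono[OF c(1) H(2)] nonneg_on_mono[OF c'(1) H(4)]]) simp
    then show "S \<subseteq> S'" using c(2) nonneg_onD(2)[OF c'(1)] by (metis less_irrefl subsetI)
  qed
  fix S S' assume "S \<in> faces \<T>" "S' \<in> faces \<T>" "cell S = cell S'"
  then show "S = S'" using sub[of S S'] sub[of S' S] by auto
qed

section \<open>Dimensions\<close>

text \<open>The direction space of \<open>cell S\<close> when \<open>S\<close> is a covering forest,
  see \<open>span_cell\<close>: nonnegativity is dropped and both totals are zero.\<close>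

definition tangent :: "(nat \<times> nat) set \<Rightarrow> flow set" where
  "tangent S = {k. lin tree k \<and> (\<Sum>i\<in>I. inflow k i) = 0 \<and>
     (\<Sum>j\<in>J. outflow k j) = 0 \<and>
     (\<exists>c. (\<forall>e. e \<notin> S \<longrightarrow> c e = 0) \<and> (\<forall>u\<in>{1..n}. bd c u = dv k u))}"

lemma tangent_lincomb:
  assumes "x \<in> tangent S" "y \<in> tangent S"
  shows "s *\<^sub>R x + t *\<^sub>R y \<in> tangent S"
proof -
  obtain c d where c: "\<forall>e. e \<notin> S \<longrightarrow> c e = 0" "\<forall>u\<in>{1..n}. bd c u = dv x u"
    and d: "\<forall>e. e \<notin> S \<longrightarrow> d e = 0" "\<forall>u\<in>{1..n}. bd d u = dv y u"
    using assms unfolding tangent_def by blast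
  have "\<exists>c. (\<forall>e. e \<notin> S \<longrightarrow> c e = 0) \<and> (\<forall>u\<in>{1..n}. bd c u = dv (s *\<^sub>R x + t *\<^sub>R y) u)"
  proof (intro exI[of _ "\<lambda>e. s * c e + t * d e"] conjI ballI allI impI)
    fix e assume "e \<notin> S" then show "s * c e + t * d e = 0" using spec[OF c(1), of e] spec[OF d(1), of e] by simp
  next
    fix u assume "u \<in> {1..n}"
    then show "bd (\<lambda>e. s * c e + t * d e) u = dv (s *\<^sub>R x + t *\<^sub>R y) u"
      using c(2) d(2) by (simp add: bd_lincomb dv_lincomb)
  qed
  then show ?thesis
    using assms lin_lincomb[of tree x y s t] unfolding tangent_def
    by (simp add: lookup_add sum.distrib flip: sum_distrib_left)
qed

lemma subspace_tangent: "subspace (tangent S)"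
proof (rule subspaceI)
  have "lin tree 0" by (simp add: lin_def ch_def[abs_def] dv_def flow_along_def bd_zero cong: if_cong)
  then show "0 \<in> tangent S" unfolding tangent_def by (auto simp: dv_def intro!: exI[of _ "\<lambda>_. 0"] bd_zero)
  show "x + y \<in> tangent S" if "x \<in> tangent S" "y \<in> tangent S" for x y
    using tangent_lincomb[OF that, of 1 1] by simp
  show "r *\<^sub>R x \<in> tangent S" if "x \<in> tangent S" for x r
    using tangent_lincomb[OF that that, of r 0] by simp
qed

lemma cell_diff_tangent:
  assumes "x \<in> cell S" "y \<in> cell S"
  shows "x - y \<in> tangent S"
proof -
  obtain c where c: "x \<in> \<P>" "nonneg_on S c" "\<And>u. u \<in> {1..n} \<Longrightarrow> bd c u = dv x u" using assms(1) unfolding cell_def by blast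
  obtain d where d: "y \<in> \<P>" "nonneg_on S d" "\<And>u. u \<in> {1..n} \<Longrightarrow> bd d u = dv y u" using assms(2) unfolding cell_def by blast
  have "\<exists>c. (\<forall>e. e \<notin> S \<longrightarrow> c e = 0) \<and> (\<forall>u\<in>{1..n}. bd c u = dv (x - y) u)"
    using nonneg_onD(2)[OF c(2)] nonneg_onD(2)[OF d(2)] c(3) d(3)
    by (intro exI[of _ "\<lambda>e. c e - d e"]) (auto simp: bd_diff dv_diff)
  then show ?thesis unfolding tangent_def using P_diff[OF c(1) d(1)] by blast
qed

text \<open>Differences of points are tangent. Conversely a small step from a full point along a
  tangent vector stays in the cell.\<close>

lemma span_cell:
  assumes S: "forest S" "covers S"
  shows "span {x - y | x y. x \<in> cell S \<and> y \<in> cell S} = tangent S"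
proof (intro subset_antisym)
  show "span {x - y | x y. x \<in> cell S \<and> y \<in> cell S} \<subseteq> tangent S"
  proof (rule span_minimal[OF _ subspace_tangent], clarify)
    show "x - y \<in> tangent S" if "x \<in> cell S" "y \<in> cell S" for x y
      using that by (rule cell_diff_tangent)
  qed
  show "tangent S \<subseteq> span {x - y | x y. x \<in> cell S \<and> y \<in> cell S}"
  proof
    fix k assume "k \<in> tangent S"
    then obtain c where k: "lin tree k" "(\<Sum>i\<in>I. inflow k i) = 0"
      "(\<Sum>j\<in>J. outflow k j) = 0"
      and c: "\<And>e. e \<notin> S \<Longrightarrow> c e = 0" "\<And>u. u \<in> {1..n} \<Longrightarrow> bd c u = dv k u" unfolding tangent_def by blast
    obtain x where x: "full S x" using full_exists[OF S] by blast
    obtain \<epsilon> where e: "\<epsilon> > 0" "x + \<epsilon> *\<^sub>R k \<in> cell S" using full_step[OF S(1) x k c] by blast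
    have "(x + \<epsilon> *\<^sub>R k) - x \<in> {x - y | x y. x \<in> cell S \<and> y \<in> cell S}" using e(2) full_cell[OF x] by blast
    then have "(1 / \<epsilon>) *\<^sub>R ((x + \<epsilon> *\<^sub>R k) - x) \<in> span {x - y | x y. x \<in> cell S \<and> y \<in> cell S}"
      by (intro span_scale span_base)
    then show "k \<in> span {x - y | x y. x \<in> cell S \<and> y \<in> cell S}" using e(1) by simp
  qed
qed

lemma pdim_cell: "forest S \<Longrightarrow> covers S \<Longrightarrow> pdim (cell S) = dim (tangent S)"
  unfolding pdim_def
  using span_cell[of S] real_vector.dim_span[of "{x - y | x y. x \<in> cell S \<and> y \<in> cell S}"] by simp

text \<open>Differences of points of the polytope have supplies with sum zero, and a single tree of
  the fan already represents all of these.\<close>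

lemma pdim_P:
  assumes fan: "tree_fan \<T>" and H: "H \<in> \<T>"
  shows "pdim \<P> = dim (tangent H)"
proof -
  have sub: "{x - y | x y. x \<in> \<P> \<and> y \<in> \<P>} \<subseteq> tangent H"
  proof clarify
    fix x y assume "x \<in> \<P>" "y \<in> \<P>"
    note d = P_diff[OF this]
    obtain c where "\<forall>e. e \<notin> H \<longrightarrow> c e = 0" "\<forall>u\<in>{1..n}. bd c u = dv (x - y) u"
      using tree_fan_span[OF fan H lin_sum_dv[OF d(1)]] by blast
    then show "x - y \<in> tangent H"
      unfolding tangent_def mem_Collect_eq using d by (intro conjI exI[of _ c])
  qed
  have "tangent H = span {x - y | x y. x \<in> cell H \<and> y \<in> cell H}"
    by (rule span_cell[OF tree_fan_forest[OF fan H] tree_fanD(4)[OF fan H], symmetric])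
  also have "\<dots> \<subseteq> span {x - y | x y. x \<in> \<P> \<and> y \<in> \<P>}"
    by (rule span_mono) (auto simp: cell_def)
  finally have "span {x - y | x y. x \<in> \<P> \<and> y \<in> \<P>} = tangent H"
    using span_minimal[OF sub subspace_tangent] by blast
  then show ?thesis
    using real_vector.dim_span[of "{x - y | x y. x \<in> \<P> \<and> y \<in> \<P>}"] unfolding pdim_def by simp
qed

text \<open>The type of flows has infinite dimension, so the finiteness used in counting basis
  vectors has to come from the finitely many coordinates of the tree.\<close>

lemma tangent_finite_dim:
  assumes "independent B" "B \<subseteq> tangent S"
  shows "finite B"
proof -
  let ?K = "tree \<union> src \<union> snk"
  have fin: "finite ?K" using simple_finite[OF simple_tree] by simp
  have "x \<in> span ((\<lambda>e. Poly_Mapping.single e 1) ` ?K)" if "x \<in> B" for x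
  proof -
    have "Poly_Mapping.keys x \<subseteq> ?K" using that assms(2) unfolding tangent_def lin_def upair_tree by blast
    then have "x = (\<Sum>e\<in>?K. Poly_Mapping.lookup x e *\<^sub>R Poly_Mapping.single e 1)"
      using fin by (intro poly_mapping_eqI) (auto simp: lookup_sum lookup_single when_def in_keys_iff if_distrib cong: if_cong)
    moreover have "\<dots> \<in> span ((\<lambda>e. Poly_Mapping.single e 1) ` ?K)"
      by (intro span_sum span_scale span_base) auto
    ultimately show ?thesis by simp
  qed
  then have "B \<subseteq> span ((\<lambda>e. Poly_Mapping.single e (1::real)) ` ?K)" by blast
  then show ?thesis
    using real_vector.independent_span_bound[OF finite_imageI[OF fin] assms(1)] by simp
qed

text \<open>The new arc contributes one direction \<open>k\<close>. It is not tangent to the smaller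
  forest by uniqueness of coefficients, and subtracting a multiple of \<open>k\<close> empties the
  new arc.\<close>

lemma dim_tangent_insert:
  assumes S: "forest (insert e S)" and e: "e \<notin> S"
  shows "dim (tangent (insert e S)) = Suc (dim (tangent S))"
proof -
  obtain a b where ab: "e = (a, b)" "a \<in> I" "b \<in> J" using forestD(1)[OF S] by blast
  have ab_n: "a \<in> {1..n}" "b \<in> {1..n}" using ab I_sub J_sub by blast+
  obtain z where z: "z \<in> I" "z \<in> J" using valley_in[of 1] w_ge_1 by auto
  \<comment> \<open>A valley \<open>z\<close> absorbs one unit at the source and one at the sink:
    both totals become zero and the supplies are e_a - e_b. No arc flows are needed, since
    \<open>lift\<close> computes them.\<close>
  define y where "y = mk {} (\<lambda>u. of_bool (a = u) - of_bool (z = u)) (\<lambda>u. of_bool (b = u) - of_bool (z = u)) (\<lambda>_. 0)"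
  have simple: "simple {}" by (simp add: simple_def)
  have dvy: "dv y u = of_bool (a = u) - of_bool (b = u)" for u
    unfolding y_def dv_mk[OF simple] using ab z by (auto simp: of_bool_def)
  have "(\<Sum>u\<in>{1..n}. dv y u) = 0" unfolding dvy using ab_n by (simp add: sum_subtractf of_bool_def)
  then have lin: "lin tree (lift y)" by (rule lin_lift)
  have bd1: "bd (\<lambda>x. of_bool (x = e)) u = dv (lift y) u" for u
    unfolding dv_lift dvy ab(1) by (rule bd_single[OF ab_n])
  define k where "k = lift y"
  have "(\<Sum>i\<in>I. inflow k i) = 0"
  proof -
    have "(\<Sum>i\<in>I. inflow k i) = (\<Sum>i\<in>I. of_bool (a = i) - of_bool (z = i))"
      unfolding k_def y_def by (rule sum.cong[OF refl]) (simp only: lookup_lift_src lookup_mk_src[OF simple])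
    also have "\<dots> = 0" using ab z by (simp add: sum_subtractf of_bool_def)
    finally show ?thesis .
  qed
  moreover have "(\<Sum>j\<in>J. outflow k j) = 0"
    using calculation lin_sum_dv[OF lin] sum_dv[of k] unfolding k_def by linarith
  ultimately have k: "k \<in> tangent (insert e S)"
    unfolding tangent_def mem_Collect_eq using lin bd1 unfolding k_def[symmetric]
    by (intro conjI exI[of _ "\<lambda>x. of_bool (x = e)"]) auto
  have k_notin: "k \<notin> tangent S"
  proof
    assume "k \<in> tangent S"
    then obtain c where c: "\<forall>e. e \<notin> S \<longrightarrow> c e = 0" "\<forall>u\<in>{1..n}. bd c u = dv k u" unfolding tangent_def by blast
    have "c = (\<lambda>x. of_bool (x = e))"
    proof (rule forest_unique[OF S])
      show "bd c u = bd (\<lambda>x. of_bool (x = e)) u" if "u \<in> {1..n}" for u using c(2) that bd1 by (simp add: k_def)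
    qed (use c(1) in auto)
    then have "c e = 1" by simp
    then show False using spec[OF c(1), of e] e by simp
  qed
  have mono: "tangent S \<subseteq> tangent (insert e S)" unfolding tangent_def by blast
  have span: "tangent (insert e S) \<subseteq> span (insert k (tangent S))"
  proof
    fix x assume x: "x \<in> tangent (insert e S)"
    then obtain c where c: "\<forall>e'. e' \<notin> insert e S \<longrightarrow> c e' = 0" "\<forall>u\<in>{1..n}. bd c u = dv x u" unfolding tangent_def by blast
    have diff: "x - c e *\<^sub>R k = 1 *\<^sub>R x + (- c e) *\<^sub>R k" by simp
    have "x - c e *\<^sub>R k \<in> tangent (insert e S)" unfolding diff by (rule tangent_lincomb[OF x k])
    moreover have "\<exists>d. (\<forall>e'. e' \<notin> S \<longrightarrow> d e' = 0) \<and> (\<forall>u\<in>{1..n}. bd d u = dv (x - c e *\<^sub>R k) u)"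
    proof (intro exI[of _ "\<lambda>e'. 1 * c e' + (- c e) * of_bool (e' = e)"] conjI ballI allI impI)
      show "1 * c e' + (- c e) * of_bool (e' = e) = 0" if "e' \<notin> S" for e'
        using spec[OF c(1), of e'] that by (cases "e' = e") auto
      show "bd (\<lambda>e'. 1 * c e' + (- c e) * of_bool (e' = e)) u = dv (x - c e *\<^sub>R k) u" if "u \<in> {1..n}" for u
        unfolding diff bd_lincomb dv_lincomb using c(2) that bd1 by (simp add: k_def)
    qed
    ultimately have "x - c e *\<^sub>R k \<in> tangent S" unfolding tangent_def by blast
    then show "x \<in> span (insert k (tangent S))" unfolding span_insert by (auto intro: span_base)
  qed
  obtain B where B: "B \<subseteq> tangent S" "independent B" "tangent S \<subseteq> span B" "card B = dim (tangent S)"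
    by (rule basis_exists)
  have spanB: "span B = tangent S"
    using B(3) span_minimal[OF B(1) subspace_tangent] by blast
  have fin: "finite B" by (rule tangent_finite_dim[OF B(2,1)])
  have "dim (tangent (insert e S)) = card (insert k B)"
  proof (rule dim_unique[OF _ _ _ refl])
    show "insert k B \<subseteq> tangent (insert e S)" using k B(1) mono by blast
    show "tangent (insert e S) \<subseteq> span (insert k B)"
      using span unfolding span_insert spanB by (simp add: span_eq_iff[THEN iffD2, OF subspace_tangent])
    show "independent (insert k B)" using B(2) k_notin by (simp add: independent_insert spanB)
  qed
  moreover have "k \<notin> B" using B(1) k_notin by blast
  ultimately show ?thesis using fin B(4) by simp
qed

lemma dim_tangent_diff:
  assumes "forest H" "S \<subseteq> H"
  shows "dim (tangent H) = dim (tangent S) + card (H - S)"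
proof -
  have "finite R \<Longrightarrow> forest (S \<union> R) \<Longrightarrow> R \<inter> S = {} \<Longrightarrow> dim (tangent (S \<union> R)) = dim (tangent S) + card R" for R
  proof (induction R rule: finite_induct)
    case (insert e R)
    then have "forest (S \<union> R)" using forest_mono by blast
    then show ?case using insert dim_tangent_insert[of e "S \<union> R"] by simp
  qed simp
  from this[of "H - S"] show ?thesis
    using assms forestD(3)[OF assms(1)] by (simp add: Un_absorb1 Diff_Int_distrib2)
qed

lemma codim_cell:
  assumes fan: "tree_fan \<T>" and S: "S \<in> faces \<T>"
  shows "pdim \<P> - pdim (cell S) = n - 1 - card S"
proof -
  obtain H where H: "H \<in> \<T>" "S \<subseteq> H" using S unfolding faces_def by blast
  have for_H: "forest H" by (rule tree_fan_forest[OF fan H(1)])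
  have "card (H - S) = n - 1 - card S"
    using H(2) forestD(3)[OF for_H] tree_fanD(6)[OF fan H(1)] by (simp add: card_Diff_subset finite_subset)
  then show ?thesis
    using pdim_P[OF fan H(1)] pdim_cell[OF faces_forest[OF fan S]] dim_tangent_diff[OF for_H H(2)] by simp
qed

end

section \<open>Routes\<close>

lemma path_steps_Cons: "path_steps (x # y # ys) = insert (x, y) (path_steps (y # ys))"
  and path_steps_single: "path_steps [x] = {}"
  by (simp_all add: path_steps_def)

lemma finite_path_steps [simp]: "finite (path_steps r)"
  by (simp add: path_steps_def)

lemma path_steps_set: "(p, q) \<in> path_steps r \<Longrightarrow> p \<in> set r \<and> q \<in> set (tl r)"
  unfolding path_steps_def by (auto dest: set_zip_leftD set_zip_rightD)

lemma path_steps_snoc: "xs \<noteq> [] \<Longrightarrow> path_steps (xs @ [z]) = insert (last xs, z) (path_steps xs)"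
proof (induction xs)
  case (Cons x xs)
  then show ?case by (cases xs) (auto simp: path_steps_Cons path_steps_single)
qed simp

lemma path_steps_prefix: "path_steps xs \<subseteq> path_steps (xs @ ys)"
proof (induction xs)
  case (Cons x xs)
  then show ?case by (cases xs) (auto simp: path_steps_Cons path_steps_single)
qed (simp add: path_steps_def)

lemma set_path_steps: "xs \<noteq> [] \<Longrightarrow> set xs \<subseteq> insert (hd xs) (snd ` path_steps xs)"
proof (induction xs)
  case (Cons x xs)
  then show ?case by (cases xs) (auto simp: path_steps_Cons path_steps_single)
qed simp

lemma path_steps_irrefl:
  assumes "distinct r"
  shows "(p, p) \<notin> path_steps r" "(p, q) \<in> path_steps r \<Longrightarrow> (q, p) \<notin> path_steps r"
proof -
  have "(p, q) \<in> path_steps r \<longrightarrow> p \<noteq> q \<and> (q, p) \<notin> path_steps r" for p q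
    using assms
  proof (induction r)
    case (Cons x r)
    show ?case
    proof (cases r)
      case Nil
      then show ?thesis by (simp add: path_steps_single)
    next
      case r: (Cons y ys)
      show ?thesis
        using Cons path_steps_set[of p q r] path_steps_set[of q p r] unfolding r path_steps_Cons by auto
    qed
  qed (simp add: path_steps_def)
  then show "(p, p) \<notin> path_steps r" "(p, q) \<in> path_steps r \<Longrightarrow> (q, p) \<notin> path_steps r" by blast+
qed

text \<open>Distinctness of the vertices ensures that the set \<open>path_steps r\<close> counts
  every step once.\<close>

lemma path_steps_telescope:
  fixes \<phi> :: "nat \<Rightarrow> real"
  assumes "distinct r" "r \<noteq> []"
  shows "(\<Sum>e\<in>path_steps r. \<phi> (fst e) - \<phi> (snd e)) = \<phi> (hd r) - \<phi> (last r)"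
  using assms
proof (induction r)
  case (Cons x r)
  show ?case
  proof (cases r)
    case Nil
    then show ?thesis by (simp add: path_steps_single)
  next
    case r: (Cons y ys)
    have "(x, y) \<notin> path_steps r" using path_steps_set[of x y r] Cons.prems by auto
    then show ?thesis using Cons unfolding r path_steps_Cons by simp
  qed
qed simp

text \<open>Loop erasure: when the next vertex has been visited before, the list is cut back to that
  visit. Routes have distinct vertices.\<close>

lemma simple_path:
  assumes "(a, b) \<in> R\<^sup>*"
  shows "\<exists>xs. xs \<noteq> [] \<and> distinct xs \<and> hd xs = a \<and> last xs = b \<and> path_steps xs \<subseteq> R"
  using assms
proof induction
  case base
  show ?case by (intro exI[of _ "[a]"]) (simp add: path_steps_single)
next
  case (step y z)
  then obtain xs where xs: "xs \<noteq> []" "distinct xs" "hd xs = a" "last xs = y" "path_steps xs \<subseteq> R" by blast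
  show ?case
  proof (cases "z \<in> set xs")
    case True
    then obtain ys zs where "xs = ys @ z # zs" by (meson split_list)
    then have eq: "xs = (ys @ [z]) @ zs" by simp
    have "path_steps (ys @ [z]) \<subseteq> R" using path_steps_prefix[of "ys @ [z]" zs] xs(5) eq by simp
    moreover have "hd (ys @ [z]) = a" using xs(3) eq by (cases ys) auto
    moreover have "distinct (ys @ [z])" using xs(2) eq by auto
    ultimately show ?thesis by (intro exI[of _ "ys @ [z]"]) simp
  next
    case False
    have "path_steps (xs @ [z]) \<subseteq> R"
      unfolding path_steps_snoc[OF xs(1)] using xs(4,5) step.hyps(2) by simp
    then show ?thesis using False xs by (intro exI[of _ "xs @ [z]"]) simp
  qed
qed

lemma lookup_signed_char_vec:
  assumes r: "distinct r"
  shows "Poly_Mapping.lookup (signed_char_vec r) (a, b) =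
    of_bool (a < b \<and> (a, b) \<in> path_steps r) - of_bool (a < b \<and> (b, a) \<in> path_steps r)"
proof -
  have "Poly_Mapping.lookup (signed_char_vec r) (a, b) =
      (\<Sum>e\<in>path_steps r. (if e = (a, b) then of_bool (a < b) else 0) - (if e = (b, a) then of_bool (a < b) else 0))"
    unfolding signed_char_vec_def lookup_sum
  proof (rule sum.cong[OF refl])
    fix e assume "e \<in> path_steps r"
    obtain x y where e: "e = (x, y)" by fastforce
    have "x \<noteq> y" using path_steps_irrefl(1)[OF r] \<open>e \<in> path_steps r\<close> e by blast
    then show "Poly_Mapping.lookup (case e of (p, q) \<Rightarrow> if p < q then Poly_Mapping.single (p, q) 1
          else Poly_Mapping.single (q, p) (- 1)) (a, b) =
        (if e = (a, b) then of_bool (a < b) else (0::real)) - (if e = (b, a) then of_bool (a < b) else 0)"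
      by (auto simp: e lookup_single when_def)
  qed
  also have "\<dots> = of_bool (a < b \<and> (a, b) \<in> path_steps r) - of_bool (a < b \<and> (b, a) \<in> path_steps r)"
    by (auto simp: sum_subtractf)
  finally show ?thesis .
qed

lemma unit_vector:
  fixes f :: "nat \<Rightarrow> real"
  assumes "finite A" "\<And>a. a \<in> A \<Longrightarrow> 0 \<le> f a" "\<And>a. a \<in> A \<Longrightarrow> f a \<in> \<int>" "sum f A = 1"
  shows "\<exists>a\<in>A. \<forall>b\<in>A. f b = of_bool (b = a)"
proof -
  have "\<exists>a\<in>A. f a \<noteq> 0" using assms(4) by (metis sum.neutral zero_neq_one)
  then obtain a where a: "a \<in> A" "f a \<noteq> 0" by blast
  obtain m where m: "f a = of_int m" using assms(3)[OF a(1)] by (rule Ints_cases)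
  have "1 \<le> f a" using m a assms(2)[OF a(1)] by simp
  moreover have "sum f A = f a + sum f (A - {a})" using assms(1) a(1) by (rule sum.remove)
  moreover have nn: "0 \<le> sum f (A - {a})" using assms(2) by (intro sum_nonneg) auto
  ultimately have fa: "f a = 1" and z: "sum f (A - {a}) = 0" using assms(4) by linarith+
  have "f b = 0" if "b \<in> A - {a}" for b
    using sum_nonneg_0[of "A - {a}" f b] z that assms(1,2) by auto
  then show ?thesis using a(1) fa by (intro bexI[of _ a]) auto
qed

context valley_path begin

section \<open>Routes as lattice points, and the cells \<open>Q_cell\<close>\<close>

lemma traversable_GB:
  "traversable (GB_path \<nu>) p q \<longleftrightarrow> (p, q) \<in> tree \<or> (q, p) \<in> cyc ` {1..<w}"
  unfolding traversable_def edges_GB_Fwd edges_GB_Bidir using edges_GB_Bwd tree_less[of p q] tree_less[of q p]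
  by (auto simp: tree_def)

lemma traversable_aug_GB:
  "traversable (partial_aug \<nu> (GB_path \<nu>)) p q \<longleftrightarrow>
    (p, q) \<in> tree \<union> src \<union> snk \<or> (q, p) \<in> cyc ` {1..<w}"
proof -
  have F: "(a, b, Fwd) \<in> edges (partial_aug \<nu> (GB_path \<nu>)) \<longleftrightarrow> (a, b) \<in> Leaves \<union> src \<union> snk" for a b
    using edges_GB_Fwd by (auto simp: partial_aug_def)
  have B: "(a, b, Bidir) \<in> edges (partial_aug \<nu> (GB_path \<nu>)) \<longleftrightarrow> (a, b) \<in> cyc ` {1..<w}" for a b
    using edges_GB_Bidir by (auto simp: partial_aug_def)
  have W: "(a, b, Bwd) \<notin> edges (partial_aug \<nu> (GB_path \<nu>))" for a b
    using edges_GB_Bwd by (auto simp: partial_aug_def)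
  have less: "(a, b) \<in> tree \<union> src \<union> snk \<Longrightarrow> a < b" for a b
    using tree_less[of a b] I_sub J_sub by auto
  show ?thesis
    unfolding traversable_def F B using W less[of p q] less[of q p] by (auto simp: tree_def)
qed

lemma Min_Max_aug: "Min (verts (partial_aug \<nu> H)) = 0" "Max (verts (partial_aug \<nu> H)) = n + 1"
  by (auto simp: partial_aug_def intro: Max_eqI Min_eqI)

lemma P_balanced:
  assumes "x \<in> \<P>"
  shows "balanced (dv x)"
proof -
  have x: "unit_flow x" using assms by (simp add: P_iff)
  then have "\<forall>i\<in>I. 0 \<le> inflow x i" "\<forall>j\<in>J. 0 \<le> outflow x j"
    unfolding unit_flow_def by blast+
  then show ?thesis unfolding balanced_def unit_flow_sum_dv[OF x] by (auto simp: dv_def)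
qed

lemma cutf_P:
  assumes x: "x \<in> \<P>" and k: "k \<in> {1..<w}"
  shows "cutf (dv x) k = Poly_Mapping.lookup x (cyc k)"
proof -
  have "lin tree x" using x by (simp add: P_iff)
  then have "cutf (dv x) k = cutf (bd (ch tree x)) k"
    unfolding cutf_def lin_def by simp
  also have "\<dots> = ch tree x (cyc k)"
    using cutf_bd[of "ch tree x" k] ch_tree_supp ch_tree_cyc_w k by simp
  also have "\<dots> = Poly_Mapping.lookup x (cyc k)"
    using k by (intro ch_tree) (auto simp: tree_def)
  finally show ?thesis .
qed

text \<open>The cut values of a point are its flows on the spine. The closing arc has cut value 0,
  and comparison with it becomes the condition of being nonpositive.\<close>

lemma cell_start_iff:
  assumes x: "x \<in> \<P>" and i: "i \<in> {1..<w}"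
  shows "x \<in> cell (start {i}) \<longleftrightarrow> Poly_Mapping.lookup x (cyc i) \<le> 0 \<and>
    (\<forall>k\<in>{1..<w}. Poly_Mapping.lookup x (cyc i) \<le> Poly_Mapping.lookup x (cyc k))"
proof -
  have i': "i \<in> {1..w}" using i by auto
  have w0: "cutf (dv x) w = 0" using P_balanced[OF x] by (simp add: cutf_w balanced_def)
  have "{1..w} = insert w {1..<w}" using w_ge_1 by auto
  then have "(\<forall>k\<in>{1..w}. cutf (dv x) i \<le> cutf (dv x) k) \<longleftrightarrow> Poly_Mapping.lookup x (cyc i) \<le> 0 \<and>
      (\<forall>k\<in>{1..<w}. Poly_Mapping.lookup x (cyc i) \<le> Poly_Mapping.lookup x (cyc k))"
    using cutf_P[OF x] i w0 by simp
  moreover have "x \<in> cell (start {i}) \<longleftrightarrow> (\<forall>k\<in>{1..w}. cutf (dv x) i \<le> cutf (dv x) k)"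
    using start_repr[OF P_balanced[OF x] i'] start_repr_cutf[OF i'] x unfolding cell_def by blast
  ultimately show ?thesis by blast
qed

text \<open>Telescoping along the route. Indicators of single vertices for \<phi> give all
  conservation laws in \<open>route_in_P\<close>.\<close>

lemma route_pairing:
  assumes r: "is_route (partial_aug \<nu> (GB_path \<nu>)) r"
  shows "(\<Sum>e\<in>tree \<union> src \<union> snk. Poly_Mapping.lookup (signed_char_vec r) e * (\<phi> (fst e) - \<phi> (snd e))) = \<phi> 0 - \<phi> (n + 1)"
proof -
  let ?K = "tree \<union> src \<union> snk"
  have fin: "finite ?K" using simple_finite[OF simple_tree] by simp
  have r': "distinct r" "r \<noteq> []" "hd r = 0" "last r = n + 1"
    using r unfolding is_route_def Min_Max_aug by auto
  have "(\<Sum>e\<in>?K. Poly_Mapping.lookup (signed_char_vec r) e * (\<phi> (fst e) - \<phi> (snd e))) =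
      (\<Sum>s\<in>path_steps r. \<Sum>e\<in>?K. Poly_Mapping.lookup (case s of (p, q) \<Rightarrow> if p < q then Poly_Mapping.single (p, q) 1
          else Poly_Mapping.single (q, p) (- 1)) e * (\<phi> (fst e) - \<phi> (snd e)))"
    unfolding signed_char_vec_def lookup_sum sum_distrib_right by (rule sum.swap)
  also have "\<dots> = (\<Sum>s\<in>path_steps r. \<phi> (fst s) - \<phi> (snd s))"
  proof (rule sum.cong[OF refl])
    fix s assume s: "s \<in> path_steps r"
    obtain p q where pq: "s = (p, q)" by fastforce
    have "traversable (partial_aug \<nu> (GB_path \<nu>)) p q" using r s pq unfolding is_route_def by blast
    then have "upair s \<in> ?K" "p \<noteq> q"
      unfolding traversable_aug_GB pq upair_def using tree_less[of p q] tree_less[of q p] I_sub J_sub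
      by (auto simp: tree_def)
    then show "(\<Sum>e\<in>?K. Poly_Mapping.lookup (case s of (p, q) \<Rightarrow> if p < q then Poly_Mapping.single (p, q) 1
          else Poly_Mapping.single (q, p) (- 1)) e * (\<phi> (fst e) - \<phi> (snd e))) = \<phi> (fst s) - \<phi> (snd s)"
      using fin unfolding pq upair_def
      by (cases "p < q") (simp_all add: lookup_single when_def if_distrib[of "\<lambda>r. r * _"] cong: if_cong)
  qed
  also have "\<dots> = \<phi> 0 - \<phi> (n + 1)"
    using path_steps_telescope[OF r'(1,2), of \<phi>] r'(3,4) by simp
  finally show ?thesis .
qed

lemma route_in_P:
  assumes r: "is_route (partial_aug \<nu> (GB_path \<nu>)) r"
  shows "signed_char_vec r \<in> \<P>"
proof -
  let ?x = "signed_char_vec r"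
  let ?K = "tree \<union> src \<union> snk"
  have r': "distinct r" using r unfolding is_route_def by blast
  have trav: "(p, q) \<in> ?K \<or> (q, p) \<in> cyc ` {1..<w}" if "(p, q) \<in> path_steps r" for p q
    using r that unfolding is_route_def traversable_aug_GB by blast
  have disj: "tree \<inter> src = {}" "(tree \<union> src) \<inter> snk = {}"
    using IJ_sub[OF tree_sub] I_sub by auto
  have fin: "finite tree" using simple_finite[OF simple_tree] .
  have split: "(\<Sum>e\<in>?K. f e) = (\<Sum>e\<in>tree. f e) + (\<Sum>i\<in>I. f (0, i)) + (\<Sum>j\<in>J. f (j, n + 1))" for f :: "nat \<times> nat \<Rightarrow> real"
  proof -
    have imgs: "src = Pair 0 ` I" "snk = (\<lambda>j. (j, n + 1)) ` J" by auto
    have "(\<Sum>e\<in>src. f e) = (\<Sum>i\<in>I. f (0, i))" "(\<Sum>e\<in>snk. f e) = (\<Sum>j\<in>J. f (j, n + 1))"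
      unfolding imgs by (simp_all add: sum.reindex inj_on_def)
    then show ?thesis using disj fin by (simp add: sum.union_disjoint)
  qed
  have keys: "Poly_Mapping.keys ?x \<subseteq> ?K"
  proof
    fix e assume e: "e \<in> Poly_Mapping.keys ?x"
    obtain a b where ab: "e = (a, b)" by fastforce
    then have "a < b" "(a, b) \<in> path_steps r \<or> (b, a) \<in> path_steps r"
      using e lookup_signed_char_vec[OF r', of a b] by (auto simp: in_keys_iff of_bool_def split: if_splits)
    moreover have "(b, a) \<notin> ?K" using \<open>a < b\<close> tree_less[of b a] I_sub J_sub by auto
    moreover have "(b, a) \<notin> cyc ` {1..<w}" using \<open>a < b\<close> tree_less[of b a] by (auto simp: tree_def)
    ultimately have "(a, b) \<in> ?K \<or> (a, b) \<in> cyc ` {1..<w}" using trav by blast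
    then show "e \<in> ?K" unfolding ab tree_def by blast
  qed
  have src0: "0 \<le> inflow ?x i" if "i \<in> I" for i
  proof -
    have "(i, 0) \<notin> ?K" using IJ_sub[OF tree_sub] that by auto
    moreover have "(0, i) \<notin> cyc ` {1..<w}" using IJ_sub[OF tree_sub] by (auto simp: tree_def)
    ultimately have "(i, 0) \<notin> path_steps r" using trav by blast
    then show ?thesis by (simp add: lookup_signed_char_vec[OF r'])
  qed
  have snk0: "0 \<le> outflow ?x j" if "j \<in> J" for j
  proof -
    have "(n + 1, j) \<notin> ?K" using IJ_sub[OF tree_sub] that by auto
    moreover have "(j, n + 1) \<notin> cyc ` {1..<w}" using IJ_sub[OF tree_sub] by (auto simp: tree_def)
    ultimately have "(n + 1, j) \<notin> path_steps r" using trav by blast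
    then show ?thesis by (simp add: lookup_signed_char_vec[OF r'])
  qed
  have tree0: "(\<Sum>e\<in>tree. Poly_Mapping.lookup ?x e * (of_bool (fst e = u) - of_bool (snd e = u))) = 0" if "u \<notin> {1..n}" for u
  proof (rule sum.neutral, rule ballI)
    fix e assume "e \<in> tree"
    then have "fst e \<noteq> u" "snd e \<noteq> u" using IJ_sub[OF tree_sub] that by (auto simp: mem_Times_iff)
    then show "Poly_Mapping.lookup ?x e * (of_bool (fst e = u) - of_bool (snd e = u)) = 0" by simp
  qed
  have "(\<Sum>i\<in>I. inflow ?x i) = 1"
  proof -
    have "(\<Sum>i\<in>I. inflow ?x i * (of_bool (0 = (0::nat)) - of_bool (i = 0))) = (\<Sum>i\<in>I. inflow ?x i)"
      using I_sub by (intro sum.cong) auto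
    moreover have "(\<Sum>j\<in>J. outflow ?x j * (of_bool (j = 0) - of_bool (n + 1 = 0))) = 0"
      using J_sub by (intro sum.neutral) auto
    ultimately show ?thesis
      using route_pairing[OF r, of "\<lambda>u. of_bool (u = 0)"] tree0[of 0] unfolding split by simp
  qed
  moreover have "(\<Sum>j\<in>J. outflow ?x j) = 1"
  proof -
    have "(\<Sum>i\<in>I. inflow ?x i * (of_bool (0 = n + 1) - of_bool (i = n + 1))) = 0"
      using I_sub by (intro sum.neutral) auto
    moreover have "(\<Sum>j\<in>J. outflow ?x j * (of_bool (j = n + 1) - of_bool (n + 1 = n + 1))) =
        - (\<Sum>j\<in>J. outflow ?x j)"
      unfolding sum_negf[symmetric] using J_sub by (intro sum.cong) auto
    ultimately show ?thesis
      using route_pairing[OF r, of "\<lambda>u. of_bool (u = n + 1)"] tree0[of "n + 1"] unfolding split by simp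
  qed
  moreover have "bd (ch tree ?x) u = dv ?x u" if u: "u \<in> {1..n}" for u
  proof -
    have "(\<Sum>i\<in>I. inflow ?x i * (of_bool (0 = u) - of_bool (i = u))) = - (of_bool (u \<in> I) * inflow ?x u)"
    proof -
      have "(\<Sum>i\<in>I. inflow ?x i * (of_bool (0 = u) - of_bool (i = u))) =
          (\<Sum>i\<in>I. if i = u then - inflow ?x i else 0)"
        using u by (intro sum.cong) auto
      then show ?thesis by simp
    qed
    moreover have "(\<Sum>j\<in>J. outflow ?x j * (of_bool (j = u) - of_bool (n + 1 = u))) = of_bool (u \<in> J) * outflow ?x u"
    proof -
      have "(\<Sum>j\<in>J. outflow ?x j * (of_bool (j = u) - of_bool (n + 1 = u))) =
          (\<Sum>j\<in>J. if j = u then outflow ?x j else 0)"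
        using u by (intro sum.cong) auto
      then show ?thesis by simp
    qed
    moreover have "of_bool (0 = u) - of_bool (n + 1 = u) = (0::real)" using u by auto
    ultimately have "(\<Sum>e\<in>tree. Poly_Mapping.lookup ?x e * (of_bool (fst e = u) - of_bool (snd e = u))) = dv ?x u"
      using route_pairing[OF r, of "\<lambda>v. of_bool (v = u)"] unfolding split dv_def fst_conv snd_conv by linarith
    then show ?thesis unfolding bd_ch[OF simple_tree] upair_tree .
  qed
  ultimately show ?thesis
    unfolding P_iff lin_def unit_flow_def upair_tree using keys src0 snk0
    by (intro conjI ballI)
qed

text \<open>Walk from \<open>a\<close> to its hub, along the spine in either direction to the hub of
  \<open>b\<close>, and on to \<open>b\<close>; then remove repetitions.\<close>

lemma route_exists:
  assumes a: "a \<in> I" and b: "b \<in> J"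
  shows "\<exists>r. is_route (partial_aug \<nu> (GB_path \<nu>)) r \<and> (0, a) \<in> path_steps r \<and> (b, n + 1) \<in> path_steps r"
proof -
  define R where "R = {(p, q). traversable (GB_path \<nu>) p q}"
  have R_iff: "(p, q) \<in> R \<longleftrightarrow> (p, q) \<in> tree \<or> (q, p) \<in> cyc ` {1..<w}" for p q
    unfolding R_def by (simp add: traversable_GB)
  have cyc_tree: "cyc ` {1..<w} \<subseteq> tree" by (auto simp: tree_def)
  have R_n: "p \<in> {1..n} \<and> q \<in> {1..n}" if "(p, q) \<in> R" for p q
    using that cyc_tree IJ_sub[OF tree_sub] unfolding R_iff by blast
  have step: "(valley \<nu> k, valley \<nu> (Suc k)) \<in> R \<and> (valley \<nu> (Suc k), valley \<nu> k) \<in> R" if "k \<in> {1..<w}" for k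
  proof -
    have "(valley \<nu> k, valley \<nu> (Suc k)) \<in> cyc ` {1..<w}" using cyc_less[OF that] that by (metis Suc_eq_plus1 imageI)
    then show ?thesis using cyc_tree unfolding R_iff by blast
  qed
  have up: "(valley \<nu> k, valley \<nu> (k + m)) \<in> R\<^sup>* \<and> (valley \<nu> (k + m), valley \<nu> k) \<in> R\<^sup>*" if "1 \<le> k" "k + m \<le> w" for k m
    using that
  proof (induction m)
    case (Suc m)
    then have "k + m \<in> {1..<w}" by auto
    from step[OF this] Suc show ?case
      by (auto intro: rtrancl_into_rtrancl converse_rtrancl_into_rtrancl)
  qed simp
  have spine: "(valley \<nu> k, valley \<nu> l) \<in> R\<^sup>*" if "k \<in> {1..w}" "l \<in> {1..w}" for k l
    using up[of k "l - k"] up[of l "k - l"] that by (cases "k \<le> l") auto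
  have ab_n: "a \<in> {1..n}" "b \<in> {1..n}" using a b I_sub J_sub by blast+
  have "(a, hub a) \<in> R\<^sup>*"
  proof (cases "a \<in> J")
    case True
    then show ?thesis using a by simp
  next
    case False
    then have "(a, hub a) \<in> tree" using a by (auto simp: tree_def Leaves_def)
    then show ?thesis using R_iff by blast
  qed
  moreover have "(hub a, hub b) \<in> R\<^sup>*"
    unfolding hub_def using spine[OF rk_in[OF ab_n(1)] rk_in[OF ab_n(2)]] .
  moreover have "(hub b, b) \<in> R\<^sup>*"
  proof (cases "b \<in> I")
    case True
    then show ?thesis using b by simp
  next
    case False
    then have "(hub b, b) \<in> tree" using b by (auto simp: tree_def Leaves_def)
    then show ?thesis using R_iff by blast
  qed
  ultimately have "(a, b) \<in> R\<^sup>*" by (meson rtrancl_trans)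
  then obtain xs where xs: "xs \<noteq> []" "distinct xs" "hd xs = a" "last xs = b" "path_steps xs \<subseteq> R"
    using simple_path by blast
  have set_xs: "set xs \<subseteq> {1..n}"
    using set_path_steps[OF xs(1)] xs(3,5) R_n ab_n(1) by fastforce
  define r where "r = 0 # xs @ [n + 1]"
  have steps: "path_steps r = insert (0, a) (insert (b, n + 1) (path_steps xs))"
  proof -
    obtain y ys where y: "xs @ [n + 1] = y # ys" by (cases "xs @ [n + 1]") auto
    have "y = a" using arg_cong[OF y, of hd] xs(1,3) by simp
    then have "path_steps r = insert (0, a) (path_steps (xs @ [n + 1]))"
      unfolding r_def y by (simp add: path_steps_Cons)
    then show ?thesis unfolding path_steps_snoc[OF xs(1)] xs(4) .
  qed
  have "is_route (partial_aug \<nu> (GB_path \<nu>)) r"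
    unfolding is_route_def Min_Max_aug
  proof (intro conjI)
    show "distinct r" using xs(2) set_xs by (auto simp: r_def)
    show "\<forall>(p, q)\<in>path_steps r. traversable (partial_aug \<nu> (GB_path \<nu>)) p q"
    proof clarify
      fix p q assume "(p, q) \<in> path_steps r"
      then have "(p, q) = (0, a) \<or> (p, q) = (b, n + 1) \<or> (p, q) \<in> path_steps xs"
        unfolding steps by (simp only: insert_iff)
      then have "(p, q) \<in> src \<or> (p, q) \<in> snk \<or> (p, q) \<in> R" using a b xs(5) by auto
      then show "traversable (partial_aug \<nu> (GB_path \<nu>)) p q"
        unfolding traversable_aug_GB R_iff by blast
    qed
  qed (simp_all add: r_def)
  then show ?thesis using steps by blast
qed

lemma start_w: "start {w} = tree"
  unfolding start_def tree_def by (rule arg_cong[of _ _ "\<lambda>A. Leaves \<union> cyc ` A"]) (use w_ge_1 in auto)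

lemma forest_start: "i \<in> {1..w} \<Longrightarrow> forest (start {i})"
  using tree_fan_forest[OF tree_fan_start] by blast

text \<open>An integral point has its source flow at one \<open>a\<close> and its sink flow at one
  \<open>b\<close>. A route through both has the same data, and flows on the tree are determined by
  these.\<close>

lemma integral_P_route:
  assumes x: "x \<in> \<P>" "x \<in> lattice_points"
  shows "\<exists>r. is_route (partial_aug \<nu> (GB_path \<nu>)) r \<and> x = signed_char_vec r"
proof -
  have x_int: "Poly_Mapping.lookup x e \<in> \<int>" for e using x(2) unfolding lattice_points_def by blast
  have unit: "unit_flow y" "lin tree y" if "y \<in> \<P>" for y using that by (simp_all add: P_iff)
  obtain a where a: "a \<in> I" "\<And>i. i \<in> I \<Longrightarrow> inflow x i = of_bool (i = a)"
    using unit_vector[of I "\<lambda>i. inflow x i"] unit(1)[OF x(1)] x_int unfolding unit_flow_def by auto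
  obtain b where b: "b \<in> J" "\<And>j. j \<in> J \<Longrightarrow> outflow x j = of_bool (j = b)"
    using unit_vector[of J "\<lambda>j. outflow x j"] unit(1)[OF x(1)] x_int unfolding unit_flow_def by auto
  obtain r where r: "is_route (partial_aug \<nu> (GB_path \<nu>)) r" "(0, a) \<in> path_steps r" "(b, n + 1) \<in> path_steps r"
    using route_exists[OF a(1) b(1)] by blast
  let ?y = "signed_char_vec r"
  have y: "?y \<in> \<P>" by (rule route_in_P[OF r(1)])
  have r': "distinct r" using r(1) unfolding is_route_def by blast
  have y_int: "Poly_Mapping.lookup ?y e \<in> \<int>" for e
    using lookup_signed_char_vec[OF r', of "fst e" "snd e"] by (simp add: of_bool_def)
  have "inflow ?y a = 1" "outflow ?y b = 1"
    using lookup_signed_char_vec[OF r', of 0 a] lookup_signed_char_vec[OF r', of b "n + 1"] r(2,3)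
      path_steps_irrefl(2)[OF r' r(2)] path_steps_irrefl(2)[OF r' r(3)] a(1) b(1) I_sub J_sub by auto
  moreover obtain a' where "a' \<in> I" "\<And>i. i \<in> I \<Longrightarrow> inflow ?y i = of_bool (i = a')"
    using unit_vector[of I "\<lambda>i. inflow ?y i"] unit(1)[OF y] y_int unfolding unit_flow_def by auto
  moreover obtain b' where "b' \<in> J" "\<And>j. j \<in> J \<Longrightarrow> outflow ?y j = of_bool (j = b')"
    using unit_vector[of J "\<lambda>j. outflow ?y j"] unit(1)[OF y] y_int unfolding unit_flow_def by auto
  ultimately have "a = a'" "b = b'" using a(1) b(1) by (auto simp: of_bool_def split: if_splits)
  have "forest tree" using forest_start[of w] w_ge_1 by (simp add: start_w)
  then have "x = ?y"
  proof (rule lin_inject[OF _ unit(2)[OF x(1)] unit(2)[OF y]])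
    show "inflow x i = inflow ?y i" if "i \<in> I" for i
      using a(2)[OF that] \<open>\<And>i. i \<in> I \<Longrightarrow> inflow ?y i = of_bool (i = a')\<close>[OF that] \<open>a = a'\<close> by simp
    show "outflow x j = outflow ?y j" if "j \<in> J" for j
      using b(2)[OF that] \<open>\<And>j. j \<in> J \<Longrightarrow> outflow ?y j = of_bool (j = b')\<close>[OF that] \<open>b = b'\<close> by simp
  qed
  then show ?thesis using r(1) by blast
qed

lemma graph_of_tree: "graph_of tree = G_path \<nu>"
proof (rule graph.equality)
  have "{(b, a, Bwd) | a b. (a, b) \<in> tree \<and> b < a} = {}" using tree_less less_asym by blast
  moreover have "{(a, b, Fwd) | a b. (a, b) \<in> tree \<and> a < b} = (\<lambda>(a, b). (a, b, Fwd)) ` tree"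
    using tree_less by (auto simp: image_iff)
  ultimately show "edges (graph_of tree) = edges (G_path \<nu>)"
    unfolding edges_G_path_tree graph_of_def graph.simps by (simp only: Un_empty_right)
qed (simp_all add: graph_of_def verts_G_path)

text \<open>For \<open>i < w\<close> the cell is the hull of its lattice points, and these come from
  routes. Route vectors have entries -1, 0 and 1, so entry \<open>i\<close> is least and nonpositive
  iff it is -1, or it is 0 and no spine edge is traversed downwards: this is the defining condition
  on routes.\<close>

theorem Q_cell_eq:
  assumes i: "i \<in> {1..w}"
  shows "Q_cell \<nu> i = cell (start {i})"
proof (cases "i = w")
  case True
  have "Q_cell \<nu> i = FP tree" unfolding Q_cell_def FP_def graph_of_tree using True by simp
  also have "FP tree = lift ` FP tree"
    using lift_id by (force simp: FP_iff[OF simple_tree])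
  also have "\<dots> = cell tree" by (rule lift_FP[OF simple_tree])
  finally show ?thesis using True by (simp add: start_w)
next
  case False
  then have iw: "i \<in> {1..<w}" using i by auto
  have cyc_i: "cyc i = (valley \<nu> i, valley \<nu> (i + 1))" "valley \<nu> i < valley \<nu> (i + 1)" using cyc_less[OF iw] by auto
  let ?aug = "partial_aug \<nu> (GB_path \<nu>)"
  let ?cond = "\<lambda>r. (valley \<nu> i, valley \<nu> (i + 1)) \<notin> path_steps r \<and>
       ((\<exists>(p, q) \<in> path_steps r. q < p) \<longrightarrow> (valley \<nu> (i + 1), valley \<nu> i) \<in> path_steps r)"
  let ?R = "{r. is_route ?aug r \<and> ?cond r}"
  have Q: "Q_cell \<nu> i = convex hull (signed_char_vec ` ?R)"
    unfolding Q_cell_def using False by simp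
  have lookup_cyc: "Poly_Mapping.lookup (signed_char_vec r) (cyc k) =
      of_bool (cyc k \<in> path_steps r) - of_bool ((snd (cyc k), fst (cyc k)) \<in> path_steps r)"
    if "is_route ?aug r" "k \<in> {1..<w}" for r k
    using that lookup_signed_char_vec[of r] cyc_less[of k] unfolding is_route_def by simp
  have cond_iff: "?cond r \<longleftrightarrow> signed_char_vec r \<in> cell (start {i})" if r: "is_route ?aug r" for r
  proof -
    have r': "distinct r" using r unfolding is_route_def by blast
    let ?f = "\<lambda>k. Poly_Mapping.lookup (signed_char_vec r) (cyc k)"
    have desc: "(\<exists>(p, q) \<in> path_steps r. q < p) \<longleftrightarrow> (\<exists>k\<in>{1..<w}. (snd (cyc k), fst (cyc k)) \<in> path_steps r)" (is "?L \<longleftrightarrow> ?RR")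
    proof
      assume ?L
      then obtain p q where pq: "(p, q) \<in> path_steps r" "q < p" by blast
      then have "traversable ?aug p q" using r unfolding is_route_def by blast
      moreover have "(p, q) \<notin> tree \<union> src \<union> snk" using pq(2) tree_less[of p q] I_sub J_sub by auto
      ultimately have "(q, p) \<in> cyc ` {1..<w}" unfolding traversable_aug_GB by blast
      then obtain k where k: "k \<in> {1..<w}" "(q, p) = cyc k" by blast
      have "(snd (cyc k), fst (cyc k)) = (p, q)" unfolding k(2)[symmetric] by simp
      then show ?RR using pq(1) k(1) by metis
    next
      assume ?RR
      then obtain k where k: "k \<in> {1..<w}" "(snd (cyc k), fst (cyc k)) \<in> path_steps r" by blast
      have "fst (cyc k) < snd (cyc k)" using cyc_less[OF k(1)] by simp
      then show ?L using k(2) by blast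
    qed
    have excl: "\<not> (cyc k \<in> path_steps r \<and> (snd (cyc k), fst (cyc k)) \<in> path_steps r)" for k
      using path_steps_irrefl(2)[OF r', of "fst (cyc k)" "snd (cyc k)"] by auto
    have f: "?f k = of_bool (cyc k \<in> path_steps r) - of_bool ((snd (cyc k), fst (cyc k)) \<in> path_steps r)" if "k \<in> {1..<w}" for k
      using lookup_cyc[OF r that] .
    have "signed_char_vec r \<in> cell (start {i}) \<longleftrightarrow> ?f i \<le> 0 \<and> (\<forall>k\<in>{1..<w}. ?f i \<le> ?f k)"
      by (rule cell_start_iff[OF route_in_P[OF r] iw])
    also have "?f i \<le> 0 \<longleftrightarrow> cyc i \<notin> path_steps r" using f[OF iw] excl[of i] by auto
    also have "cyc i \<notin> path_steps r \<and> (\<forall>k\<in>{1..<w}. ?f i \<le> ?f k) \<longleftrightarrow>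
        cyc i \<notin> path_steps r \<and> ((\<exists>k\<in>{1..<w}. (snd (cyc k), fst (cyc k)) \<in> path_steps r) \<longrightarrow>
          (snd (cyc i), fst (cyc i)) \<in> path_steps r)"
    proof (rule conj_cong[OF refl])
      assume ni: "cyc i \<notin> path_steps r"
      show "(\<forall>k\<in>{1..<w}. ?f i \<le> ?f k) \<longleftrightarrow> ((\<exists>k\<in>{1..<w}. (snd (cyc k), fst (cyc k)) \<in> path_steps r) \<longrightarrow>
          (snd (cyc i), fst (cyc i)) \<in> path_steps r)"
      proof (cases "(snd (cyc i), fst (cyc i)) \<in> path_steps r")
        case True
        then have "?f i = - 1" using f[OF iw] ni by simp
        moreover have "- 1 \<le> ?f k" if "k \<in> {1..<w}" for k using f[OF that] by auto
        ultimately show ?thesis using True by auto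
      next
        case bi: False
        then have fi: "?f i = 0" using f[OF iw] ni by simp
        have "0 \<le> ?f k \<longleftrightarrow> (snd (cyc k), fst (cyc k)) \<notin> path_steps r" if "k \<in> {1..<w}" for k
          using f[OF that] excl[of k] by auto
        then show ?thesis using bi unfolding fi by blast
      qed
    qed
    finally show ?thesis unfolding desc[symmetric] cyc_i(1) fst_conv snd_conv by blast
  qed
  show ?thesis
  proof
    show "Q_cell \<nu> i \<subseteq> cell (start {i})"
      unfolding Q by (rule hull_minimal) (use cond_iff convex_cell in auto)
    have "lift ` FPV (start {i}) \<subseteq> signed_char_vec ` ?R"
    proof
      fix x assume "x \<in> lift ` FPV (start {i})"
      then have x: "x \<in> cell (start {i})" "x \<in> lattice_points"
        using lift_FP[OF forestD(2)[OF forest_start[OF i]]] lift_integral unfolding FPV_def by blast+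
      then have "x \<in> \<P>" unfolding cell_def by blast
      then obtain r where r: "is_route ?aug r" "x = signed_char_vec r" using integral_P_route x(2) by blast
      then have "?cond r" using cond_iff[OF r(1)] x(1) by blast
      then show "x \<in> signed_char_vec ` ?R" using r by blast
    qed
    then show "cell (start {i}) \<subseteq> Q_cell \<nu> i"
      unfolding Q cell_hull[OF forest_start[OF i]] by (rule hull_mono)
  qed
qed


section \<open>The encoding\<close>

lemma M_graph_of:
  assumes S: "simple S"
  shows "M_graph (graph_of S) = Poly_Mapping.single (sf_mono S) 1"
proof -
  let ?up = "{e \<in> S. fst e < snd e}" and ?dn = "{e \<in> S. snd e < fst e}"
  have fin: "finite ?up" "finite ?dn" using simple_finite[OF S] by auto
  have F: "{(i, j). (i, j, Fwd) \<in> edges (graph_of S)} = ?up" by (auto simp: edges_graph_of)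
  have "{(i, j). (i, j, Bwd) \<in> edges (graph_of S)} = prod.swap ` ?dn"
    by (auto simp: edges_graph_of image_iff)
  then have "(\<Prod>(i, j)\<in>{(i, j). (i, j, Bwd) \<in> edges (graph_of S)}. xvar j i) = (\<Prod>e\<in>?dn. xvar (fst e) (snd e))"
    by (simp add: prod.reindex case_prod_unfold)
  moreover have "(\<Prod>(i, j)\<in>?up. xvar i j) * (\<Prod>(i, j)\<in>?dn. xvar i j) = (\<Prod>(i, j)\<in>S. xvar i j)"
  proof -
    have "fst e < snd e \<or> snd e < fst e" if "e \<in> S" for e
      using simpleD(1)[OF S, of "fst e" "snd e"] that by (auto simp: nat_neq_iff)
    then have "S = ?up \<union> ?dn" by blast
    moreover have "?up \<inter> ?dn = {}" by auto
    ultimately show ?thesis using fin by (metis (no_types, lifting) prod.union_disjoint)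
  qed
  ultimately show ?thesis
    unfolding M_graph_def F using prod_xvar[OF simple_finite[OF S]] by (simp add: case_prod_unfold)
qed

lemma beta_power: "beta ^ k = Poly_Mapping.single 0 (monom 1 k)"
  by (induction k) (simp_all add: beta_def mult_single mult_monom one_poly_mapping_def)

lemma beta_M_graph_of:
  assumes "simple S"
  shows "beta ^ k * M_graph (graph_of S) = Poly_Mapping.single (sf_mono S) (monom 1 k)"
  unfolding M_graph_of[OF assms] beta_power by (simp add: mult_single)

lemma graph_of_fwd_bwd: "simple S \<Longrightarrow> fwd_bwd_graph_on n (graph_of S)"
  unfolding fwd_bwd_graph_on_def wf_graph_def graph_of_def
  by (auto simp: simple_def)

lemma traversable_graph_of: "i \<noteq> j \<Longrightarrow> traversable (graph_of S) i j \<longleftrightarrow> (i, j) \<in> S"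
  unfolding traversable_def by (auto simp: edges_graph_of)

text \<open>The encoding assigns graphs to faces as point sets; the subforest is recovered from its
  cell by \<open>cell_inj\<close>.\<close>

definition face_graph :: "(nat \<times> nat) set set \<Rightarrow> flow set \<Rightarrow> graph" where
  "face_graph \<T> F = graph_of (the_inv_into (faces \<T>) cell F)"

lemma face_graph_cell: "tree_fan \<T> \<Longrightarrow> S \<in> faces \<T> \<Longrightarrow> face_graph \<T> (cell S) = graph_of S"
  unfolding face_graph_def using the_inv_into_f_f[OF cell_inj] by simp

lemma polyhedral_subdivision_fan:
  assumes fan: "tree_fan \<T>"
  shows "polyhedral_subdivision \<P> (cell ` \<T>)"
  unfolding polyhedral_subdivision_def
proof (intro conjI ballI)
  show "finite (cell ` \<T>)" using tree_fanD(1)[OF fan] by simp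
  show "\<Union> (cell ` \<T>) = \<P>"
  proof
    show "\<Union> (cell ` \<T>) \<subseteq> \<P>" unfolding cell_def by blast
    show "\<P> \<subseteq> \<Union> (cell ` \<T>)"
    proof
      fix x assume x: "x \<in> \<P>"
      then show "x \<in> \<Union> (cell ` \<T>)"
        using tree_fanD(7)[OF fan P_balanced[OF x]] unfolding cell_def by blast
    qed
  qed
next
  fix C assume "C \<in> cell ` \<T>"
  then obtain H where H: "H \<in> \<T>" "C = cell H" by blast
  note for_H = tree_fan_forest[OF fan H(1)]
  show "polytope C" unfolding H(2) by (rule polytope_cell[OF for_H])
  show "C \<noteq> {}" using full_exists[OF for_H tree_fanD(4)[OF fan H(1)]] full_cell H(2) by blast
  show "pdim C = pdim \<P>"
    using pdim_cell[OF for_H tree_fanD(4)[OF fan H(1)]] pdim_P[OF fan H(1)] H(2) by simp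
next
  \<comment> \<open>Uniqueness across two trees: a common point has one coefficient function, which
    is supported in both trees.\<close>
  have inter: "cell H \<inter> cell H' = cell (H \<inter> H')" if H: "H \<in> \<T>" "H' \<in> \<T>" for H H'
  proof (intro subset_antisym subsetI)
    fix x assume x: "x \<in> cell H \<inter> cell H'"
    obtain c where c: "x \<in> \<P>" "nonneg_on H c" "\<And>u. u \<in> {1..n} \<Longrightarrow> bd c u = dv x u" using x unfolding cell_def by blast
    obtain c' where c': "nonneg_on H' c'" "\<And>u. u \<in> {1..n} \<Longrightarrow> bd c' u = dv x u" using x unfolding cell_def by blast
    have "c = c'" by (rule tree_fan_unique[OF fan H c(2) c'(1)]) (simp add: c(3) c'(2))
    then have "nonneg_on (H \<inter> H') c" using nonneg_onD[OF c(2)] nonneg_onD(2)[OF c'(1)] by (intro nonneg_onI) auto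
    then show "x \<in> cell (H \<inter> H')" using cellI[OF c(1)] c(3) by blast
  next
    fix x assume "x \<in> cell (H \<inter> H')"
    then show "x \<in> cell H \<inter> cell H'"
      using nonneg_on_mono[of "H \<inter> H'"] unfolding cell_def by blast
  qed
  fix C D assume "C \<in> cell ` \<T>" "D \<in> cell ` \<T>"
  then obtain H H' where H: "H \<in> \<T>" "C = cell H" "H' \<in> \<T>" "D = cell H'" by blast
  show "C \<inter> D face_of C" "C \<inter> D face_of D"
    using cell_face_of[OF tree_fan_forest[OF fan H(1)], of "H \<inter> H'"]
      cell_face_of[OF tree_fan_forest[OF fan H(3)], of "H \<inter> H'"] inter[OF H(1,3)] H(2,4) by auto
qed

theorem encodes_via_fan:
  assumes fan: "tree_fan \<T>"
  shows "encodes_via \<nu> (face_poly (faces \<T>)) (cell ` \<T>) (face_graph \<T>) (\<lambda>_. lift)"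
proof -
  have simple: "simple S" if "S \<in> faces \<T>" for S using forestD(2)[OF faces_forest(1)[OF fan that]] .
  have term_eq: "beta ^ (pdim \<P> - pdim (cell S)) * M_graph (face_graph \<T> (cell S)) = face_term S"
    if "S \<in> faces \<T>" for S
    unfolding face_graph_cell[OF fan that] codim_cell[OF fan that] beta_M_graph_of[OF simple[OF that]] face_term_def ..
  have "inj_on face_term (faces \<T>)"
  proof (rule inj_onI)
    fix S S' assume S: "S \<in> faces \<T>" "S' \<in> faces \<T>" and eq: "face_term S = face_term S'"
    have "Poly_Mapping.keys (face_term R) = {sf_mono R}" for R by (simp add: face_term_def)
    then have "sf_mono S = sf_mono S'" using eq by (metis singleton_inject)
    then show "S = S'" using sf_mono_inject faces_finite(2)[OF fan] S by blast
  qed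
  note inj = this
  let ?g = "\<lambda>F. beta ^ (pdim \<P> - pdim F) * M_graph (face_graph \<T> F)"
  have terms: "terms (face_poly (faces \<T>)) = face_term ` faces \<T>"
    by (rule terms_face_poly[OF faces_finite(1)[OF fan]]) (use faces_finite(2)[OF fan] in blast)
  have "bij_betw ?g (cell ` faces \<T>) (terms (face_poly (faces \<T>)))"
    unfolding bij_betw_def
  proof
    show "inj_on ?g (cell ` faces \<T>)"
    proof (rule inj_onI)
      fix F F' assume "F \<in> cell ` faces \<T>" "F' \<in> cell ` faces \<T>" and eq: "?g F = ?g F'"
      then obtain S S' where S: "S \<in> faces \<T>" "F = cell S" "S' \<in> faces \<T>" "F' = cell S'" by blast
      have "face_term S = face_term S'" using eq unfolding S(2,4) term_eq[OF S(1)] term_eq[OF S(3)] .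
      then show "F = F'" using inj_onD[OF inj _ S(1,3)] S(2,4) by simp
    qed
    show "?g ` cell ` faces \<T> = terms (face_poly (faces \<T>))"
      unfolding terms image_image by (intro image_cong refl term_eq)
  qed
  moreover have "fwd_bwd_graph_on n (face_graph \<T> F) \<and>
      integral_equivalence lift (flow_polytope (partial_aug \<nu> (face_graph \<T> F))) F" if F: "F \<in> cell ` faces \<T>" for F
  proof -
    obtain S where S: "S \<in> faces \<T>" "F = cell S" using F by blast
    show ?thesis
      unfolding S(2) face_graph_cell[OF fan S(1)]
      using graph_of_fwd_bwd[OF simple[OF S(1)]] integral_equivalence_lift[OF faces_forest(1)[OF fan S(1)]]
      unfolding FP_def by blast
  qed
  ultimately show ?thesis
    unfolding encodes_via_def Let_def interior_faces_fan[OF fan]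
    using polyhedral_subdivision_fan[OF fan] by blast
qed

section \<open>Geometric cuts and cuts of trees\<close>

text \<open>Rerouting the whole flow of \<open>y\<close> empties that arc and leaves
  \<open>c x - c y\<close> on the other, so the result is nonnegative exactly on this side of the
  hyperplane. The backward inclusion undoes the rerouting.\<close>

lemma cut_half:
  assumes fan: "tree_fan \<T>" and H: "H \<in> \<T>" and valid: "valid_triple (i, j, k)" and b: "both (i, j, k) H"
    and xy: "x = (i, j) \<and> y = (j, k) \<or> x = (j, k) \<and> y = (i, j)"
  shows "lift ` {z \<in> FP H. coord y z \<le> coord x z} = cell (insert (i, k) (H - {y}))"
proof -
  note for_H = tree_fan_forest[OF fan H]
  note simple = forestD(2)[OF for_H]
  note neqs = valid_neqs[OF fan valid]
  have xH: "x \<in> H" "y \<in> H" using b xy by (auto simp: both_def)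
  have ik: "(i, k) \<notin> H" by (rule both_ik_notin[OF fan valid H b])
  note bdshift = bd_shift[OF both_in(1)[OF fan valid b order_refl H]]
  have H': "insert (i, k) (H - {y}) \<in> cut_tree (i, j, k) H"
    using xy b by (auto simp: cut_tree_def)
  have shift_eval: "shift (i, j, k) m c x = c x - m" "shift (i, j, k) m c y = c y - m" for m c
    using xy neqs by (auto simp: shift_def)
  show ?thesis
  proof (intro subset_antisym subsetI)
    fix p assume "p \<in> lift ` {z \<in> FP H. coord y z \<le> coord x z}"
    then obtain z where z: "z \<in> FP H" "coord y z \<le> coord x z" "p = lift z" by blast
    define c where "c = ch H z"
    have c: "nonneg_on H c" unfolding c_def by (rule nonneg_on_ch[OF z(1) simple])
    have cxy: "c y \<le> c x" using z(2) xH by (simp add: c_def ch_def)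
    have p: "p \<in> \<P>" "\<And>u. u \<in> {1..n} \<Longrightarrow> bd c u = dv p u"
      using z(1) unfolding FP_iff[OF simple] z(3) c_def lin_def by (auto simp: lift_in_P dv_lift)
    let ?c = "shift (i, j, k) (c y) c"
    have "nonneg_on (insert (i, k) (H - {y})) ?c"
    proof (rule nonneg_onI)
      fix e
      consider "e = x" | "e = y" | "e = (i, k)" | "e \<noteq> x" "e \<noteq> y" "e \<noteq> (i, k)" by blast
      then show "0 \<le> ?c e"
      proof cases
        case 3
        then show ?thesis using nonneg_onD(1)[OF c] xy neqs by (auto simp: shift_def)
      next
        case 4
        then show ?thesis using nonneg_onD(1)[OF c] xy by (auto simp: shift_def)
      qed (use shift_eval cxy in auto)
      assume e: "e \<notin> insert (i, k) (H - {y})"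
      show "?c e = 0"
      proof (cases "e = y")
        case False
        then have "e \<notin> H" "e \<noteq> x" "e \<noteq> (i, k)" using e xH by auto
        then show ?thesis using False nonneg_onD(2)[OF c] xy by (auto simp: shift_def)
      qed (simp add: shift_eval)
    qed
    then show "p \<in> cell (insert (i, k) (H - {y}))"
      by (rule cellI[OF p(1)]) (simp add: bdshift p(2))
  next
    fix p assume "p \<in> cell (insert (i, k) (H - {y}))"
    then obtain c where c: "p \<in> \<P>" "nonneg_on (insert (i, k) (H - {y})) c" "\<And>u. u \<in> {1..n} \<Longrightarrow> bd c u = dv p u"
      unfolding cell_def by blast
    let ?c = "shift (i, j, k) (- c (i, k)) c"
    have nn: "nonneg_on H ?c" by (rule cut_tree_push(1)[OF fan valid H b H' c(2)])
    obtain z where z: "z \<in> FP H" "lift z = p" "ch H z = ?c"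
      using FP_ch_ge[OF simple c(1) nn] by (auto simp: bdshift c(3))
    have "y \<noteq> (i, k)" using ik xH by auto
    then have "c y = 0" by (intro nonneg_onD(2)[OF c(2)]) auto
    then have "ch H z y \<le> ch H z x" unfolding z(3) shift_eval using nonneg_onD(1)[OF c(2)] by simp
    then have "coord y z \<le> coord x z" using xH by (simp add: ch_def)
    then show "p \<in> lift ` {z \<in> FP H. coord y z \<le> coord x z}" using z by blast
  qed
qed

lemma cut_subdivision_fan:
  assumes fan: "tree_fan \<T>" and valid: "valid_triple t"
  shows "cut_subdivision \<nu> t (face_graph \<T>) (\<lambda>_. lift) (cell ` \<T>) = cell ` (\<Union>H\<in>\<T>. cut_tree t H)"
proof -
  obtain i j k where t: "t = (i, j, k)" by (metis prod_cases3)
  have "cut_cell \<nu> t (face_graph \<T> (cell H)) lift (cell H) = cell ` cut_tree t H" if H: "H \<in> \<T>" for H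
  proof -
    have ijk: "i \<noteq> j" "j \<noteq> k" using valid t by (auto simp: valid_triple_def)
    have g: "face_graph \<T> (cell H) = graph_of H"
      using face_graph_cell[OF fan] trees_subset_faces[OF fan] H by blast
    show ?thesis
    proof (cases "both (i, j, k) H")
      case False
      then show ?thesis
        unfolding g cut_cell_def t prod.case traversable_graph_of[OF ijk(1)] traversable_graph_of[OF ijk(2)]
        by (auto simp: cut_tree_def both_def)
    next
      case True
      then have "(i, j) \<in> H \<and> (j, k) \<in> H" by (simp add: both_def)
      then show ?thesis
        unfolding g cut_cell_def t prod.case traversable_graph_of[OF ijk(1)] traversable_graph_of[OF ijk(2)]
        using cut_half[OF fan H valid[unfolded t] True, of "(i, j)" "(j, k)"]
          cut_half[OF fan H valid[unfolded t] True, of "(j, k)" "(i, j)"] True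
        by (simp add: cut_tree_def FP_def)
    qed
  qed
  then show ?thesis unfolding cut_subdivision_def by auto
qed

section \<open>The simplex-subdivision and its polynomial\<close>

lemma start_mono: "i \<in> A \<Longrightarrow> start A \<subseteq> start {i}"
  unfolding start_def by blast

abbreviation "valley_sets \<equiv> {A. A \<subseteq> {1..w} \<and> A \<noteq> {}}"

text \<open>Each leaf edge is the only arc at some vertex that must be covered, so it cannot be
  dropped. Arcs of the cycle may be dropped freely, at least one of them being absent.\<close>

lemma faces_start: "faces ((\<lambda>i. start {i}) ` {1..w}) = start ` valley_sets"
proof (intro subset_antisym subsetI)
  fix S assume "S \<in> faces ((\<lambda>i. start {i}) ` {1..w})"
  then obtain i where i: "i \<in> {1..w}" "covers S" "S \<subseteq> start {i}" unfolding faces_def by blast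
  define A where "A = {k \<in> {1..w}. cyc k \<notin> S}"
  have "cyc i \<notin> S" using cyc_notin_start[of i "{i}"] i by blast
  then have A: "A \<in> valley_sets" using i(1) unfolding A_def by blast
  have S_sub: "S \<subseteq> Leaves \<union> cyc ` {1..w}" using i(3) unfolding start_def by blast
  have "Leaves \<subseteq> S"
  proof
    fix e assume e: "e \<in> Leaves"
    have "fst e \<in> {1..n}" "snd e \<in> {1..n}" using subsetD[OF Leaves_sub' e] by (auto simp: mem_Times_iff)
    then obtain a where a: "a \<in> {1..n} - V" "a = fst e \<or> a = snd e"
      using Leaves_not_V[OF e] by blast
    obtain e' where "e' \<in> S" "a = fst e' \<or> a = snd e'" using i(2) a(1) unfolding covers_def by blast
    moreover from this have "e' = e" using Leaves_unique_incident[OF e _ a(2)] S_sub a(1) by blast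
    ultimately show "e \<in> S" by simp
  qed
  then have "S = start A" using S_sub unfolding start_def A_def by blast
  then show "S \<in> start ` valley_sets" using A by blast
next
  fix S assume "S \<in> start ` valley_sets"
  then obtain A where A: "A \<subseteq> {1..w}" "A \<noteq> {}" "S = start A" by blast
  then obtain i where i: "i \<in> A" "i \<in> {1..w}" by blast
  have "covers S" unfolding A(3) by (rule covers_start[OF A(2)])
  moreover have "S \<subseteq> start {i}" unfolding A(3) by (rule start_mono[OF i(1)])
  ultimately show "S \<in> faces ((\<lambda>i. start {i}) ` {1..w})"
    unfolding faces_def using i(2) by blast
qed

lemma start_inj: "inj_on start valley_sets"
proof (rule inj_onI)
  have sub: "A \<subseteq> B" if "A \<in> valley_sets" "B \<in> valley_sets" "start A = start B" for A B
  proof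
    fix k assume k: "k \<in> A"
    then have kw: "k \<in> {1..w}" using that(1) by blast
    then have "cyc k \<notin> start B" using cyc_notin_start[OF k kw] that(3) by simp
    then show "k \<in> B" using kw unfolding start_def by blast
  qed
  show "A = B" if "A \<in> valley_sets" "B \<in> valley_sets" "start A = start B" for A B
    using sub[OF that] sub[OF that(2,1)] that(3) by auto
qed

lemma simple_start: "A \<in> valley_sets \<Longrightarrow> simple (start A)"
proof -
  assume A: "A \<in> valley_sets"
  then obtain i where "i \<in> A" "i \<in> {1..w}" by blast
  then show ?thesis using forestD(2)[OF forest_mono[OF forest_start start_mono]] by blast
qed

lemma card_start:
  assumes "A \<in> valley_sets"
  shows "n - 1 - card (start A) = card A - 1"
proof -
  have A: "A \<subseteq> {1..w}" "finite A" "A \<noteq> {}" using assms finite_subset by auto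
  have "card (start A) = card Leaves + card (cyc ` ({1..w} - A))"
    unfolding start_def using Leaves_cyc_disj by (intro card_Un_disjoint) auto
  also have "card (cyc ` ({1..w} - A)) = w - card A"
    using inj_on_subset[OF inj_cyc] A by (simp add: card_image card_Diff_subset)
  finally have "card (start A) = (n - w) + (w - card A)" by (simp only: card_Leaves)
  moreover have "card A \<le> w" using card_mono[OF _ A(1)] by simp
  moreover have "card A \<ge> 1" using A by (simp add: Suc_le_eq card_gt_0_iff)
  ultimately show ?thesis using w_le_n by linarith
qed

lemma edges_Gi_path:
  assumes i: "i \<in> {1..w}"
  shows "edges (Gi_path \<nu> i) = edges (graph_of (start {i}))"
proof (cases "i = w")
  case True
  then show ?thesis by (simp add: start_w graph_of_tree Gi_path_def)
next
  case False
  then have iw: "i \<in> {1..<w}" using i by auto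
  have cyc_i: "cyc i = (valley \<nu> i, valley \<nu> (i + 1))" using cyc_less[OF iw] by blast
  have "start {i} = Leaves \<union> cyc ` ({1..<w} - {i}) \<union> {cyc w}"
  proof -
    have "{1..w} - {i} = insert w ({1..<w} - {i})" using iw by auto
    then show ?thesis unfolding start_def by simp
  qed
  also have "\<dots> = (tree - {cyc i}) \<union> {cyc w}"
  proof -
    have "cyc ` ({1..<w} - {i}) = cyc ` {1..<w} - cyc ` {i}"
      by (rule inj_on_image_set_diff[OF inj_cyc]) (use i in auto)
    then show ?thesis using Leaves_cyc_disj[OF i] unfolding tree_def by blast
  qed
  finally have start: "start {i} = (tree - {cyc i}) \<union> {cyc w}" .
  \<comment> \<open>This arc descends, so \<open>graph_of\<close> stores it as the backward edge
    between the first and the last valley.\<close>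
  have cw: "cyc w = (valley \<nu> w, valley \<nu> 1)" by (simp add: cyc_def)
  have less: "valley \<nu> 1 < valley \<nu> w" using valley_less_iff[of 1 w] iw by auto
  have "(a, b, s) \<in> edges (Gi_path \<nu> i) \<longleftrightarrow> (a, b, s) \<in> edges (graph_of (start {i}))" for a b s
  proof (cases s)
    case Fwd
    show ?thesis
      unfolding Fwd edges_graph_of start cw using False less tree_less[of a b]
      by (auto simp: Gi_path_def edges_G_path_tree cyc_i)
  next
    case Bwd
    show ?thesis
      unfolding Bwd edges_graph_of start cw using False less tree_less[of b a]
      by (auto simp: Gi_path_def edges_G_path_tree)
  next
    case Bidir
    show ?thesis
      unfolding Bidir using False edges_graph_of(3)[of a b "start {i}"]
      by (auto simp: Gi_path_def edges_G_path_tree)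
  qed
  then show ?thesis by auto
qed

lemma Gi_inter_graph_of:
  assumes A: "A \<in> valley_sets"
  shows "Gi_inter \<nu> A = graph_of (start A)"
proof -
  have start: "e \<in> start A \<longleftrightarrow> (\<forall>i\<in>A. e \<in> start {i})" for e
  proof
    assume "e \<in> start A" then show "\<forall>i\<in>A. e \<in> start {i}" using start_mono by blast
  next
    assume all: "\<forall>i\<in>A. e \<in> start {i}"
    obtain i where i: "i \<in> A" using A by blast
    then have e: "e \<in> Leaves \<union> cyc ` {1..w}" using all unfolding start_def by blast
    show "e \<in> start A"
    proof (cases "e \<in> Leaves")
      case False
      then obtain k where k: "k \<in> {1..w}" "e = cyc k" using e by blast
      then have "k \<notin> A" using all cyc_notin_start[of k "{k}"] by blast
      then show ?thesis using k unfolding start_def by blast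
    qed (simp add: start_def)
  qed
  obtain i where i: "i \<in> A" using A by blast
  have "(a, b, s) \<in> edges (Gi_inter \<nu> A) \<longleftrightarrow> (a, b, s) \<in> edges (graph_of (start A))" for a b s
  proof -
    have "(a, b, s) \<in> edges (Gi_inter \<nu> A) \<longleftrightarrow> (\<forall>i\<in>A. (a, b, s) \<in> edges (graph_of (start {i})))"
      using edges_Gi_path A by (auto simp: Gi_inter_def subset_iff)
    also have "\<dots> \<longleftrightarrow> (a, b, s) \<in> edges (graph_of (start A))"
      using i by (cases s) (auto simp: edges_graph_of start)
    finally show ?thesis .
  qed
  then have "edges (Gi_inter \<nu> A) = edges (graph_of (start A))" by auto
  moreover have "verts (Gi_inter \<nu> A) = verts (graph_of (start A))" by (simp add: Gi_inter_def graph_of_def)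
  ultimately show ?thesis by simp
qed

lemma P_poly_faces: "P_poly \<nu> = face_poly (faces ((\<lambda>i. start {i}) ` {1..w}))"
proof -
  have "face_poly (faces ((\<lambda>i. start {i}) ` {1..w})) = (\<Sum>A\<in>valley_sets. face_term (start A))"
    unfolding face_poly_def faces_start using start_inj by (simp add: sum.reindex)
  also have "\<dots> = (\<Sum>A\<in>valley_sets. beta ^ (card A - 1) * M_graph (Gi_inter \<nu> A))"
  proof (rule sum.cong[OF refl])
    fix A assume A: "A \<in> valley_sets"
    show "face_term (start A) = beta ^ (card A - 1) * M_graph (Gi_inter \<nu> A)"
      unfolding Gi_inter_graph_of[OF A] beta_M_graph_of[OF simple_start[OF A]] face_term_def card_start[OF A] ..
  qed
  finally show ?thesis unfolding P_poly_def by simp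
qed

lemma simplex_subdivision_cells: "simplex_subdivision \<nu> = cell ` (\<lambda>i. start {i}) ` {1..w}"
  unfolding simplex_subdivision_def image_image using Q_cell_eq by (intro image_cong) auto

definition fan_seq :: "(nat \<times> nat \<times> nat) list \<Rightarrow> nat \<Rightarrow> (nat \<times> nat) set set" where
  "fan_seq ts l = fold (\<lambda>t \<T>. \<Union>H\<in>\<T>. cut_tree t H) (take l ts) ((\<lambda>i. start {i}) ` {1..w})"

lemma fan_seq_0: "fan_seq ts 0 = (\<lambda>i. start {i}) ` {1..w}"
  by (simp add: fan_seq_def)

lemma fan_seq_Suc: "l < length ts \<Longrightarrow> fan_seq ts (Suc l) = (\<Union>H\<in>fan_seq ts l. cut_tree (ts ! l) H)"
  by (simp add: fan_seq_def take_Suc_conv_app_nth)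

text \<open>Geometry and algebra advance together: the fan property is what allows the next
  reduction to be read as a cut.\<close>

lemma tree_fan_seq:
  assumes "list_all valid_triple ts" "l \<le> length ts"
  shows "tree_fan (fan_seq ts l) \<and> fold reduce (take l ts) (P_poly \<nu>) = face_poly (faces (fan_seq ts l))"
  using assms(2)
proof (induction l)
  case 0
  show ?case using tree_fan_start P_poly_faces by (simp add: fan_seq_0)
next
  case (Suc l)
  then have l: "l < length ts" and IH: "tree_fan (fan_seq ts l)"
    "fold reduce (take l ts) (P_poly \<nu>) = face_poly (faces (fan_seq ts l))" by auto
  obtain i j k where t: "ts ! l = (i, j, k)" by (metis prod_cases3)
  have valid: "valid_triple (ts ! l)" using assms(1) l by (simp add: list_all_length)
  have "tree_fan (fan_seq ts (Suc l))"
    unfolding fan_seq_Suc[OF l] t by (rule tree_fan_cut[OF IH(1) valid[unfolded t]])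
  moreover have "fold reduce (take (Suc l) ts) (P_poly \<nu>) = reduce (ts ! l) (face_poly (faces (fan_seq ts l)))"
    using l IH(2) by (simp add: take_Suc_conv_app_nth)
  ultimately show ?case unfolding reduce_faces[OF IH(1) valid] fan_seq_Suc[OF l] by blast
qed

end

theorem theorem1p2:
  fixes \<nu> :: "step list" and a b :: nat
  assumes "lattice_path \<nu> a b"
  shows "encodes \<nu> (P_poly \<nu>) (simplex_subdivision \<nu>) \<and>
    (\<forall>ts. list_all valid_triple ts \<longrightarrow>
      (let p = (\<lambda>l. fold reduce (take l ts) (P_poly \<nu>)) in
       \<exists>\<C> h T. \<C> 0 = simplex_subdivision \<nu> \<and>
         (\<forall>l \<le> length ts. eq_in_subdivision_algebra (p l) (P_poly \<nu>) \<and>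
            encodes_via \<nu> (p l) (\<C> l) (h l) (T l)) \<and>
         (\<forall>l < length ts. \<C> (Suc l) = cut_subdivision \<nu> (ts ! l) (h l) (T l) (\<C> l))))"
proof (intro conjI allI impI)
  interpret valley_path \<nu> .
  show "encodes \<nu> (P_poly \<nu>) (simplex_subdivision \<nu>)"
    unfolding encodes_def P_poly_faces simplex_subdivision_cells
    using encodes_via_fan[OF tree_fan_start] by blast
  fix ts :: "(nat \<times> nat \<times> nat) list"
  assume ts: "list_all valid_triple ts"
  define \<C> where "\<C> l = cell ` fan_seq ts l" for l
  define h where "h l = face_graph (fan_seq ts l)" for l
  \<comment> \<open>One map serves all faces at all stages, so the halves produced by a cut are
    again images of flow polytopes under the same map.\<close>
  define T where "T l = (\<lambda>_ :: flow set. lift)" for l :: nat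
  have "\<C> 0 = simplex_subdivision \<nu>"
    by (simp only: \<C>_def fan_seq_0 simplex_subdivision_cells)
  moreover have "eq_in_subdivision_algebra (fold reduce (take l ts) (P_poly \<nu>)) (P_poly \<nu>) \<and>
      encodes_via \<nu> (fold reduce (take l ts) (P_poly \<nu>)) (\<C> l) (h l) (T l)" if l: "l \<le> length ts" for l
  proof
    have "list_all valid_triple (take l ts)" using ts by (auto simp: list_all_iff dest: in_set_takeD)
    then show "eq_in_subdivision_algebra (fold reduce (take l ts) (P_poly \<nu>)) (P_poly \<nu>)"
      by (rule fold_reduce_eq)
    have fan: "tree_fan (fan_seq ts l)" and p: "fold reduce (take l ts) (P_poly \<nu>) = face_poly (faces (fan_seq ts l))"
      using tree_fan_seq[OF ts l] by blast+
    show "encodes_via \<nu> (fold reduce (take l ts) (P_poly \<nu>)) (\<C> l) (h l) (T l)"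
      unfolding p \<C>_def h_def T_def by (rule encodes_via_fan[OF fan])
  qed
  moreover have "\<C> (Suc l) = cut_subdivision \<nu> (ts ! l) (h l) (T l) (\<C> l)" if l: "l < length ts" for l
  proof -
    have "tree_fan (fan_seq ts l)" using tree_fan_seq[OF ts, of l] l by simp
    moreover have "valid_triple (ts ! l)" using ts l by (simp add: list_all_length)
    ultimately show ?thesis
      unfolding \<C>_def h_def T_def fan_seq_Suc[OF l] by (rule cut_subdivision_fan[symmetric])
  qed
  ultimately show "let p = (\<lambda>l. fold reduce (take l ts) (P_poly \<nu>)) in
       \<exists>\<C> h T. \<C> 0 = simplex_subdivision \<nu> \<and>
         (\<forall>l \<le> length ts. eq_in_subdivision_algebra (p l) (P_poly \<nu>) \<and>
            encodes_via \<nu> (p l) (\<C> l) (h l) (T l)) \<and>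
         (\<forall>l < length ts. \<C> (Suc l) = cut_subdivision \<nu> (ts ! l) (h l) (T l) (\<C> l))"
    unfolding Let_def by blast
qed

end
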